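(* Assume that the problem $g(\boldsymbol P;\boldsymbol u)=0$, with $\boldsymbol P$ as parameters and $\boldsymbol u$ as solution, is Lipschitz well-posed with Lipschitz constant $\mathcal L$, and let $\mathcal G(\boldsymbol P)$ denote its solution $\boldsymbol u$. Assume moreover that $\mathbb E[\boldsymbol\sigma\boldsymbol\sigma^T]=\boldsymbol\Sigma$ and $\mathbb E[\boldsymbol\delta\boldsymbol\delta^T]=\boldsymbol\Gamma$. Then, for $\beta>0$, $$\|\boldsymbol u^{\mathrm{MAP}}-\tilde{\boldsymbol u}^{\mathrm{MAP}}_N\|_\infty\le\beta\mathcal L\Big(\|\boldsymbol\Sigma^{-1}\|_\infty+\|\boldsymbol\Gamma^{-1}\|_\infty+(1+\beta)\|\boldsymbol\Sigma^{-1/2}\|_\infty+(1+\beta)\|\boldsymbol\Gamma^{-1/2}\|_\infty\Big)$$ with probability at least $1-10\,\zeta(N,\beta)$, and $$\|\boldsymbol u^{\mathrm{MAP}}-\hat{\boldsymbol u}^{\mathrm{MAP}}_N\|_\infty\le\beta\mathcal L\Big(\|\boldsymbol\Sigma^{-1}\|_\infty+\|\boldsymbol\Gamma^{-1}\|_\infty+\|\boldsymbol\Sigma^{-1/2}\|_\infty+\|\boldsymbol\Gamma^{-1/2}\|_\infty\Big)$$ with probability at least $1-4\,\zeta(N,\beta)-2k\,\zeta_{2/3}(N,\beta)-2n\,\zeta_{2/3}(N,\beta)$.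
   Context: Fix $\mathbf d\in\mathbb R^k$, $\boldsymbol u_0\in\mathbb R^n$, symmetric positive definite covariance matrices $\boldsymbol\Sigma\in\mathbb R^{k\times k}$, $\boldsymbol\Gamma\in\mathbb R^{n\times n}$, and a differentiable map $\mathcal F:\mathbb R^n\to\mathbb R^k$; $\nabla_{\boldsymbol u}\mathcal F(\boldsymbol u)$ denotes the $n\times k$ gradient (transpose of the Jacobian). Write $\|x\|_W^2:=x^TWx$. Vector norm: $\|x\|_\infty=\max_i|x_i|$; matrix norms $\|\cdot\|_\infty$ are the induced operator norms. Random variables: $\boldsymbol\sigma,\boldsymbol\varepsilon$ (in $\mathbb R^k$) and $\boldsymbol\delta,\boldsymbol\lambda$ (in $\mathbb R^n$) are independent subgaussian random vectors with $\mathbb E[\boldsymbol\sigma]=0$, $\mathbb E[\boldsymbol\varepsilon\boldsymbol\varepsilon^T]=\boldsymbol\Sigma^{-1}$, $\mathbb E[\boldsymbol\delta]=0$, $\mathbb E[\boldsymbol\lambda\boldsymbol\lambda^T]=\boldsymbol\Gamma^{-1}$. Let $(\boldsymbol\sigma^i,\boldsymbol\varepsilon^i,\boldsymbol\delta^i,\boldsymbol\lambda^i)$, $i=1,\dots,N$, be i.i.d. samples, and set $$\boldsymbol S_N=\frac1N\sum_{i=1}^N\boldsymbol\varepsilon^i(\boldsymbol\varepsilon^i)^T,\quad \boldsymbol L_N=\frac1N\sum_{i=1}^N\boldsymbol\lambda^i(\boldsymbol\lambda^i)^T,\quad \bar{\boldsymbol\sigma}_N=\frac1N\sum_{i=1}^N\boldsymbol\sigma^i,\quad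 \bar{\boldsymbol\delta}_N=\frac1N\sum_{i=1}^N\boldsymbol\delta^i.$$ Minimizers (assumed to exist): $$\boldsymbol u^{\mathrm{MAP}}=\arg\min_{\boldsymbol u}\tfrac12\|\mathbf d-\mathcal F(\boldsymbol u)\|^2_{\boldsymbol\Sigma^{-1}}+\tfrac12\|\boldsymbol u-\boldsymbol u_0\|^2_{\boldsymbol\Gamma^{-1}},$$ $$\tilde{\boldsymbol u}^{\mathrm{MAP}}_N=\arg\min_{\boldsymbol u}\tfrac12\|\mathbf d+\bar{\boldsymbol\sigma}_N-\mathcal F(\boldsymbol u)\|^2_{\boldsymbol S_N}+\tfrac12\|\boldsymbol u-\boldsymbol u_0-\bar{\boldsymbol\delta}_N\|^2_{\boldsymbol L_N},$$ $$\hat{\boldsymbol u}^{\mathrm{MAP}}_N=\arg\min_{\boldsymbol u}\frac1N\sum_{i=1}^N\Big[\tfrac12\|(\boldsymbol\varepsilon^i)^T(\mathbf d+\boldsymbol\sigma^i-\mathcal F(\boldsymbol u))\|_2^2+\tfrac12\|(\boldsymbol\lambda^i)^T(\boldsymbol u-\boldsymbol u_0-\boldsymbol\delta^i)\|_2^2\Big].$$ Parametrized optimality system: for a parameter vector $\boldsymbol P=[\mathrm{vec}(B);\mathrm{vec}(C);\boldsymbol e;\boldsymbol z]$ with $B\in\mathbb R^{k\times k}$, $C\in\mathbb R^{n\times n}$, $\boldsymbol e\in\mathbb R^k$, $\boldsymbol z\in\mathbb R^n$ (vec is vectorization, semicolons denote concatenation), $$g(\boldsymbol P;\boldsymbol u):=\nabla_{\boldsymbol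 u}\mathcal F(\boldsymbol u)\,[B(\mathcal F(\boldsymbol u)-\mathbf d)-\boldsymbol e]+C(\boldsymbol u-\boldsymbol u_0)-\boldsymbol z.$$ The relevant parameter vectors are $\boldsymbol P^{\mathrm{MAP}}=[\mathrm{vec}(\boldsymbol\Sigma^{-1});\mathrm{vec}(\boldsymbol\Gamma^{-1});0;0]$, $\tilde{\boldsymbol P}_N=[\mathrm{vec}(\boldsymbol S_N);\mathrm{vec}(\boldsymbol L_N);\boldsymbol S_N\bar{\boldsymbol\sigma}_N;\boldsymbol L_N\bar{\boldsymbol\delta}_N]$ and $\hat{\boldsymbol P}_N=[\mathrm{vec}(\boldsymbol S_N);\mathrm{vec}(\boldsymbol L_N);\frac1N\sum_i\boldsymbol\varepsilon^i(\boldsymbol\varepsilon^i)^T\boldsymbol\sigma^i;\frac1N\sum_i\boldsymbol\lambda^i(\boldsymbol\lambda^i)^T\boldsymbol\delta^i]$. "Lipschitz well-posed with constant $\mathcal L$" means: for every $\boldsymbol P$ in the set of admissible parameters, which contains $\boldsymbol P^{\mathrm{MAP}}$ and (almost surely) $\tilde{\boldsymbol P}_N,\hat{\boldsymbol P}_N$, there is a unique solution $\boldsymbol u=\mathcal G(\boldsymbol P)$ of $g(\boldsymbol P;\boldsymbol u)=0$, and $\|\mathcal G(\boldsymbol P)-\mathcal G(\boldsymbol P')\|_\infty\le\mathcal L\|\boldsymbol P-\boldsymbol P'\|_\infty$ for all admissible $\boldsymbol P,\boldsymbol P'$. Finally, $\zeta(N,\beta):=\exp(-c\beta^2N)$ and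 $\zeta_\alpha(N,\beta):=\exp(-c\beta^\alpha N^{\alpha/2})$, where $c>0$ denotes a constant possibly depending on the dimensions but not on $N$.
   Formalization: The constant c also depends on the subgaussian constant of the noise vectors and, in the first estimate, on an arbitrary upper bound b for β (0 < β ≤ b); a c depending only on the dimensions, uniform in all β > 0, does not exist. *)

theory Defs
  imports "HOL-Probability.Probability"
begin

section \<open>Norms and matrices\<close>

text \<open>On \<^typ>\<open>real^'n\<close> the library constant \<^const>\<open>infnorm\<close> is the maximum norm
  (lemma infnorm_cart).\<close>

definition matrix_infnorm :: "real^'n^'m \<Rightarrow> real" where
  "matrix_infnorm A = (SUP x\<in>{x. infnorm x = 1}. infnorm (A *v x))"

definition sym_pos_def :: "real^'n^'n \<Rightarrow> bool" where
  "sym_pos_def A \<longleftrightarrow> transpose A = A \<and> (\<forall>x. x \<noteq> 0 \<longrightarrow> 0 < x \<bullet> (A *v x))"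

definition inv_sqrt :: "real^'n^'n \<Rightarrow> real^'n^'n" where
  "inv_sqrt A = (THE R. sym_pos_def R \<and> R ** R = matrix_inv A)"

definition outer :: "real^'n \<Rightarrow> real^'n \<Rightarrow> real^'n^'n" where
  "outer x y = (\<chi> i j. x $ i * y $ j)"

definition wnorm2 :: "real^'n^'n \<Rightarrow> real^'n \<Rightarrow> real" where
  "wnorm2 W x = x \<bullet> (W *v x)"

section \<open>Subgaussian random vectors\<close>

text \<open>The Orlicz norm of index 2 of the real random variable \<open>Y\<close> is at most \<open>t\<close>.\<close>

definition psi2_le :: "'a measure \<Rightarrow> real \<Rightarrow> ('a \<Rightarrow> real) \<Rightarrow> bool" where
  "psi2_le M t Y \<longleftrightarrow> 0 < t \<and> Y \<in> borel_measurable M \<and>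
     (\<integral>\<^sup>+\<omega>. ennreal (exp ((Y \<omega> / t)\<^sup>2)) \<partial>M) \<le> 2"

definition subgaussian :: "'a measure \<Rightarrow> ('a \<Rightarrow> real^'n) \<Rightarrow> bool" where
  "subgaussian M X \<longleftrightarrow> X \<in> borel_measurable M \<and>
     (\<exists>t. \<forall>v. norm v = 1 \<longrightarrow> psi2_le M t (\<lambda>\<omega>. v \<bullet> X \<omega>))"

text \<open>Quantitative, scale-invariant version: the Orlicz norm of every one-dimensional marginal is
  at most \<open>K\<close> times its \<open>L\<^sup>2\<close> norm. For vectors whose second moment matrix is positive definite,
  being subgaussian means having such a \<open>K\<close>; see \<open>subgaussian_iff_const\<close> below.\<close>

definition subgaussian_const :: "'a measure \<Rightarrow> real \<Rightarrow> ('a \<Rightarrow> real^'n) \<Rightarrow> bool" where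
  "subgaussian_const M K X \<longleftrightarrow> X \<in> borel_measurable M \<and>
     (\<forall>v. v \<noteq> 0 \<longrightarrow>
        psi2_le M (K * sqrt (\<integral>\<omega>. (v \<bullet> X \<omega>)\<^sup>2 \<partial>M)) (\<lambda>\<omega>. v \<bullet> X \<omega>))"

lemma psi2_le_mono:
  assumes "psi2_le M s Y" "s \<le> t"
  shows "psi2_le M t Y"
proof -
  have s: "0 < s" "0 < t" using assms by (auto simp: psi2_le_def)
  have "(Y \<omega> / t)\<^sup>2 \<le> (Y \<omega> / s)\<^sup>2" for \<omega>
  proof -
    have "\<bar>Y \<omega>\<bar> / t \<le> \<bar>Y \<omega>\<bar> / s" using s assms(2) by (intro divide_left_mono) auto
    then have "\<bar>Y \<omega> / t\<bar> \<le> \<bar>Y \<omega> / s\<bar>" using s by simp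
    then show ?thesis using abs_le_square_iff by blast
  qed
  then have "(\<integral>\<^sup>+\<omega>. ennreal (exp ((Y \<omega> / t)\<^sup>2)) \<partial>M) \<le> (\<integral>\<^sup>+\<omega>. ennreal (exp ((Y \<omega> / s)\<^sup>2)) \<partial>M)"
    by (intro nn_integral_mono ennreal_leI) simp
  also have "\<dots> \<le> 2" using assms by (simp add: psi2_le_def)
  finally show ?thesis using assms s by (simp add: psi2_le_def)
qed

lemma psi2_le_scale:
  assumes "psi2_le M t Y" "0 < a"
  shows "psi2_le M (a * t) (\<lambda>\<omega>. a * Y \<omega>)"
  using assms by (auto simp: psi2_le_def intro!: borel_measurable_times)

lemma inner_outer: "v \<bullet> (outer x x *v v) = (v \<bullet> x)\<^sup>2"
  by (simp add: outer_def inner_vec_def matrix_vector_mult_def power2_eq_square sum_product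
      sum_distrib_left sum_distrib_right mult_ac)

lemma second_moment_marginal:
  fixes X :: "'a \<Rightarrow> real^'n"
  assumes "(\<integral>\<omega>. outer (X \<omega>) (X \<omega>) \<partial>M) = Q" "sym_pos_def Q"
  shows "(\<integral>\<omega>. (v \<bullet> X \<omega>)\<^sup>2 \<partial>M) = v \<bullet> (Q *v v)"
proof -
  have "Q \<noteq> 0"
  proof
    assume "Q = 0"
    then have "\<not> 0 < (1::real^'n) \<bullet> (Q *v 1)" by simp
    moreover have "(1::real^'n) \<noteq> 0" by (simp add: vec_eq_iff)
    ultimately show False using assms(2) by (auto simp: sym_pos_def_def)
  qed
  then have int: "integrable M (\<lambda>\<omega>. outer (X \<omega>) (X \<omega>))"
    using assms(1) not_integrable_integral_eq by blast
  have "linear (\<lambda>A::real^'n^'n. v \<bullet> (A *v v))"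
    by (rule linearI) (simp_all add: matrix_vector_mult_add_rdistrib inner_add_right
        scaleR_matrix_vector_assoc[symmetric])
  then have "bounded_linear (\<lambda>A::real^'n^'n. v \<bullet> (A *v v))"
    by (rule linear_conv_bounded_linear[THEN iffD1])
  from integral_bounded_linear[OF this int] assms(1) show ?thesis
    by (simp add: inner_outer)
qed

lemma subgaussian_iff_const:
  fixes X :: "'a \<Rightarrow> real^'n"
  assumes Q: "(\<integral>\<omega>. outer (X \<omega>) (X \<omega>) \<partial>M) = Q" "sym_pos_def Q"
  shows "subgaussian M X \<longleftrightarrow> (\<exists>K>0. subgaussian_const M K X)"
proof -
  let ?q = "\<lambda>v::real^'n. sqrt (v \<bullet> (Q *v v))"
  have marg: "(\<integral>\<omega>. (v \<bullet> X \<omega>)\<^sup>2 \<partial>M) = v \<bullet> (Q *v v)" for v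
    by (rule second_moment_marginal[OF Q])
  have qpos: "0 < ?q v" if "v \<noteq> 0" for v
    using Q(2) that by (simp add: sym_pos_def_def)
  have qscale: "?q (a *\<^sub>R v) = a * ?q v" if "0 < a" for a v
  proof -
    have "(a *\<^sub>R v) \<bullet> (Q *v (a *\<^sub>R v)) = a\<^sup>2 * (v \<bullet> (Q *v v))"
      by (simp add: matrix_vector_mult_scaleR power2_eq_square)
    then show ?thesis using that by (simp add: real_sqrt_mult)
  qed
  have S: "compact (sphere (0::real^'n) 1)" "sphere (0::real^'n) 1 \<noteq> {}"
    by auto
  have cont: "continuous_on (sphere 0 1) ?q"
    by (intro continuous_intros matrix_vector_mult_linear_continuous_on)
  obtain a where a: "norm a = 1" "\<And>v. norm v = 1 \<Longrightarrow> ?q a \<le> ?q v"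
    using continuous_attains_inf[OF S cont] by auto
  obtain b where b: "norm b = 1" "\<And>v. norm v = 1 \<Longrightarrow> ?q v \<le> ?q b"
    using continuous_attains_sup[OF S cont] by auto
  have q0: "0 < ?q a" "0 < ?q b" using a(1) b(1) by (intro qpos; force)+
  show ?thesis
  proof
    assume "subgaussian M X"
    then obtain t where X: "X \<in> borel_measurable M"
      and t: "\<And>v. norm v = 1 \<Longrightarrow> psi2_le M t (\<lambda>\<omega>. v \<bullet> X \<omega>)"
      by (auto simp: subgaussian_def)
    have tpos: "0 < t" using t[OF a(1)] by (simp add: psi2_le_def)
    have "subgaussian_const M (t / ?q a) X"
      unfolding subgaussian_const_def marg
    proof (intro conjI allI impI X)
      fix v :: "real^'n" assume v: "v \<noteq> 0"
      define w where "w = inverse (norm v) *\<^sub>R v"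
      have w: "norm w = 1" "v = norm v *\<^sub>R w" using v by (auto simp: w_def)
      have nv: "0 < norm v" using v by simp
      have "t \<le> t / ?q a * ?q w"
        using a(2)[OF w(1)] q0 tpos by (simp add: field_simps)
      from psi2_le_scale[OF psi2_le_mono[OF t[OF w(1)] this] nv]
      have "psi2_le M (t / ?q a * (norm v * ?q w)) (\<lambda>\<omega>. norm v * (w \<bullet> X \<omega>))"
        by (simp add: mult_ac)
      also have "norm v * ?q w = ?q v"
        using qscale[OF nv, of w] w(2) by simp
      also have "(\<lambda>\<omega>. norm v * (w \<bullet> X \<omega>)) = (\<lambda>\<omega>. v \<bullet> X \<omega>)"
        using v by (auto simp: w_def)
      finally show "psi2_le M (t / ?q a * ?q v) (\<lambda>\<omega>. v \<bullet> X \<omega>)" .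
    qed
    then show "\<exists>K>0. subgaussian_const M K X"
      using tpos q0 by (intro exI[of _ "t / ?q a"]) simp
  next
    assume "\<exists>K>0. subgaussian_const M K X"
    then obtain K where K: "0 < K" "subgaussian_const M K X" by blast
    have "psi2_le M (K * ?q b) (\<lambda>\<omega>. v \<bullet> X \<omega>)" if "norm v = 1" for v
    proof (rule psi2_le_mono)
      have "v \<noteq> 0" using that by auto
      then show "psi2_le M (K * ?q v) (\<lambda>\<omega>. v \<bullet> X \<omega>)"
        using K(2) by (simp add: subgaussian_const_def marg)
      show "K * ?q v \<le> K * ?q b" using b(2)[OF that] K(1) by simp
    qed
    then show "subgaussian M X"
      using K(2) by (auto simp: subgaussian_def subgaussian_const_def)
  qed
qed

section \<open>Samples\<close>

text \<open>Mutual independence, by the product rule: the library's \<open>indep_vars\<close> needs a single value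
  type. Subfamilies are covered by taking some of the sets to be \<^term>\<open>UNIV\<close>.\<close>

definition indep4 ::
  "'a measure \<Rightarrow> ('a \<Rightarrow> real^'k) \<Rightarrow> ('a \<Rightarrow> real^'k) \<Rightarrow> ('a \<Rightarrow> real^'n) \<Rightarrow> ('a \<Rightarrow> real^'n) \<Rightarrow> bool"
where
  "indep4 M X1 X2 X3 X4 \<longleftrightarrow>
     X1 \<in> borel_measurable M \<and> X2 \<in> borel_measurable M \<and>
     X3 \<in> borel_measurable M \<and> X4 \<in> borel_measurable M \<and>
     (\<forall>A1\<in>sets borel. \<forall>A2\<in>sets borel. \<forall>A3\<in>sets borel. \<forall>A4\<in>sets borel.
        measure M {\<omega> \<in> space M. X1 \<omega> \<in> A1 \<and> X2 \<omega> \<in> A2 \<and> X3 \<omega> \<in> A3 \<and> X4 \<omega> \<in> A4} =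
        measure M {\<omega> \<in> space M. X1 \<omega> \<in> A1} * measure M {\<omega> \<in> space M. X2 \<omega> \<in> A2} *
        measure M {\<omega> \<in> space M. X3 \<omega> \<in> A3} * measure M {\<omega> \<in> space M. X4 \<omega> \<in> A4})"

definition iid_copies ::
  "'a measure \<Rightarrow> nat \<Rightarrow> ('a \<Rightarrow> 'b::topological_space) \<Rightarrow> (nat \<Rightarrow> 'a \<Rightarrow> 'b) \<Rightarrow> bool" where
  "iid_copies M N Z Zs \<longleftrightarrow>
     prob_space.indep_vars M (\<lambda>_. borel) Zs {1..N} \<and>
     (\<forall>i\<in>{1..N}. distr M borel (Zs i) = distr M borel Z)"

definition sample_mean :: "nat \<Rightarrow> (nat \<Rightarrow> 'b::real_vector) \<Rightarrow> 'b" where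
  "sample_mean N x = (1 / real N) *\<^sub>R (\<Sum>i=1..N. x i)"

section \<open>Objectives\<close>

definition map_objective ::
  "(real^'n \<Rightarrow> real^'k) \<Rightarrow> real^'k^'k \<Rightarrow> real^'n^'n \<Rightarrow> real^'k \<Rightarrow> real^'n \<Rightarrow> real^'n \<Rightarrow> real" where
  "map_objective F W V d u0 u = wnorm2 W (d - F u) / 2 + wnorm2 V (u - u0) / 2"

text \<open>The next two functions take the realised samples. In the first one, the residuals
  \<open>d + mean sig - F u\<close> and \<open>u - u0 - mean del\<close> arise by shifting \<open>d\<close> and \<open>u0\<close>.\<close>

definition tilde_objective ::
  "(real^'n \<Rightarrow> real^'k) \<Rightarrow> real^'k \<Rightarrow> real^'n \<Rightarrow> nat \<Rightarrow> (nat \<Rightarrow> real^'k) \<Rightarrow> (nat \<Rightarrow> real^'k) \<Rightarrow>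
   (nat \<Rightarrow> real^'n) \<Rightarrow> (nat \<Rightarrow> real^'n) \<Rightarrow> real^'n \<Rightarrow> real" where
  "tilde_objective F d u0 N sig eps del lam =
     map_objective F (sample_mean N (\<lambda>i. outer (eps i) (eps i)))
                     (sample_mean N (\<lambda>i. outer (lam i) (lam i)))
                     (d + sample_mean N sig) (u0 + sample_mean N del)"

definition hat_objective ::
  "(real^'n \<Rightarrow> real^'k) \<Rightarrow> real^'k \<Rightarrow> real^'n \<Rightarrow> nat \<Rightarrow> (nat \<Rightarrow> real^'k) \<Rightarrow> (nat \<Rightarrow> real^'k) \<Rightarrow>
   (nat \<Rightarrow> real^'n) \<Rightarrow> (nat \<Rightarrow> real^'n) \<Rightarrow> real^'n \<Rightarrow> real" where
  "hat_objective F d u0 N sig eps del lam u =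
     sample_mean N (\<lambda>i. (eps i \<bullet> (d + sig i - F u))\<^sup>2 / 2 +
                        (lam i \<bullet> (u - u0 - del i))\<^sup>2 / 2)"

section \<open>The parametrized optimality system\<close>

text \<open>The stacked vector \<open>[vec B; vec C; e; z]\<close>, indexed by the disjoint union of the index sets of
  its four blocks.\<close>

type_synonym ('k, 'n) params = "real ^ (('k \<times> 'k) + ('n \<times> 'n) + 'k + 'n)"

definition stack ::
  "real^'k^'k \<Rightarrow> real^'n^'n \<Rightarrow> real^'k \<Rightarrow> real^'n \<Rightarrow> ('k::finite, 'n::finite) params" where
  "stack B C e z = (\<chi> s. case s of
       Inl (i, j) \<Rightarrow> B $ i $ j
     | Inr (Inl (i, j)) \<Rightarrow> C $ i $ j
     | Inr (Inr (Inl i)) \<Rightarrow> e $ i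
     | Inr (Inr (Inr i)) \<Rightarrow> z $ i)"

definition par_B :: "('k::finite, 'n::finite) params \<Rightarrow> real^'k^'k" where
  "par_B P = (\<chi> i j. P $ Inl (i, j))"

definition par_C :: "('k::finite, 'n::finite) params \<Rightarrow> real^'n^'n" where
  "par_C P = (\<chi> i j. P $ Inr (Inl (i, j)))"

definition par_e :: "('k::finite, 'n::finite) params \<Rightarrow> real^'k" where
  "par_e P = (\<chi> i. P $ Inr (Inr (Inl i)))"

definition par_z :: "('k::finite, 'n::finite) params \<Rightarrow> real^'n" where
  "par_z P = (\<chi> i. P $ Inr (Inr (Inr i)))"

lemma par_stack [simp]:
  "par_B (stack B C e z) = B" "par_C (stack B C e z) = C"
  "par_e (stack B C e z) = e" "par_z (stack B C e z) = z"
  by (simp_all add: stack_def par_B_def par_C_def par_e_def par_z_def vec_eq_iff)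

definition gradient :: "(real^'n \<Rightarrow> real^'k) \<Rightarrow> real^'n \<Rightarrow> real^'k^'n" where
  "gradient F u = transpose (jacobian F (at u))"

definition opt_system ::
  "(real^'n \<Rightarrow> real^'k) \<Rightarrow> real^'k \<Rightarrow> real^'n \<Rightarrow> ('k::finite, 'n::finite) params \<Rightarrow> real^'n \<Rightarrow> real^'n"
where
  "opt_system F d u0 P u =
     gradient F u *v (par_B P *v (F u - d) - par_e P) + par_C P *v (u - u0) - par_z P"

definition opt_solution ::
  "(real^'n \<Rightarrow> real^'k) \<Rightarrow> real^'k \<Rightarrow> real^'n \<Rightarrow> ('k::finite, 'n::finite) params \<Rightarrow> real^'n" where
  "opt_solution F d u0 P = (THE u. opt_system F d u0 P u = 0)"

definition lipschitz_well_posed ::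
  "(real^'n \<Rightarrow> real^'k) \<Rightarrow> real^'k \<Rightarrow> real^'n \<Rightarrow> ('k::finite, 'n::finite) params set \<Rightarrow> real \<Rightarrow> bool"
where
  "lipschitz_well_posed F d u0 A L \<longleftrightarrow> 0 \<le> L \<and>
     (\<forall>P\<in>A. \<exists>!u. opt_system F d u0 P u = 0) \<and>
     (\<forall>P\<in>A. \<forall>P'\<in>A.
        infnorm (opt_solution F d u0 P - opt_solution F d u0 P') \<le> L * infnorm (P - P'))"

definition P_map :: "real^'k^'k \<Rightarrow> real^'n^'n \<Rightarrow> ('k::finite, 'n::finite) params" where
  "P_map Sig Gam = stack (matrix_inv Sig) (matrix_inv Gam) 0 0"

definition P_tilde ::
  "nat \<Rightarrow> (nat \<Rightarrow> real^'k) \<Rightarrow> (nat \<Rightarrow> real^'k) \<Rightarrow> (nat \<Rightarrow> real^'n) \<Rightarrow> (nat \<Rightarrow> real^'n) \<Rightarrow>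
   ('k::finite, 'n::finite) params" where
  "P_tilde N sig eps del lam =
     (let S = sample_mean N (\<lambda>i. outer (eps i) (eps i));
          T = sample_mean N (\<lambda>i. outer (lam i) (lam i))
      in stack S T (S *v sample_mean N sig) (T *v sample_mean N del))"

definition P_hat ::
  "nat \<Rightarrow> (nat \<Rightarrow> real^'k) \<Rightarrow> (nat \<Rightarrow> real^'k) \<Rightarrow> (nat \<Rightarrow> real^'n) \<Rightarrow> (nat \<Rightarrow> real^'n) \<Rightarrow>
   ('k::finite, 'n::finite) params" where
  "P_hat N sig eps del lam =
     stack (sample_mean N (\<lambda>i. outer (eps i) (eps i)))
           (sample_mean N (\<lambda>i. outer (lam i) (lam i)))
           (sample_mean N (\<lambda>i. outer (eps i) (eps i) *v sig i))
           (sample_mean N (\<lambda>i. outer (lam i) (lam i) *v del i))"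

section \<open>Failure probabilities\<close>

text \<open>Second moment matrices have exponential, not Gaussian, upper tails. Hence in a bound of the
  form \<open>10 * zeta c N \<beta>\<close> on their deviations, \<open>c\<close> can be uniform in \<open>\<beta>\<close> only on bounded ranges
  \<open>0 < \<beta> \<le> b\<close>.\<close>

definition zeta :: "real \<Rightarrow> nat \<Rightarrow> real \<Rightarrow> real" where
  "zeta c N \<beta> = exp (- c * \<beta>\<^sup>2 * real N)"

definition zeta_pow :: "real \<Rightarrow> real \<Rightarrow> nat \<Rightarrow> real \<Rightarrow> real" where
  "zeta_pow \<alpha> c N \<beta> = exp (- c * \<beta> powr \<alpha> * real N powr (\<alpha> / 2))"

end

theory Submission
  imports Defs
begin

text \<open>
  Each of the three estimators is a critical point of its objective, hence the solution
  \<open>\<G>(P)\<close> of the optimality system at its parameter vector, and Lipschitz well-posedness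
  reduces both claims to bounding the distance of the random parameter vectors from \<open>P_map\<close>.
  Let \<open>R = \<Sigma>\<^sup>-\<^sup>1\<^sup>/\<^sup>2\<close>, \<open>\<eta> = R\<^sup>-\<^sup>1 \<epsilon>\<close> and \<open>w = R \<sigma>\<close>, whose second moments are the identity. Then
  \<open>S\<^sub>N \<sigma>\<^sub>N = R (I + E) w\<^sub>N\<close>, where \<open>E\<close> is the deviation of the empirical second moment of \<open>\<eta>\<close>,
  and the mean of \<open>\<epsilon> \<epsilon>\<^sup>T \<sigma>\<close> is \<open>R\<close> times the mean of \<open>\<eta> \<eta>\<^sup>T w\<close>. The products of two
  coordinates are subexponential, which gives \<open>exp (- c \<beta>\<^sup>2 N)\<close> on bounded ranges of \<open>\<beta>\<close>;
  those of three have tails \<open>exp (- c t\<^sup>2\<^sup>/\<^sup>3)\<close>, and truncation at \<open>\<beta> N\<close> shows that this rate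
  survives for \<open>t = \<beta> N\<^sup>1\<^sup>/\<^sup>2\<close> after averaging. Union bounds cost factors that depend on the
  dimensions; they are absorbed by decreasing \<open>c\<close>, as a failure probability is at most 1.
\<close>

section \<open>Spectral theorem and inverse square roots\<close>

text \<open>The constant \<open>c\<close> is fixed before the covariances, so no tail estimate may
  see \<open>Sig\<close> or \<open>Gam\<close>: marginals are scaled to second moment at most 1,
  which makes their Orlicz norm at most \<open>K\<close>. Two scalings serve two purposes. For the
  entries of the empirical second moments, coordinates are divided by
  \<open>sqrt (matrix_infnorm Q)\<close>, where \<open>Q\<close> is the inverse covariance; undoing
  this costs exactly the factor \<open>matrix_infnorm Q\<close>. For the noise blocks, whitening
  leaves a single \<open>R\<close> outside, so only the norm of \<open>R\<close> enters. As
  parameters are compared in the maximum norm, scalar sample means suffice throughout. The second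
  claim has two obstacles: products of three subgaussian variables have in general no exponential
  moment, and all \<beta> > 0 are allowed, while the quadratic rate is uniform only on bounded
  ranges. There the second moments are therefore put through the 2/3 tails as well, whose estimate
  covers deviations of every size.\<close>

text \<open>The maximiser \<open>v\<close> of the Rayleigh quotient on the unit sphere of
  \<open>S\<close> is an eigenvector: otherwise moving from \<open>v\<close> in the direction of the
  residual \<open>w\<close> would raise the quotient to first order.\<close>

lemma self_adjoint_eigenvector:
  fixes f :: "'v::euclidean_space \<Rightarrow> 'v"
  assumes "linear f" and adj: "\<And>x y. f x \<bullet> y = x \<bullet> f y"
    and S: "subspace S" "f ` S \<subseteq> S" "S \<noteq> {0}"
  obtains v \<mu> where "v \<in> S" "norm v = 1" "f v = \<mu> *\<^sub>R v"
proof -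
  interpret linear f by fact
  obtain s where "s \<in> S" "s \<noteq> 0" using S subspace_0 by blast
  then have "s /\<^sub>R norm s \<in> S \<inter> sphere 0 1" using S(1) by (simp add: subspace_scale)
  then have ne: "S \<inter> sphere 0 1 \<noteq> {}" by blast
  have comp: "compact (S \<inter> sphere 0 1)"
    using closed_subspace[OF S(1)] by (simp add: closed_Int_compact)
  have "continuous_on (S \<inter> sphere 0 1) (\<lambda>x. x \<bullet> f x)"
    by (intro continuous_intros linear_continuous_on linear_conv_bounded_linear[THEN iffD1] assms)
  from continuous_attains_sup[OF comp ne this]
  obtain v where v: "v \<in> S" "norm v = 1"
    and max: "\<And>y. y \<in> S \<Longrightarrow> norm y = 1 \<Longrightarrow> y \<bullet> f y \<le> v \<bullet> f v" by auto
  define \<mu> where "\<mu> = v \<bullet> f v"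
  have le: "x \<bullet> f x \<le> \<mu> * (x \<bullet> x)" if "x \<in> S" for x
  proof (cases "x = 0")
    case False
    have "(x /\<^sub>R norm x) \<bullet> f (x /\<^sub>R norm x) \<le> \<mu>"
      unfolding \<mu>_def using False that S(1) by (intro max) (auto simp: subspace_scale)
    then have "(x \<bullet> f x) / (norm x)\<^sup>2 \<le> \<mu>"
      by (simp add: scale power2_eq_square divide_inverse mult_ac)
    then show ?thesis
      using False by (simp add: divide_simps power2_norm_eq_inner mult.commute)
  qed (simp add: zero)
  define w where "w = f v - \<mu> *\<^sub>R v"
  have wS: "w \<in> S" using v S by (auto simp: w_def intro!: subspace_diff subspace_scale)
  define g where "g = \<mu> * (w \<bullet> w) - w \<bullet> f w"
  \<comment> \<open>Maximality at \<open>v + t *\<^sub>R w\<close>: the first-order gain is at most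
    a second-order term.\<close>
  have *: "2 * t * (w \<bullet> w) \<le> t\<^sup>2 * g" for t
  proof -
    have "v + t *\<^sub>R w \<in> S" using v S wS by (auto intro!: subspace_add subspace_scale)
    have "v \<bullet> f w = w \<bullet> f v" using adj[of v w] by (simp add: inner_commute)
    then have e1: "(v + t *\<^sub>R w) \<bullet> f (v + t *\<^sub>R w) = v \<bullet> f v + 2 * t * (w \<bullet> f v) + t\<^sup>2 * (w \<bullet> f w)"
      by (simp add: add scale inner_add_left inner_add_right power2_eq_square algebra_simps)
    have e2: "(v + t *\<^sub>R w) \<bullet> (v + t *\<^sub>R w) = v \<bullet> v + 2 * t * (w \<bullet> v) + t\<^sup>2 * (w \<bullet> w)"
      using inner_commute[of v w]
      by (simp add: inner_add_left inner_add_right power2_eq_square algebra_simps)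
    have "v \<bullet> v = 1" using v by (simp add: norm_eq_1)
    moreover have "w \<bullet> f v = w \<bullet> w + \<mu> * (w \<bullet> v)"
      by (simp add: w_def inner_diff_right)
    ultimately have "\<mu> + 2 * t * (w \<bullet> w + \<mu> * (w \<bullet> v)) + t\<^sup>2 * (w \<bullet> f w)
        \<le> \<mu> * (1 + 2 * t * (w \<bullet> v) + t\<^sup>2 * (w \<bullet> w))"
      using le[OF \<open>v + t *\<^sub>R w \<in> S\<close>, unfolded e1 e2] by (simp add: \<mu>_def)
    then show ?thesis by (simp add: g_def algebra_simps)
  qed
  have "w \<bullet> w = 0"
  proof (rule ccontr)
    assume "w \<bullet> w \<noteq> 0"
    then have p: "w \<bullet> w > 0" using inner_ge_zero[of w] by linarith
    \<comment> \<open>For this \<open>t\<close> the right-hand side is at most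
      \<open>t * (w \<bullet> w)\<close>, half of the left-hand side, which contradicts
      positivity.\<close>
    define t where "t = (w \<bullet> w) / (\<bar>g\<bar> + 1)"
    have t: "t > 0" using p by (simp add: t_def)
    have "2 * (w \<bullet> w) \<le> t * g"
      using *[of t] t by (simp add: power2_eq_square)
    also have "t * g \<le> t * (\<bar>g\<bar> + 1)" using t by (intro mult_left_mono) auto
    also have "\<dots> = w \<bullet> w" by (simp add: t_def)
    finally show False using p by simp
  qed
  then have "f v = \<mu> *\<^sub>R v" by (simp add: w_def)
  with v show ?thesis by (rule that)
qed

text \<open>An orthonormal set of eigenvectors of maximal size spans: its orthogonal complement is
  invariant under \<open>f\<close>, and an eigenvector found there would enlarge the set. Sizes are
  bounded by the dimension, so a maximum exists.\<close>

lemma self_adjoint_eigenbasis: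
  fixes f :: "'v::euclidean_space \<Rightarrow> 'v"
  assumes "linear f" and adj: "\<And>x y. f x \<bullet> y = x \<bullet> f y"
  obtains B where "finite B" "pairwise orthogonal B" "\<And>b. b \<in> B \<Longrightarrow> norm b = 1"
    "span B = UNIV" "\<And>b. b \<in> B \<Longrightarrow> \<exists>\<mu>. f b = \<mu> *\<^sub>R b"
proof -
  define P where "P B \<longleftrightarrow> pairwise orthogonal B \<and> (\<forall>b\<in>B. norm b = 1 \<and> (\<exists>\<mu>. f b = \<mu> *\<^sub>R b))" for B
  have bound: "finite B \<and> card B \<le> DIM('v)" if "P B" for B
    using that unfolding P_def
    by (intro independent_bound pairwise_orthogonal_independent) auto
  have "P {}" by (simp add: P_def)
  then obtain B where B: "P B" and maxB: "\<And>C. P C \<Longrightarrow> card C \<le> card B"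
    using ex_has_greatest_nat[of P "{}" card "DIM('v) + 1"] bound by (metis less_Suc_eq_le Suc_eq_plus1)
  have fin: "finite B" using bound B by blast
  define S where "S = {y. \<forall>x\<in>B. orthogonal x y}"
  have "S = {0}"
  proof (rule ccontr)
    assume "S \<noteq> {0}"
    moreover have "f ` S \<subseteq> S"
      using B by (fastforce simp: S_def P_def orthogonal_def adj[symmetric])
    ultimately obtain v \<mu> where v: "v \<in> S" "norm v = 1" "f v = \<mu> *\<^sub>R v"
      using self_adjoint_eigenvector[OF assms] subspace_orthogonal_to_vectors[of B, folded S_def] by metis
    have "v \<notin> B" using v by (auto simp: S_def orthogonal_def norm_eq_1)
    moreover have "P (insert v B)"
      using B v by (auto simp: P_def S_def pairwise_insert orthogonal_commute)
    ultimately show False using maxB[of "insert v B"] fin by simp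
  qed
  have "span B = UNIV"
  proof (rule ccontr)
    assume "span B \<noteq> UNIV"
    then have "span B \<subset> span UNIV" by auto
    then obtain x where "x \<noteq> 0" "\<And>y. y \<in> span B \<Longrightarrow> orthogonal x y"
      using orthogonal_to_subspace_exists_gen by metis
    then have "x \<in> S" by (auto simp: S_def span_base orthogonal_commute)
    with \<open>S = {0}\<close> \<open>x \<noteq> 0\<close> show False by blast
  qed
  with B fin show ?thesis by (intro that) (auto simp: P_def)
qed

lemma orthonormal_expansion:
  assumes "finite B" "pairwise orthogonal B" "\<And>b. b \<in> B \<Longrightarrow> norm b = 1" "x \<in> span B"
  shows "(\<Sum>b\<in>B. (b \<bullet> x) *\<^sub>R b) = x"
proof -
  obtain u where u: "x = (\<Sum>b\<in>B. u b *\<^sub>R b)" using assms(1,4) by (auto simp: span_finite)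
  have "b \<bullet> x = u b" if "b \<in> B" for b
  proof -
    have "b \<bullet> x = (\<Sum>c\<in>B. u c * (b \<bullet> c))" by (simp add: u inner_sum_right)
    also have "\<dots> = (\<Sum>c\<in>B. if c = b then u b else 0)"
      using assms(2,3) that by (intro sum.cong) (auto simp: pairwise_def orthogonal_def norm_eq_1)
    also have "\<dots> = u b" using assms(1) that by simp
    finally show ?thesis .
  qed
  then show ?thesis by (simp add: u[symmetric] cong: sum.cong)
qed

section \<open>Positive definite square roots and inverses\<close>

lemma sym_pos_def_self_adjoint:
  assumes "sym_pos_def (A::real^'n^'n)"
  shows "(A *v x) \<bullet> y = x \<bullet> (A *v y)"
  using assms by (metis dot_lmul_matrix transpose_matrix_vector sym_pos_def_def)

text \<open>It is enough to compare both roots on an eigenbasis of \<open>R\<close>, where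
  \<open>R' ** R'\<close> acts as \<open>\<mu>\<^sup>2\<close>. Uniqueness is what gives the
  definite description in \<open>inv_sqrt\<close> its value.\<close>

lemma sym_pos_def_sqrt_unique:
  fixes R R' :: "real^'n^'n"
  assumes R: "sym_pos_def R" and R': "sym_pos_def R'" and eq: "R ** R = R' ** R'"
  shows "R = R'"
proof -
  obtain B where B: "span B = UNIV" "\<And>b. b \<in> B \<Longrightarrow> norm b = 1" "\<And>b. b \<in> B \<Longrightarrow> \<exists>\<mu>. R *v b = \<mu> *\<^sub>R b"
    using self_adjoint_eigenbasis[of "(*v) R"] sym_pos_def_self_adjoint[OF R] by (metis matrix_vector_mul_linear)
  have "R *v b = R' *v b" if b: "b \<in> B" for b
  proof -
    obtain \<mu> where \<mu>: "R *v b = \<mu> *\<^sub>R b" using B b by blast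
    have "b \<noteq> 0" using B(2)[OF b] by auto
    then have "0 < b \<bullet> (R *v b)" using R by (auto simp: sym_pos_def_def)
    then have "\<mu> > 0" using B(2)[OF b] by (simp add: \<mu> norm_eq_1)
    \<comment> \<open>\<open>w\<close> satisfies \<open>R' w = - \<mu> w\<close>, so it vanishes because \<open>R'\<close> is positive definite.\<close>
    define w where "w = R' *v b - \<mu> *\<^sub>R b"
    have "R' *v (R' *v b) = R *v (R *v b)" by (simp add: matrix_vector_mul_assoc eq)
    also have "\<dots> = \<mu>\<^sup>2 *\<^sub>R b" by (simp add: \<mu> matrix_vector_mult_scaleR power2_eq_square)
    finally have "R' *v w = - \<mu> *\<^sub>R w"
      by (simp add: w_def matrix_vector_mult_diff_distrib matrix_vector_mult_scaleR
          power2_eq_square algebra_simps)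
    then have "w \<bullet> (R' *v w) \<le> 0" using \<open>\<mu> > 0\<close> by simp
    then have "w = 0" using R' by (force simp: sym_pos_def_def)
    then show ?thesis by (simp add: w_def \<mu>)
  qed
  then have "R *v x = R' *v x" for x
    using linear_eq_on[of "(*v) R" "(*v) R'" x B] B(1) by auto
  then show ?thesis by (simp add: matrix_eq)
qed

text \<open>The spectral square root: each vector of an orthonormal eigenbasis of \<open>Q\<close>
  is multiplied by the square root of its eigenvalue.\<close>

lemma sym_pos_def_sqrt_exists:
  fixes Q :: "real^'n^'n"
  assumes Q: "sym_pos_def Q"
  obtains R where "sym_pos_def R" "R ** R = Q"
proof -
  obtain B where B: "finite B" "pairwise orthogonal B" "\<And>b. b \<in> B \<Longrightarrow> norm b = 1"
      "span B = UNIV" "\<And>b. b \<in> B \<Longrightarrow> \<exists>\<mu>. Q *v b = \<mu> *\<^sub>R b"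
    using self_adjoint_eigenbasis[of "(*v) Q"] sym_pos_def_self_adjoint[OF Q] by (metis matrix_vector_mul_linear)
  then obtain \<mu> where \<mu>: "\<And>b. b \<in> B \<Longrightarrow> Q *v b = \<mu> b *\<^sub>R b" by metis
  have \<mu>pos: "\<mu> b > 0" if b: "b \<in> B" for b
  proof -
    have "b \<noteq> 0" using B(3)[OF b] by auto
    then have "0 < b \<bullet> (Q *v b)" using Q by (auto simp: sym_pos_def_def)
    then show ?thesis using B(3)[OF b] by (simp add: \<mu>[OF b] norm_eq_1)
  qed
  have expand: "(\<Sum>b\<in>B. (b \<bullet> x) *\<^sub>R b) = x" for x
    using B by (intro orthonormal_expansion) auto
  define r where "r x = (\<Sum>b\<in>B. (sqrt (\<mu> b) * (b \<bullet> x)) *\<^sub>R b)" for x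
  have lin: "linear r"
    by (rule linearI) (simp_all add: r_def inner_add_right algebra_simps sum.distrib scaleR_sum_right)
  define R where "R = matrix r"
  have R: "R *v x = r x" for x using matrix_works[of r] lin by (simp add: R_def linear_matrix_vector_mul_eq)
  have rb: "r b = sqrt (\<mu> b) *\<^sub>R b" if b: "b \<in> B" for b
  proof -
    have "r b = (\<Sum>c\<in>B. if c = b then sqrt (\<mu> b) *\<^sub>R b else 0)"
      unfolding r_def using B(2,3) b
      by (intro sum.cong) (auto simp: pairwise_def orthogonal_def norm_eq_1)
    then show ?thesis using B(1) b by simp
  qed
  have "(R ** R) *v b = Q *v b" if "b \<in> B" for b
    using that \<mu>[OF that] \<mu>pos[OF that] rb[OF that]
    by (simp add: R linear_scale[OF lin] flip: matrix_vector_mul_assoc)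
  then have "(R ** R) *v x = Q *v x" for x
    using linear_eq_on[of "(*v) (R ** R)" "(*v) Q" x B] B(4) by auto
  then have RR: "R ** R = Q" by (simp add: matrix_eq)
  have adj: "r x \<bullet> y = x \<bullet> r y" for x y
    by (simp add: r_def inner_sum_left inner_sum_right inner_commute mult_ac)
  have "transpose R = R"
  proof -
    have "(transpose R *v x) \<bullet> y = (R *v x) \<bullet> y" for x y
      using dot_lmul_matrix[of x R y] adj by (simp add: R)
    then show ?thesis by (metis matrix_eq vector_eq_rdot)
  qed
  moreover have "0 < x \<bullet> (R *v x)" if "x \<noteq> 0" for x
  proof -
    have "x \<bullet> r x = (\<Sum>b\<in>B. sqrt (\<mu> b) * (b \<bullet> x)\<^sup>2)"
      by (simp add: r_def inner_sum_right inner_commute power2_eq_square mult_ac)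
    moreover have "\<exists>b\<in>B. b \<bullet> x \<noteq> 0"
    proof (rule ccontr)
      assume "\<not> ?thesis"
      then show False using expand[of x] that by simp
    qed
    then have "0 < (\<Sum>b\<in>B. sqrt (\<mu> b) * (b \<bullet> x)\<^sup>2)"
      using \<mu>pos B(1) by (auto intro!: sum_pos2 simp: less_imp_le)
    ultimately show ?thesis by (simp add: R)
  qed
  ultimately show ?thesis using RR by (intro that) (auto simp: sym_pos_def_def)
qed

lemma sym_pos_def_inverse:
  fixes S :: "real^'n^'n"
  assumes S: "sym_pos_def S"
  shows "matrix_inv S ** S = mat 1" "S ** matrix_inv S = mat 1" "sym_pos_def (matrix_inv S)"
proof -
  have "x = 0" if "S *v x = 0" for x
    using that S by (force simp: sym_pos_def_def)
  then have "invertible S"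
    using invertible_left_inverse matrix_left_invertible_ker by blast
  then show *: "matrix_inv S ** S = mat 1" "S ** matrix_inv S = mat 1"
    by (auto simp: matrix_inv_def invertible_def intro: someI2_ex)
  have "transpose (matrix_inv S) = matrix_inv S"
    using * S by (metis matrix_mul_assoc matrix_mul_lid matrix_mul_rid matrix_transpose_mul
      sym_pos_def_def transpose_mat)
  moreover have "0 < x \<bullet> (matrix_inv S *v x)" if "x \<noteq> 0" for x
  proof -
    define y where "y = matrix_inv S *v x"
    have x: "x = S *v y" by (simp add: y_def matrix_vector_mul_assoc *)
    with that have "y \<noteq> 0" by auto
    then have "0 < y \<bullet> (S *v y)" using S by (simp add: sym_pos_def_def)
    then show ?thesis by (simp add: y_def[symmetric] x[symmetric] inner_commute)
  qed
  ultimately show "sym_pos_def (matrix_inv S)" by (simp add: sym_pos_def_def)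
qed

lemma inv_sqrt:
  assumes "sym_pos_def S"
  shows "sym_pos_def (inv_sqrt S)" "inv_sqrt S ** inv_sqrt S = matrix_inv S"
proof -
  have "\<exists>!R. sym_pos_def R \<and> R ** R = matrix_inv S"
    using sym_pos_def_sqrt_exists[OF sym_pos_def_inverse(3)[OF assms]] sym_pos_def_sqrt_unique
    by metis
  from theI'[OF this] show "sym_pos_def (inv_sqrt S)" "inv_sqrt S ** inv_sqrt S = matrix_inv S"
    by (auto simp: inv_sqrt_def)
qed

section \<open>Tails of independent sums\<close>

text \<open>Taylor expansion with Lagrange remainder. Keeping the linear term exact means that,
  after integration, a centred variable contributes only at second order.\<close>

lemma exp_le_quadratic: "exp x \<le> 1 + x + x\<^sup>2 * exp \<bar>x\<bar>" for x :: real
proof -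
  obtain t where t: "\<bar>t\<bar> \<le> \<bar>x\<bar>" "exp x = (\<Sum>m<2. x ^ m / fact m) + exp t / fact 2 * x ^ 2"
    using Maclaurin_exp_le[of x 2] by blast
  have "exp t / 2 * x\<^sup>2 \<le> exp \<bar>x\<bar> * x\<^sup>2"
  proof (intro mult_right_mono)
    have "exp t / 2 \<le> exp t" by simp
    also have "exp t \<le> exp \<bar>x\<bar>" using t(1) by simp
    finally show "exp t / 2 \<le> exp \<bar>x\<bar>" .
  qed simp
  then show ?thesis using t(2) by (simp add: numeral_2_eq_2 mult.commute)
qed

text \<open>This and its cubic analogue trade a polynomial factor for part of an exponential
  moment.\<close>

lemma power2_le_exp: "z\<^sup>2 \<le> 2 * exp z" if "0 \<le> z" for z :: real
  using exp_lower_Taylor_quadratic[OF that] that by simp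

lemma power3_le_exp: "z ^ 3 \<le> 6 * exp z" if "0 \<le> z" for z :: real
proof -
  obtain t where "exp z = (\<Sum>m<4. z ^ m / fact m) + exp t / fact 4 * z ^ 4"
    using Maclaurin_exp_le[of z 4] by blast
  moreover have "0 \<le> exp t / fact 4 * z ^ 4" by simp
  ultimately have "z ^ 3 / 6 \<le> exp z"
    using that by (simp add: eval_nat_numeral)
  then show ?thesis by simp
qed

context prob_space
begin

text \<open>Markov's inequality for the exponential of \<open>l\<close> times the sum, whose
  expectation factorises by independence. Exponential moments are nonnegative integrals, so
  \<open>mgf\<close> carries their finiteness.\<close>

lemma chernoff:
  fixes X :: "'i \<Rightarrow> 'a \<Rightarrow> real"
  assumes I: "finite I" and ind: "indep_vars (\<lambda>_. borel) X I"
    and mgf: "\<And>i. i \<in> I \<Longrightarrow> (\<integral>\<^sup>+\<omega>. ennreal (exp (l * X i \<omega>)) \<partial>M) \<le> ennreal (exp \<kappa>)" and "0 < l"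
  shows "prob {\<omega> \<in> space M. \<tau> \<le> (\<Sum>i\<in>I. X i \<omega>)} \<le> exp (real (card I) * \<kappa> - l * \<tau>)"
proof -
  have [measurable]: "X i \<in> borel_measurable M" if "i \<in> I" for i
    using ind that by (simp add: indep_vars_def)
  have ind': "indep_vars (\<lambda>_. borel) (\<lambda>i \<omega>. ennreal (exp (l * X i \<omega>))) I"
    by (rule indep_vars_compose2[OF ind, where Y="\<lambda>_ x. ennreal (exp (l * x))"]) measurable
  have "emeasure M {\<omega> \<in> space M. \<tau> \<le> (\<Sum>i\<in>I. X i \<omega>)}
      = (\<integral>\<^sup>+\<omega>. indicator {\<omega> \<in> space M. \<tau> \<le> (\<Sum>i\<in>I. X i \<omega>)} \<omega> \<partial>M)"
    by (intro nn_integral_indicator[symmetric]) measurable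
  also have "\<dots> \<le> (\<integral>\<^sup>+\<omega>. ennreal (exp (- l * \<tau>)) * (\<Prod>i\<in>I. ennreal (exp (l * X i \<omega>))) \<partial>M)"
  proof (intro nn_integral_mono)
    fix \<omega>
    have "1 \<le> exp (- l * \<tau>) * exp (\<Sum>i\<in>I. l * X i \<omega>)" if "\<tau> \<le> (\<Sum>i\<in>I. X i \<omega>)"
      using that \<open>0 < l\<close> by (simp flip: exp_add sum_distrib_left)
    moreover have "ennreal (exp (- l * \<tau>)) * (\<Prod>i\<in>I. ennreal (exp (l * X i \<omega>)))
        = ennreal (exp (- l * \<tau>) * exp (\<Sum>i\<in>I. l * X i \<omega>))"
      by (simp add: prod_ennreal exp_sum[OF I] ennreal_mult'' prod_nonneg)
    ultimately show "indicator {\<omega> \<in> space M. \<tau> \<le> (\<Sum>i\<in>I. X i \<omega>)} \<omega>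
        \<le> ennreal (exp (- l * \<tau>)) * (\<Prod>i\<in>I. ennreal (exp (l * X i \<omega>)))"
      by (auto simp: indicator_def simp flip: ennreal_1 intro!: ennreal_leI)
  qed
  also have "\<dots> = ennreal (exp (- l * \<tau>)) * (\<Prod>i\<in>I. \<integral>\<^sup>+\<omega>. ennreal (exp (l * X i \<omega>)) \<partial>M)"
    by (subst nn_integral_cmult) (auto simp: indep_vars_nn_integral[OF I ind'])
  also have "\<dots> \<le> ennreal (exp (- l * \<tau>)) * (\<Prod>i\<in>I. ennreal (exp \<kappa>))"
    by (intro mult_left_mono prod_mono_ennreal mgf) auto
  also have "\<dots> = ennreal (exp (real (card I) * \<kappa> - l * \<tau>))"
    by (simp add: ennreal_power exp_of_nat_mult[symmetric] exp_add[symmetric] flip: ennreal_mult'')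
  finally show ?thesis by (simp add: emeasure_eq_measure)
qed

text \<open>Integrates \<open>exp_le_quadratic\<close> and closes with
  \<open>1 + x \<le> exp x\<close>. The mean is merely bounded above by \<open>m\<close>, because
  truncated variables are no longer centred.\<close>

lemma mgf_le:
  fixes X :: "'a \<Rightarrow> real"
  assumes X: "integrable M X" "expectation X \<le> m" and g: "integrable M g" "expectation g \<le> v"
    and le: "\<And>\<omega>. \<omega> \<in> space M \<Longrightarrow> (l * X \<omega>)\<^sup>2 * exp \<bar>l * X \<omega>\<bar> \<le> g \<omega>" and "0 \<le> l"
  shows "(\<integral>\<^sup>+\<omega>. ennreal (exp (l * X \<omega>)) \<partial>M) \<le> ennreal (exp (l * m + v))"
proof -
  have "(\<integral>\<^sup>+\<omega>. ennreal (exp (l * X \<omega>)) \<partial>M) \<le> (\<integral>\<^sup>+\<omega>. ennreal (1 + l * X \<omega> + g \<omega>) \<partial>M)"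
    by (intro nn_integral_mono ennreal_leI order_trans[OF exp_le_quadratic] add_left_mono le)
  also have "\<dots> = ennreal (\<integral>\<omega>. 1 + l * X \<omega> + g \<omega> \<partial>M)"
  proof (intro nn_integral_eq_integral AE_I2)
    fix \<omega> assume "\<omega> \<in> space M"
    from exp_le_quadratic[of "l * X \<omega>"] le[OF this] exp_ge_zero[of "l * X \<omega>"]
    show "0 \<le> 1 + l * X \<omega> + g \<omega>" by linarith
  qed (use X g in auto)
  also have "\<dots> \<le> ennreal (exp (l * m + v))"
  proof (intro ennreal_leI)
    have "(\<integral>\<omega>. 1 + l * X \<omega> + g \<omega> \<partial>M) = 1 + l * expectation X + expectation g"
      using X g by (simp add: prob_space)
    also have "\<dots> \<le> 1 + (l * m + v)" using X g \<open>0 \<le> l\<close> by (simp add: add_mono mult_left_mono)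
    also have "\<dots> \<le> exp (l * m + v)" by (rule exp_ge_add_one_self)
    finally show "(\<integral>\<omega>. 1 + l * X \<omega> + g \<omega> \<partial>M) \<le> exp (l * m + v)" .
  qed
  finally show ?thesis .
qed

lemma nn_integral_le_imp_integrable:
  fixes g :: "'a \<Rightarrow> real"
  assumes [measurable]: "g \<in> borel_measurable M" and "\<And>\<omega>. 0 \<le> g \<omega>" "(\<integral>\<^sup>+\<omega>. ennreal (g \<omega>) \<partial>M) \<le> ennreal D" "0 \<le> D"
  shows "integrable M g" "expectation g \<le> D"
proof -
  show *: "integrable M g"
    by (intro integrableI_bounded) (use assms(2,3) in \<open>auto simp: ennreal_less_top intro: le_less_trans\<close>)
  have "ennreal (expectation g) \<le> ennreal D"
    using nn_integral_eq_integral[OF *] assms by simp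
  then show "expectation g \<le> D" using assms by simp
qed

text \<open>Bernstein's argument with \<open>l\<close> proportional to \<open>s\<close>. Of the two
  caps in \<open>\<theta>\<close>, \<open>a / (2 * b)\<close> ensures \<open>l \<le> a / 2\<close>
  for all \<open>s \<le> b\<close>, and \<open>a\<^sup>2 / (16 * D)\<close> makes the quadratic term
  at most half of the linear gain \<open>l * s\<close>.\<close>

lemma sum_tail_exp_upper:
  fixes X :: "'i \<Rightarrow> 'a \<Rightarrow> real"
  assumes I: "finite I" and ind: "indep_vars (\<lambda>_. borel) X I"
    and mean: "\<And>i. i \<in> I \<Longrightarrow> expectation (X i) = 0"
    and D: "\<And>i. i \<in> I \<Longrightarrow> (\<integral>\<^sup>+\<omega>. ennreal (exp (a * \<bar>X i \<omega>\<bar>)) \<partial>M) \<le> ennreal D"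
    and "0 < a" "0 < D" "0 < s" "s \<le> b" and \<theta>: "\<theta> = min (a / (2 * b)) (a\<^sup>2 / (16 * D))"
  shows "prob {\<omega> \<in> space M. s * real (card I) \<le> (\<Sum>i\<in>I. X i \<omega>)}
    \<le> exp (- (\<theta> / 2) * s\<^sup>2 * real (card I))"
proof -
  define l where "l = \<theta> * s"
  have "0 < b" using assms by linarith
  have \<theta>pos: "0 < \<theta>" using \<open>0 < a\<close> \<open>0 < D\<close> \<open>0 < b\<close> by (simp add: \<theta>)
  then have "0 < l" using \<open>0 < s\<close> by (simp add: l_def)
  have "l \<le> a / (2 * b) * b" unfolding l_def using \<theta>pos \<open>0 < a\<close> assms
    by (intro mult_mono) auto
  then have l: "l \<le> a / 2" using \<open>0 < b\<close> by simp
  have "(\<integral>\<^sup>+\<omega>. ennreal (exp (l * X i \<omega>)) \<partial>M) \<le> ennreal (exp (l * 0 + l\<^sup>2 * (8 / a\<^sup>2) * D))" if i: "i \<in> I" for i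
  proof (rule mgf_le)
    have [measurable]: "X i \<in> borel_measurable M"
      using ind i by (simp add: indep_vars_def)
    have *: "integrable M (\<lambda>\<omega>. exp (a * \<bar>X i \<omega>\<bar>))" "expectation (\<lambda>\<omega>. exp (a * \<bar>X i \<omega>\<bar>)) \<le> D"
      using D[OF i] \<open>0 < D\<close> by (auto intro!: nn_integral_le_imp_integrable)
    show "integrable M (X i)"
    proof (rule Bochner_Integration.integrable_bound)
      show "integrable M (\<lambda>\<omega>. exp (a * \<bar>X i \<omega>\<bar>) / a)" using * by simp
      show "AE \<omega> in M. norm (X i \<omega>) \<le> norm (exp (a * \<bar>X i \<omega>\<bar>) / a)"
        using \<open>0 < a\<close> exp_ge_add_one_self[of "a * \<bar>X i _\<bar>"]
        by (intro AE_I2) (simp add: field_simps, smt (verit, best) exp_ge_add_one_self)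
    qed simp
    show "expectation (X i) \<le> 0" using mean[OF i] by simp
    show "integrable M (\<lambda>\<omega>. l\<^sup>2 * (8 / a\<^sup>2) * exp (a * \<bar>X i \<omega>\<bar>))" using * by simp
    show "expectation (\<lambda>\<omega>. l\<^sup>2 * (8 / a\<^sup>2) * exp (a * \<bar>X i \<omega>\<bar>)) \<le> l\<^sup>2 * (8 / a\<^sup>2) * D"
      using * by (simp add: divide_right_mono mult_left_mono)
    show "(l * X i \<omega>)\<^sup>2 * exp \<bar>l * X i \<omega>\<bar> \<le> l\<^sup>2 * (8 / a\<^sup>2) * exp (a * \<bar>X i \<omega>\<bar>)" for \<omega>
    proof -
      \<comment> \<open>\<open>z\<close> is half of the available exponent: one factor
        \<open>exp z\<close> bounds the exponential of \<open>l * X\<close>, the other bounds the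
        square of \<open>X\<close> by \<open>z\<^sup>2 \<le> 2 * exp z\<close>, which gives
        \<open>8 / a\<^sup>2\<close>.\<close>
      define z where "z = a / 2 * \<bar>X i \<omega>\<bar>"
      have z: "0 \<le> z" using \<open>0 < a\<close> by (simp add: z_def)
      have "\<bar>l * X i \<omega>\<bar> \<le> z"
        using l \<open>0 < l\<close> using mult_right_mono[OF l, of "\<bar>X i \<omega>\<bar>"] by (simp add: z_def abs_mult)
      moreover have "(X i \<omega>)\<^sup>2 = 4 / a\<^sup>2 * z\<^sup>2"
        using \<open>0 < a\<close> by (simp add: z_def power_mult_distrib power_divide)
      moreover have "4 / a\<^sup>2 * z\<^sup>2 \<le> 4 / a\<^sup>2 * (2 * exp z)"
        by (intro mult_left_mono power2_le_exp z) auto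
      ultimately have "(X i \<omega>)\<^sup>2 * exp \<bar>l * X i \<omega>\<bar> \<le> (8 / a\<^sup>2 * exp z) * exp z"
        by (intro mult_mono) auto
      also have "\<dots> = 8 / a\<^sup>2 * exp (a * \<bar>X i \<omega>\<bar>)"
        by (simp add: z_def flip: exp_add)
      finally have "l\<^sup>2 * ((X i \<omega>)\<^sup>2 * exp \<bar>l * X i \<omega>\<bar>) \<le> l\<^sup>2 * (8 / a\<^sup>2 * exp (a * \<bar>X i \<omega>\<bar>))"
        by (intro mult_left_mono) auto
      then show ?thesis by (simp add: power_mult_distrib mult_ac)
    qed
  qed (use \<open>0 < l\<close> in simp)
  then have "prob {\<omega> \<in> space M. s * real (card I) \<le> (\<Sum>i\<in>I. X i \<omega>)}
      \<le> exp (real (card I) * (l\<^sup>2 * (8 / a\<^sup>2) * D) - l * (s * real (card I)))"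
    using \<open>0 < l\<close> by (intro chernoff[OF I ind]) auto
  also have "\<dots> \<le> exp (- (\<theta> / 2) * s\<^sup>2 * real (card I))"
  proof -
    have "\<theta> \<le> a\<^sup>2 / (16 * D)" by (simp add: \<theta>)
    then have "\<theta> * (8 / a\<^sup>2) * D \<le> 1 / 2"
      using \<open>0 < a\<close> \<open>0 < D\<close> by (simp add: field_simps)
    then have "(\<theta> * s\<^sup>2 * real (card I)) * (\<theta> * (8 / a\<^sup>2) * D) \<le> (\<theta> * s\<^sup>2 * real (card I)) * (1 / 2)"
      using \<theta>pos by (intro mult_left_mono) auto
    then show ?thesis by (simp add: l_def power2_eq_square algebra_simps)
  qed
  finally show ?thesis .
qed

lemma abs_tail_le:
  fixes Y :: "'a \<Rightarrow> real"
  assumes [measurable]: "Y \<in> borel_measurable M"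
    and "prob {\<omega> \<in> space M. \<tau> \<le> Y \<omega>} \<le> p" "prob {\<omega> \<in> space M. \<tau> \<le> - Y \<omega>} \<le> p"
  shows "prob {\<omega> \<in> space M. \<tau> \<le> \<bar>Y \<omega>\<bar>} \<le> 2 * p"
proof -
  have "prob {\<omega> \<in> space M. \<tau> \<le> \<bar>Y \<omega>\<bar>}
      \<le> prob ({\<omega> \<in> space M. \<tau> \<le> Y \<omega>} \<union> {\<omega> \<in> space M. \<tau> \<le> - Y \<omega>})"
    by (intro finite_measure_mono) auto
  also have "\<dots> \<le> prob {\<omega> \<in> space M. \<tau> \<le> Y \<omega>} + prob {\<omega> \<in> space M. \<tau> \<le> - Y \<omega>}"
    by (intro measure_Un_le) auto
  finally show ?thesis using assms by linarith
qed

lemma sum_tail_exp: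
  fixes X :: "'i \<Rightarrow> 'a \<Rightarrow> real"
  assumes I: "finite I" and ind: "indep_vars (\<lambda>_. borel) X I"
    and mean: "\<And>i. i \<in> I \<Longrightarrow> expectation (X i) = 0"
    and D: "\<And>i. i \<in> I \<Longrightarrow> (\<integral>\<^sup>+\<omega>. ennreal (exp (a * \<bar>X i \<omega>\<bar>)) \<partial>M) \<le> ennreal D"
    and "0 < a" "0 < D" "0 < s" "s \<le> b" and \<theta>: "\<theta> = min (a / (2 * b)) (a\<^sup>2 / (16 * D))"
  shows "prob {\<omega> \<in> space M. s * real (card I) \<le> \<bar>\<Sum>i\<in>I. X i \<omega>\<bar>}
    \<le> 2 * exp (- (\<theta> / 2) * s\<^sup>2 * real (card I))"
proof (rule abs_tail_le)
  have "indep_vars (\<lambda>_. borel) (\<lambda>i \<omega>. - X i \<omega>) I"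
    by (rule indep_vars_compose2[OF ind, where Y="\<lambda>_ x. - x"]) measurable
  from sum_tail_exp_upper[OF I this, of a D s b \<theta>]
  show "prob {\<omega> \<in> space M. s * real (card I) \<le> - (\<Sum>i\<in>I. X i \<omega>)}
      \<le> exp (- (\<theta> / 2) * s\<^sup>2 * real (card I))"
    using assms by (simp add: sum_negf)
  show "(\<lambda>\<omega>. \<Sum>i\<in>I. X i \<omega>) \<in> borel_measurable M"
    using ind by (intro borel_measurable_sum) (simp add: indep_vars_def)
qed (rule sum_tail_exp_upper[OF assms])

section \<open>Sums of variables with an exponential moment of order 2/3\<close>

text \<open>With \<open>t = p\<^sup>3\<close>, the summands are truncated at \<open>B = t sqrt N\<close>. The parameter \<open>l\<close> of the Chernoff bound
  is chosen such that \<open>l B\<close> is at most half of \<open>a B powr (2/3)\<close>, so that the exponential moment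
  of the truncated variables is controlled, while \<open>N l\<^sup>2\<close> stays bounded.\<close>

lemma sum_tail_exp_two_thirds_upper:
  fixes X :: "'i \<Rightarrow> 'a \<Rightarrow> real"
  assumes I: "finite I" "I \<noteq> {}" and ind: "indep_vars (\<lambda>_. borel) X I"
    and mean: "\<And>i. i \<in> I \<Longrightarrow> expectation (X i) = 0"
    and D: "\<And>i. i \<in> I \<Longrightarrow> (\<integral>\<^sup>+\<omega>. ennreal (exp (a * (root 3 \<bar>X i \<omega>\<bar>)\<^sup>2)) \<partial>M) \<le> ennreal D"
    and "0 < a" "0 < D" "1 \<le> p" and V: "V = 48 * D / a ^ 3"
  shows "prob {\<omega> \<in> space M. p ^ 3 * sqrt (card I) \<le> (\<Sum>i\<in>I. X i \<omega>)}
    \<le> (exp (V * (a / 2 + a\<^sup>2 / 4)) + V) * exp (- (a / 2) * p\<^sup>2)"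
proof -
  define N where "N = card I"
  have N: "1 \<le> real N" using I by (simp add: N_def Suc_le_eq card_gt_0_iff)
  have sN: "1 \<le> sqrt N" "sqrt N * sqrt N = N" using N by auto
  have Vpos: "0 < V" using \<open>0 < a\<close> \<open>0 < D\<close> by (simp add: V)
  define l where "l = a / (2 * p * sqrt N)"
  define B where "B = p ^ 3 * sqrt N"
  have lB: "0 < l" "0 < B" using \<open>0 < a\<close> \<open>1 \<le> p\<close> N by (auto simp: l_def B_def)
  define Y where "Y i \<omega> = (if \<bar>X i \<omega>\<bar> \<le> B then X i \<omega> else 0)" for i \<omega>
  have [measurable]: "X i \<in> borel_measurable M" if "i \<in> I" for i
    using ind that by (simp add: indep_vars_def)
  have indY: "indep_vars (\<lambda>_. borel) Y I"
    unfolding Y_def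
    by (rule indep_vars_compose2[OF ind, where Y="\<lambda>_ x. if \<bar>x\<bar> \<le> B then x else 0"]) measurable
  define G where "G i \<omega> = exp (a * (root 3 \<bar>X i \<omega>\<bar>)\<^sup>2)" for i \<omega>
  have Gnn: "0 \<le> G i \<omega>" for i \<omega> by (simp add: G_def)
  have G: "integrable M (G i)" "expectation (G i) \<le> D" if i: "i \<in> I" for i
    unfolding G_def using D[OF i] i \<open>0 < D\<close> by (auto intro!: nn_integral_le_imp_integrable)
  \<comment> \<open>The exponent \<open>a / 2\<close> on the left is reserved for the moment
    generating function of the truncated variable. The other half pays for the square of
    \<open>X\<close>, which is \<open>8 / a ^ 3 * z ^ 3\<close>, through
    \<open>z ^ 3 \<le> 6 * exp z\<close>; hence \<open>48 / a ^ 3\<close> and the form of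
    \<open>V\<close>.\<close>
  have sq_le: "(X i \<omega>)\<^sup>2 * exp (a / 2 * (root 3 \<bar>X i \<omega>\<bar>)\<^sup>2) \<le> 48 / a ^ 3 * G i \<omega>" for i \<omega>
  proof -
    define q where "q = root 3 \<bar>X i \<omega>\<bar>"
    have q: "q ^ 3 = \<bar>X i \<omega>\<bar>" by (simp add: q_def odd_real_root_pow)
    define z where "z = a / 2 * q\<^sup>2"
    have "0 \<le> z" using \<open>0 < a\<close> by (simp add: z_def)
    have "(X i \<omega>)\<^sup>2 = (q ^ 3)\<^sup>2" by (simp add: q)
    also have "\<dots> = (q\<^sup>2) ^ 3" by (simp flip: power_mult)
    also have "\<dots> = 8 / a ^ 3 * z ^ 3"
      using \<open>0 < a\<close> by (simp add: z_def power_mult_distrib power_divide)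
    also have "\<dots> \<le> 8 / a ^ 3 * (6 * exp z)"
      using \<open>0 < a\<close> by (intro mult_left_mono power3_le_exp \<open>0 \<le> z\<close>) auto
    finally have "(X i \<omega>)\<^sup>2 * exp z \<le> (48 / a ^ 3 * exp z) * exp z"
      by (intro mult_right_mono) auto
    also have "\<dots> = 48 / a ^ 3 * G i \<omega>"
      by (simp add: z_def G_def q_def flip: exp_add)
    finally show ?thesis by (simp add: z_def q_def)
  qed
  have sq_le': "(X i \<omega>)\<^sup>2 \<le> 48 / a ^ 3 * G i \<omega>" for i \<omega>
  proof -
    have "(X i \<omega>)\<^sup>2 * 1 \<le> (X i \<omega>)\<^sup>2 * exp (a / 2 * (root 3 \<bar>X i \<omega>\<bar>)\<^sup>2)"
      using \<open>0 < a\<close> by (intro mult_left_mono) auto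
    with sq_le[of i \<omega>] show ?thesis by simp
  qed
  have intX2: "integrable M (\<lambda>\<omega>. (X i \<omega>)\<^sup>2)" if i: "i \<in> I" for i
  proof (rule Bochner_Integration.integrable_bound)
    show "integrable M (\<lambda>\<omega>. 48 / a ^ 3 * G i \<omega>)" using G(1)[OF i] by simp
    show "AE \<omega> in M. norm ((X i \<omega>)\<^sup>2) \<le> norm (48 / a ^ 3 * G i \<omega>)"
    proof (rule AE_I2)
      fix \<omega> show "norm ((X i \<omega>)\<^sup>2) \<le> norm (48 / a ^ 3 * G i \<omega>)"
        using order_trans[OF sq_le'[of i \<omega>] abs_ge_self] by simp
    qed
  qed (use i in simp)
  have EX2: "expectation (\<lambda>\<omega>. (X i \<omega>)\<^sup>2) \<le> V" if i: "i \<in> I" for i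
  proof -
    have "expectation (\<lambda>\<omega>. (X i \<omega>)\<^sup>2) \<le> expectation (\<lambda>\<omega>. 48 / a ^ 3 * G i \<omega>)"
      using intX2[OF i] G(1)[OF i] sq_le' by (intro integral_mono) auto
    also have "\<dots> \<le> V" using G(2)[OF i] \<open>0 < a\<close> by (simp add: V divide_right_mono)
    finally show ?thesis .
  qed
  have intX: "integrable M (X i)" if i: "i \<in> I" for i
    by (rule square_integrable_imp_integrable[OF _ intX2[OF i]]) (use i in simp)
  have EY: "integrable M (Y i)" "expectation (Y i) \<le> V / B" if i: "i \<in> I" for i
  proof -
    have [measurable]: "Y i \<in> borel_measurable M" using i unfolding Y_def by measurable
    show intY: "integrable M (Y i)"
      by (rule Bochner_Integration.integrable_bound[OF intX[OF i]]) (auto simp: Y_def)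
    \<comment> \<open>Truncation destroys centring. The new mean is that of \<open>Y - X\<close>,
      which differs from 0 only where \<open>X\<close> exceeds \<open>B\<close> in absolute value,
      and there it is at most \<open>X\<^sup>2 / B\<close>.\<close>
    have "expectation (Y i) = expectation (\<lambda>\<omega>. Y i \<omega> - X i \<omega>)"
      using intY intX[OF i] mean[OF i] by simp
    also have "\<dots> \<le> expectation (\<lambda>\<omega>. (X i \<omega>)\<^sup>2 / B)"
    proof (rule integral_mono)
      fix \<omega>
      have "- X i \<omega> * B \<le> (X i \<omega>)\<^sup>2" if "B < \<bar>X i \<omega>\<bar>"
      proof -
        have "\<bar>X i \<omega>\<bar> * B \<le> \<bar>X i \<omega>\<bar> * \<bar>X i \<omega>\<bar>" using that by (intro mult_left_mono) auto
        moreover have "- X i \<omega> * B \<le> \<bar>X i \<omega>\<bar> * B" using lB by (intro mult_right_mono) auto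
        ultimately show ?thesis by (simp add: power2_eq_square flip: abs_mult)
      qed
      then show "Y i \<omega> - X i \<omega> \<le> (X i \<omega>)\<^sup>2 / B"
        using lB by (auto simp: Y_def pos_le_divide_eq)
    qed (use intY intX[OF i] intX2[OF i] in auto)
    also have "\<dots> \<le> V / B" using EX2[OF i] lB by (simp add: divide_right_mono)
    finally show "expectation (Y i) \<le> V / B" .
  qed
  have mgf: "(\<integral>\<^sup>+\<omega>. ennreal (exp (l * Y i \<omega>)) \<partial>M) \<le> ennreal (exp (l * (V / B) + l\<^sup>2 * V))" if i: "i \<in> I" for i
  proof (rule mgf_le[OF EY[OF i]])
    show "integrable M (\<lambda>\<omega>. l\<^sup>2 * (48 / a ^ 3 * G i \<omega>))" using G(1)[OF i] by simp
    show "expectation (\<lambda>\<omega>. l\<^sup>2 * (48 / a ^ 3 * G i \<omega>)) \<le> l\<^sup>2 * V"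
      using G(2)[OF i] \<open>0 < a\<close> by (simp add: V divide_right_mono mult_left_mono)
    show "(l * Y i \<omega>)\<^sup>2 * exp \<bar>l * Y i \<omega>\<bar> \<le> l\<^sup>2 * (48 / a ^ 3 * G i \<omega>)" for \<omega>
    proof (cases "\<bar>X i \<omega>\<bar> \<le> B")
      case True
      define q where "q = root 3 \<bar>X i \<omega>\<bar>"
      have q: "q ^ 3 = \<bar>X i \<omega>\<bar>" "0 \<le> q" by (simp_all add: q_def odd_real_root_pow)
      \<comment> \<open>On the truncated range the cube root \<open>q\<close> is at most
        \<open>p * sqrt N\<close>. Replacing one of the three factors in \<open>q ^ 3\<close> by
        this bound turns \<open>l\<close> times the absolute value of \<open>X\<close> into at most
        \<open>a / 2 * q\<^sup>2\<close>.\<close>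
      have "sqrt N * 1 \<le> sqrt N * (sqrt N * sqrt N)" using N sN by (intro mult_left_mono) auto
      then have "p ^ 3 * sqrt N \<le> p ^ 3 * (sqrt N) ^ 3"
        using \<open>1 \<le> p\<close> by (intro mult_left_mono) (auto simp: power3_eq_cube mult.commute)
      with True have "q ^ 3 \<le> (p * sqrt N) ^ 3" by (simp add: q B_def power_mult_distrib)
      then have "q \<le> p * sqrt N" using \<open>1 \<le> p\<close> by (subst (asm) power_mono_iff) (auto simp: q)
      then have "q\<^sup>2 * q \<le> q\<^sup>2 * (p * sqrt N)" by (intro mult_left_mono) auto
      then have "\<bar>X i \<omega>\<bar> \<le> q\<^sup>2 * (p * sqrt N)"
        unfolding q(1)[symmetric] by (simp add: power3_eq_cube power2_eq_square)
      then have "l * \<bar>X i \<omega>\<bar> \<le> l * (q\<^sup>2 * (p * sqrt N))" using lB by (intro mult_left_mono) auto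
      also have "\<dots> = a / 2 * q\<^sup>2" using \<open>1 \<le> p\<close> N by (simp add: l_def)
      finally have "\<bar>l * X i \<omega>\<bar> \<le> a / 2 * q\<^sup>2" using lB by (simp add: abs_mult)
      then have "(X i \<omega>)\<^sup>2 * exp \<bar>l * X i \<omega>\<bar> \<le> (X i \<omega>)\<^sup>2 * exp (a / 2 * q\<^sup>2)"
        by (intro mult_left_mono) auto
      also have "\<dots> \<le> 48 / a ^ 3 * G i \<omega>" using sq_le by (simp add: q_def)
      finally have "l\<^sup>2 * ((X i \<omega>)\<^sup>2 * exp \<bar>l * X i \<omega>\<bar>) \<le> l\<^sup>2 * (48 / a ^ 3 * G i \<omega>)"
        by (intro mult_left_mono) auto
      then show ?thesis using True by (simp add: Y_def power_mult_distrib mult_ac)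
    next
      case False
      then show ?thesis using \<open>0 < a\<close> by (simp add: Y_def G_def)
    qed
  qed (use lB in simp)
  have "prob {\<omega> \<in> space M. B \<le> (\<Sum>i\<in>I. Y i \<omega>)} \<le> exp (real (card I) * (l * (V / B) + l\<^sup>2 * V) - l * B)"
    by (rule chernoff[OF I(1) indY mgf lB(1)])
  \<comment> \<open>Over all summands the shift of the mean costs \<open>V * a / (2 * p ^ 4)\<close>
    and the quadratic term \<open>V * a\<^sup>2 / (4 * p\<^sup>2)\<close>. Both are bounded since
    \<open>1 \<le> p\<close>, against the gain \<open>l * B = a / 2 * p\<^sup>2\<close>.\<close>
  also have "\<dots> \<le> exp (V * (a / 2 + a\<^sup>2 / 4) - a / 2 * p\<^sup>2)"
  proof -
    have p4: "1 \<le> p ^ 4" "1 \<le> p\<^sup>2" using \<open>1 \<le> p\<close> by (simp_all add: one_le_power)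
    have "l * B = a / 2 * p\<^sup>2"
      using \<open>1 \<le> p\<close> N by (simp add: l_def B_def power2_eq_square power3_eq_cube)
    moreover have "N * (l * (V / B)) \<le> V * (a / 2)"
    proof -
      have "N * (l * (V / B)) = V * (a / 2) / p ^ 4"
        using \<open>1 \<le> p\<close> N sN(2) by (simp add: l_def B_def field_simps eval_nat_numeral)
      also have "\<dots> \<le> V * (a / 2) / 1"
        using p4 Vpos \<open>0 < a\<close> by (intro divide_left_mono) auto
      finally show ?thesis by simp
    qed
    moreover have "N * (l\<^sup>2 * V) \<le> V * (a\<^sup>2 / 4)"
    proof -
      have "N * (l\<^sup>2 * V) = V * (a\<^sup>2 / 4) / p\<^sup>2"
        using \<open>1 \<le> p\<close> N by (simp add: l_def power_mult_distrib power_divide field_simps)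
      also have "\<dots> \<le> V * (a\<^sup>2 / 4) / 1"
        using p4 Vpos \<open>0 < a\<close> by (intro divide_left_mono) auto
      finally show ?thesis by simp
    qed
    ultimately show ?thesis by (simp add: N_def[symmetric] algebra_simps)
  qed
  also have "\<dots> = exp (V * (a / 2 + a\<^sup>2 / 4)) * exp (- (a / 2) * p\<^sup>2)"
    by (simp flip: exp_add)
  finally have trunc: "prob {\<omega> \<in> space M. B \<le> (\<Sum>i\<in>I. Y i \<omega>)} \<le> exp (V * (a / 2 + a\<^sup>2 / 4)) * exp (- (a / 2) * p\<^sup>2)" .
  \<comment> \<open>With \<open>u\<close> the cube root of the number of summands, exceeding
    \<open>B\<close> has exponent \<open>a * (p\<^sup>2 * u)\<close>, while the union bound costs
    the factor \<open>u ^ 3\<close>.\<close>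
  define u where "u = root 3 N"
  have u: "1 \<le> u" "u ^ 3 = N" using N by (auto simp: u_def odd_real_root_pow)
  have large: "prob {\<omega> \<in> space M. B < \<bar>X i \<omega>\<bar>} \<le> D * exp (- (a * (p\<^sup>2 * u)))" if i: "i \<in> I" for i
  proof -
    have "{\<omega> \<in> space M. B < \<bar>X i \<omega>\<bar>} \<subseteq> {\<omega> \<in> space M. G i \<omega> \<ge> exp (a * (p\<^sup>2 * u))}"
    proof safe
      fix \<omega> assume "B < \<bar>X i \<omega>\<bar>"
      then have "root 3 B \<le> root 3 \<bar>X i \<omega>\<bar>" by simp
      then have "(root 3 B)\<^sup>2 \<le> (root 3 \<bar>X i \<omega>\<bar>)\<^sup>2" using lB by (intro power_mono) auto
      moreover have "(root 3 B)\<^sup>2 = p\<^sup>2 * u"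
      proof -
        have "root 3 B = p * root 3 (sqrt N)"
          using \<open>1 \<le> p\<close> by (simp add: B_def real_root_mult real_root_power_cancel)
        moreover have "(root 3 (sqrt N))\<^sup>2 = root 3 ((sqrt N)\<^sup>2)"
          by (rule real_root_power[symmetric]) simp
        ultimately show ?thesis using N by (simp add: power_mult_distrib u_def)
      qed
      ultimately show "exp (a * (p\<^sup>2 * u)) \<le> G i \<omega>" using \<open>0 < a\<close> by (simp add: G_def)
    qed
    then have "prob {\<omega> \<in> space M. B < \<bar>X i \<omega>\<bar>} \<le> prob {\<omega> \<in> space M. G i \<omega> \<ge> exp (a * (p\<^sup>2 * u))}"
      using G(1)[OF i] by (intro finite_measure_mono) auto
    also have "\<dots> \<le> expectation (G i) / exp (a * (p\<^sup>2 * u))"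
      using G(1)[OF i] by (intro integral_Markov_inequality_measure[where A="{}"]) (auto simp: Gnn)
    also have "\<dots> \<le> D / exp (a * (p\<^sup>2 * u))" using G(2)[OF i] by (intro divide_right_mono) auto
    finally show ?thesis by (simp add: exp_minus divide_inverse)
  qed
  have "prob (\<Union>i\<in>I. {\<omega> \<in> space M. B < \<bar>X i \<omega>\<bar>}) \<le> (\<Sum>i\<in>I. prob {\<omega> \<in> space M. B < \<bar>X i \<omega>\<bar>})"
    using I by (intro measure_UNION_le) auto
  also have "\<dots> \<le> (\<Sum>i\<in>I. D * exp (- (a * (p\<^sup>2 * u))))" by (intro sum_mono large)
  also have "\<dots> = D * (u ^ 3 * exp (- (a * (p\<^sup>2 * u))))" by (simp add: u N_def)
  also have "\<dots> \<le> V * exp (- (a / 2) * p\<^sup>2)"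
  proof -
    have "u ^ 3 \<le> 48 / a ^ 3 * exp (a / 2 * u)"
    proof -
      have "(a / 2 * u) ^ 3 \<le> 6 * exp (a / 2 * u)" using \<open>0 < a\<close> u by (intro power3_le_exp) auto
      then show ?thesis using \<open>0 < a\<close> by (simp add: power_mult_distrib power_divide field_simps)
    qed
    \<comment> \<open>As \<open>p\<^sup>2\<close> and \<open>u\<close> are both at least 1, their
      product dominates their mean. The share \<open>a / 2 * u\<close> of the exponent then pays for
      \<open>u ^ 3\<close>.\<close>
    moreover have "exp (- (a * (p\<^sup>2 * u))) \<le> exp (- (a / 2) * p\<^sup>2 - a / 2 * u)"
    proof -
      have "1 \<le> p\<^sup>2" using \<open>1 \<le> p\<close> by (simp add: one_le_power)
      then have "0 \<le> p\<^sup>2 * (u - 1) + u * (p\<^sup>2 - 1)" using u(1)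
        by (intro add_nonneg_nonneg mult_nonneg_nonneg) auto
      then have "p\<^sup>2 + u \<le> 2 * (p\<^sup>2 * u)" by (simp add: algebra_simps)
      then have "a / 2 * (p\<^sup>2 + u) \<le> a / 2 * (2 * (p\<^sup>2 * u))"
        using \<open>0 < a\<close> by (intro mult_left_mono) auto
      then show ?thesis by (simp add: algebra_simps)
    qed
    ultimately have "u ^ 3 * exp (- (a * (p\<^sup>2 * u)))
        \<le> 48 / a ^ 3 * exp (a / 2 * u) * exp (- (a / 2) * p\<^sup>2 - a / 2 * u)"
      using \<open>0 < a\<close> by (intro mult_mono) auto
    also have "\<dots> = 48 / a ^ 3 * exp (- (a / 2) * p\<^sup>2)" by (simp flip: exp_add)
    finally have "D * (u ^ 3 * exp (- (a * (p\<^sup>2 * u)))) \<le> D * (48 / a ^ 3 * exp (- (a / 2) * p\<^sup>2))"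
      using \<open>0 < D\<close> by (intro mult_left_mono) auto
    then show ?thesis by (simp add: V mult_ac)
  qed
  finally have large': "prob (\<Union>i\<in>I. {\<omega> \<in> space M. B < \<bar>X i \<omega>\<bar>}) \<le> V * exp (- (a / 2) * p\<^sup>2)" .
  have "{\<omega> \<in> space M. B \<le> (\<Sum>i\<in>I. X i \<omega>)}
      \<subseteq> {\<omega> \<in> space M. B \<le> (\<Sum>i\<in>I. Y i \<omega>)} \<union> (\<Union>i\<in>I. {\<omega> \<in> space M. B < \<bar>X i \<omega>\<bar>})"
  proof safe
    fix \<omega> assume "\<omega> \<in> space M" "B \<le> (\<Sum>i\<in>I. X i \<omega>)" "\<omega> \<notin> (\<Union>i\<in>I. {\<omega> \<in> space M. B < \<bar>X i \<omega>\<bar>})"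
    moreover from this have "(\<Sum>i\<in>I. Y i \<omega>) = (\<Sum>i\<in>I. X i \<omega>)"
      by (intro sum.cong) (auto simp: Y_def not_less)
    ultimately show "B \<le> (\<Sum>i\<in>I. Y i \<omega>)" by simp
  qed
  moreover
  have [measurable]: "Y i \<in> borel_measurable M" if "i \<in> I" for i
    using indY that by (simp add: indep_vars_def)
  have ev: "{\<omega> \<in> space M. B \<le> (\<Sum>i\<in>I. Y i \<omega>)} \<in> events"
      "(\<Union>i\<in>I. {\<omega> \<in> space M. B < \<bar>X i \<omega>\<bar>}) \<in> events"
    using I(1) by (measurable, intro sets.finite_UN) auto
  ultimately have "prob {\<omega> \<in> space M. B \<le> (\<Sum>i\<in>I. X i \<omega>)}
      \<le> prob ({\<omega> \<in> space M. B \<le> (\<Sum>i\<in>I. Y i \<omega>)} \<union> (\<Union>i\<in>I. {\<omega> \<in> space M. B < \<bar>X i \<omega>\<bar>}))"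
    using ev by (intro finite_measure_mono sets.Un)
  also have "\<dots> \<le> prob {\<omega> \<in> space M. B \<le> (\<Sum>i\<in>I. Y i \<omega>)} + prob (\<Union>i\<in>I. {\<omega> \<in> space M. B < \<bar>X i \<omega>\<bar>})"
    using ev by (intro measure_Un_le)
  finally show ?thesis using trunc large' by (simp add: B_def N_def distrib_right)
qed

text \<open>For \<open>p < 1\<close> the summand \<open>exp (a / 2)\<close> of the prefactor makes
  the bound exceed 1; for \<open>1 \<le> p\<close> the one-sided estimate is applied to
  \<open>X\<close> and \<open>- X\<close>.\<close>

lemma sum_tail_exp_two_thirds:
  fixes X :: "'i \<Rightarrow> 'a \<Rightarrow> real"
  assumes I: "finite I" "I \<noteq> {}" and ind: "indep_vars (\<lambda>_. borel) X I"
    and mean: "\<And>i. i \<in> I \<Longrightarrow> expectation (X i) = 0"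
    and D: "\<And>i. i \<in> I \<Longrightarrow> (\<integral>\<^sup>+\<omega>. ennreal (exp (a * (root 3 \<bar>X i \<omega>\<bar>)\<^sup>2)) \<partial>M) \<le> ennreal D"
    and "0 < a" "0 < D" "0 < p" and V: "V = 48 * D / a ^ 3"
  shows "prob {\<omega> \<in> space M. p ^ 3 * sqrt (card I) \<le> \<bar>\<Sum>i\<in>I. X i \<omega>\<bar>}
    \<le> (exp (a / 2) + 2 * (exp (V * (a / 2 + a\<^sup>2 / 4)) + V)) * exp (- (a / 2) * p\<^sup>2)"
proof (cases "1 \<le> p")
  case True
  have "prob {\<omega> \<in> space M. p ^ 3 * sqrt (card I) \<le> \<bar>\<Sum>i\<in>I. X i \<omega>\<bar>}
      \<le> 2 * ((exp (V * (a / 2 + a\<^sup>2 / 4)) + V) * exp (- (a / 2) * p\<^sup>2))"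
  proof (rule abs_tail_le)
    have "indep_vars (\<lambda>_. borel) (\<lambda>i \<omega>. - X i \<omega>) I"
      by (rule indep_vars_compose2[OF ind, where Y="\<lambda>_ x. - x"]) measurable
    from sum_tail_exp_two_thirds_upper[OF I this, of a D p V]
    show "prob {\<omega> \<in> space M. p ^ 3 * sqrt (card I) \<le> - (\<Sum>i\<in>I. X i \<omega>)}
        \<le> (exp (V * (a / 2 + a\<^sup>2 / 4)) + V) * exp (- (a / 2) * p\<^sup>2)"
      using assms True by (simp add: sum_negf)
    show "(\<lambda>\<omega>. \<Sum>i\<in>I. X i \<omega>) \<in> borel_measurable M"
      using ind by (intro borel_measurable_sum) (simp add: indep_vars_def)
  qed (use sum_tail_exp_two_thirds_upper[OF assms(1-7) True V] in simp)
  then show ?thesis by (simp add: distrib_right mult.assoc add_increasing)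
next
  case False
  have "1 \<le> exp (a / 2) * exp (- (a / 2) * p\<^sup>2)"
    using False \<open>0 < p\<close> \<open>0 < a\<close> by (simp add: power_le_one flip: exp_add)
  also have "\<dots> \<le> (exp (a / 2) + 2 * (exp (V * (a / 2 + a\<^sup>2 / 4)) + V)) * exp (- (a / 2) * p\<^sup>2)"
    using \<open>0 < a\<close> \<open>0 < D\<close> by (intro mult_right_mono) (auto simp: V)
  finally show ?thesis using prob_le_1 order_trans by blast
qed

end

section \<open>Optimality conditions\<close>

text \<open>A real supremum is informative only over a bounded set, so finiteness comes first, from
  the equivalence of maximum and Euclidean norm. Testing on coordinate vectors bounds the
  entries.\<close>

lemma matrix_infnorm_bounds:
  fixes A :: "real^'n^'m"
  shows infnorm_matrix_vector_le: "infnorm (A *v x) \<le> matrix_infnorm A * infnorm x"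
    and entry_le_matrix_infnorm: "\<bar>A $ i $ j\<bar> \<le> matrix_infnorm A"
    and matrix_infnorm_nonneg: "0 \<le> matrix_infnorm A"
proof -
  obtain K where K: "\<And>x. norm (A *v x) \<le> norm x * K"
    using bounded_linear.bounded[OF matrix_vector_mul_bounded_linear[of A]] by blast
  have bdd: "bdd_above ((\<lambda>x. infnorm (A *v x)) ` {x. infnorm x = 1})"
  proof (rule bdd_aboveI2)
    fix x :: "real^'n" assume "x \<in> {x. infnorm x = 1}"
    then have x: "norm x \<le> sqrt DIM(real^'n)" using norm_le_infnorm[of x] by simp
    have "infnorm (A *v x) \<le> norm x * K" using infnorm_le_norm K order_trans by blast
    also have "\<dots> \<le> norm x * \<bar>K\<bar>" by (intro mult_left_mono) auto
    also have "\<dots> \<le> sqrt DIM(real^'n) * \<bar>K\<bar>" using x by (intro mult_right_mono) auto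
    finally show "infnorm (A *v x) \<le> sqrt DIM(real^'n) * \<bar>K\<bar>" .
  qed
  have unit: "infnorm (A *v x) \<le> matrix_infnorm A" if "infnorm x = 1" for x
    unfolding matrix_infnorm_def using that bdd by (intro cSUP_upper) auto
  show "infnorm (A *v x) \<le> matrix_infnorm A * infnorm x" for x
  proof (cases "x = 0")
    case False
    then have pos: "0 < infnorm x" by (simp add: infnorm_pos_lt)
    have "infnorm (A *v (inverse (infnorm x) *\<^sub>R x)) \<le> matrix_infnorm A"
      using pos by (intro unit) (simp add: infnorm_mul)
    then show ?thesis using pos by (simp add: matrix_vector_mult_scaleR infnorm_mul field_simps)
  qed (simp add: infnorm_0)
  have ax: "infnorm (axis j 1 :: real^'n) = 1" for j :: 'n
  proof (rule antisym)
    show "infnorm (axis j 1 :: real^'n) \<le> 1"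
      using infnorm_le_norm[of "axis j 1 :: real^'n"] by simp
    show "1 \<le> infnorm (axis j 1 :: real^'n)"
      using component_le_infnorm_cart[of "axis j 1 :: real^'n" j] by simp
  qed
  show *: "\<bar>A $ i $ j\<bar> \<le> matrix_infnorm A" for i j
  proof -
    have "\<bar>A $ i $ j\<bar> = \<bar>(A *v axis j 1) $ i\<bar>" by (simp add: matrix_vector_mult_basis column_def)
    also have "\<dots> \<le> infnorm (A *v axis j 1)" by (rule component_le_infnorm_cart)
    also have "\<dots> \<le> matrix_infnorm A" by (intro unit ax)
    finally show ?thesis .
  qed
  show "0 \<le> matrix_infnorm A" using * abs_ge_zero order_trans by blast
qed

lemma infnorm_le_cartI:
  fixes x :: "real^'n"
  assumes "\<And>i. \<bar>x $ i\<bar> \<le> B"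
  shows "infnorm x \<le> B"
  unfolding infnorm_cart using assms by (intro cSup_least) auto

lemma infnorm_stack_diff_le:
  fixes B B' :: "real^'k^'k" and C C' :: "real^'n^'n"
  assumes "\<And>i j. \<bar>B $ i $ j - B' $ i $ j\<bar> \<le> r" "\<And>i j. \<bar>C $ i $ j - C' $ i $ j\<bar> \<le> r"
    and "infnorm (e - e') \<le> r" "infnorm (z - z') \<le> r"
  shows "infnorm (stack B C e z - stack B' C' e' z') \<le> r"
proof (rule infnorm_le_cartI)
  fix s
  have "\<bar>(e - e') $ i\<bar> \<le> r" "\<bar>(z - z') $ j\<bar> \<le> r" for i j
    using assms(3,4) component_le_infnorm_cart order_trans by blast+
  with assms(1,2) show "\<bar>(stack B C e z - stack B' C' e' z') $ s\<bar> \<le> r"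
    by (auto simp: stack_def split: sum.split)
qed

section \<open>First-order conditions for the three objectives\<close>

text \<open>Symmetry of \<open>W\<close> merges the two terms of the product rule. The vector
  \<open>a\<close> is the place where noise enters the objectives.\<close>

lemma has_derivative_quadratic_form:
  fixes W :: "real^'m^'m"
  assumes f: "(f has_derivative f') (at u)" and W: "transpose W = W"
  shows "((\<lambda>u. wnorm2 W (f u) / 2 - a \<bullet> f u) has_derivative (\<lambda>h. (W *v f u - a) \<bullet> f' h)) (at u)"
proof -
  have W: "x \<bullet> (W *v y) = (W *v x) \<bullet> y" for x y
    using W by (metis dot_lmul_matrix transpose_matrix_vector)
  have "((\<lambda>u. f u \<bullet> (W *v f u)) has_derivative (\<lambda>h. f u \<bullet> (W *v f' h) + f' h \<bullet> (W *v f u))) (at u)"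
    by (intro has_derivative_inner f bounded_linear.has_derivative[OF matrix_vector_mul_bounded_linear])
  then have "((\<lambda>u. f u \<bullet> (W *v f u) / 2 - a \<bullet> f u) has_derivative
      (\<lambda>h. (f u \<bullet> (W *v f' h) + f' h \<bullet> (W *v f u)) / 2 - a \<bullet> f' h)) (at u)"
    by (intro has_derivative_diff has_derivative_inner_right f bounded_linear.has_derivative[OF bounded_linear_divide])
  moreover have "(f u \<bullet> (W *v f' h) + f' h \<bullet> (W *v f u)) / 2 - a \<bullet> f' h = (W *v f u - a) \<bullet> f' h" for h
    using W[of "f u" "f' h"] by (simp add: inner_diff_left inner_diff_right inner_commute)
  ultimately show ?thesis by (simp add: wnorm2_def)
qed

text \<open>Fermat's rule, proved once for the shape shared by all three objectives: quadratic forms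
  in \<open>F v - d\<close> and \<open>v - u0\<close>, linear terms and a constant. The parameter
  blocks \<open>e\<close> and \<open>z\<close> are the coefficients of the linear terms.\<close>

lemma minimizer_solves_opt_system:
  fixes F :: "real^'n \<Rightarrow> real^'k"
  assumes F: "F differentiable (at u)" and B: "transpose B = B" and C: "transpose C = C"
    and min: "is_arg_min obj (\<lambda>_. True) u"
    and obj: "\<And>v. obj v = (wnorm2 B (F v - d) / 2 - e \<bullet> (F v - d))
      + (wnorm2 C (v - u0) / 2 - z \<bullet> (v - u0)) + r"
  shows "opt_system F d u0 (stack B C e z) u = 0"
proof -
  define J where "J = jacobian F (at u)"
  have J: "(F has_derivative (\<lambda>h. J *v h)) (at u)"
    using F jacobian_works by (auto simp: J_def)
  have "(obj has_derivative (\<lambda>h. ((B *v (F u - d) - e) \<bullet> (J *v h) + (C *v (u - u0) - z) \<bullet> h) + 0)) (at u)"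
    unfolding obj by (intro has_derivative_add has_derivative_const has_derivative_quadratic_form B C)
      (auto intro!: derivative_eq_intros J)
  moreover have "\<forall>y\<in>UNIV. obj u \<le> obj y"
    using min by (auto simp: is_arg_min_def not_less)
  ultimately have "(\<lambda>h. ((B *v (F u - d) - e) \<bullet> (J *v h) + (C *v (u - u0) - z) \<bullet> h) + 0) = (\<lambda>h. 0)"
    by (intro differential_zero_maxmin[of u UNIV obj]) auto
  then have "(B *v (F u - d) - e) \<bullet> (J *v h) + (C *v (u - u0) - z) \<bullet> h = 0" for h
    by (metis add.right_neutral)
  \<comment> \<open>Transposition moves the Jacobian off \<open>h\<close>, so the derivative becomes
    the inner product of \<open>h\<close> with the left-hand side of the optimality system.\<close>
  then have "(transpose J *v (B *v (F u - d) - e) + (C *v (u - u0) - z)) \<bullet> h = 0" for h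
    by (simp add: inner_add_left transpose_matrix_vector dot_lmul_matrix)
  then have "transpose J *v (B *v (F u - d) - e) + (C *v (u - u0) - z) = 0"
    using inner_eq_zero_iff by blast
  then show ?thesis by (simp add: opt_system_def gradient_def J_def algebra_simps)
qed

text \<open>Uniqueness identifies any solution of the system with the value of
  \<open>opt_solution\<close>, so the Lipschitz estimate applies to critical points.\<close>

lemma lipschitz_well_posed_le:
  assumes "lipschitz_well_posed F d u0 A L" "P \<in> A" "P' \<in> A"
    "opt_system F d u0 P u = 0" "opt_system F d u0 P' u' = 0"
  shows "infnorm (u - u') \<le> L * infnorm (P - P')"
proof -
  have "opt_solution F d u0 P = u" "opt_solution F d u0 P' = u'"
    using assms by (auto simp: lipschitz_well_posed_def opt_solution_def intro!: the1_equality)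
  with assms(1-3) show ?thesis unfolding lipschitz_well_posed_def by metis
qed

lemma outer_mult_vec: "outer x y *v z = (y \<bullet> z) *\<^sub>R x"
  by (simp add: vec_eq_iff outer_def matrix_vector_mult_def inner_vec_def sum_distrib_left
      sum_distrib_right mult_ac)

lemma transpose_sample_mean_outer:
  "transpose (sample_mean N (\<lambda>i. outer (x i) (x i))) = sample_mean N (\<lambda>i. outer (x i) (x i))"
  by (simp add: vec_eq_iff transpose_def sample_mean_def outer_def mult.commute)

lemma bounded_linear_sample_mean:
  "bounded_linear f \<Longrightarrow> f (sample_mean N x) = sample_mean N (\<lambda>i. f (x i))"
  by (simp add: sample_mean_def linear_scale linear_sum bounded_linear.linear)
  
lemma sample_mean_mult_vec:
  fixes W :: "nat \<Rightarrow> real^'n^'m"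
  shows "sample_mean N W *v v = sample_mean N (\<lambda>i. W i *v v)"
proof -
  have "bounded_linear (\<lambda>A::real^'n^'m. A *v v)"
    by (intro linear_conv_bounded_linear[THEN iffD1] linearI)
      (simp_all add: matrix_vector_mult_add_rdistrib scaleR_matrix_vector_assoc)
  then show ?thesis by (rule bounded_linear_sample_mean)
qed

lemma wnorm2_diff:
  assumes "transpose W = W"
  shows "wnorm2 W (x - y) = wnorm2 W x - 2 * ((W *v y) \<bullet> x) + wnorm2 W y"
proof -
  have "y \<bullet> (W *v x) = (W *v y) \<bullet> x"
    using assms by (metis dot_lmul_matrix transpose_matrix_vector)
  then show ?thesis
    by (simp add: wnorm2_def matrix_vector_mult_diff_distrib inner_diff_left inner_diff_right
        inner_commute)
qed

lemma wnorm2_minus: "wnorm2 W (- x) = wnorm2 W x"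
  by (simp add: wnorm2_def linear_neg[OF matrix_vector_mul_linear])

text \<open>Shifting the data changes the quadratic forms only by linear terms with coefficients
  \<open>B *v s\<close> and \<open>C *v t\<close> and by a constant. Zero shifts give the noise-free
  objective; the sample means of the noise give \<open>tilde_objective\<close>.\<close>

lemma map_objective_expand:
  assumes B: "transpose B = B" and C: "transpose C = C"
  obtains r where "\<And>v. map_objective F B C (d + s) (u0 + t) v
    = (wnorm2 B (F v - d) / 2 - (B *v s) \<bullet> (F v - d))
      + (wnorm2 C (v - u0) / 2 - (C *v t) \<bullet> (v - u0)) + r"
proof
  fix v
  have "wnorm2 B (d + s - F v) = wnorm2 B (F v - d - s)"
    using wnorm2_minus[of B "F v - d - s"] by (simp add: algebra_simps)
  moreover have "v - (u0 + t) = v - u0 - t" by simp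
  ultimately show "map_objective F B C (d + s) (u0 + t) v
    = (wnorm2 B (F v - d) / 2 - (B *v s) \<bullet> (F v - d))
      + (wnorm2 C (v - u0) / 2 - (C *v t) \<bullet> (v - u0)) + (wnorm2 B s / 2 + wnorm2 C t / 2)"
    by (simp only: map_objective_def wnorm2_diff[OF B] wnorm2_diff[OF C]) (simp add: field_simps)
qed

lemma map_minimizer_solves:
  assumes "sym_pos_def Sig" "sym_pos_def Gam" "F differentiable (at u)"
    "is_arg_min (map_objective F (matrix_inv Sig) (matrix_inv Gam) d u0) (\<lambda>_. True) u"
  shows "opt_system F d u0 (P_map Sig Gam) u = 0"
proof -
  have BC: "transpose (matrix_inv Sig) = matrix_inv Sig" "transpose (matrix_inv Gam) = matrix_inv Gam"
    using sym_pos_def_inverse(3) assms(1,2) by (auto simp: sym_pos_def_def)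
  obtain r where r: "\<And>v. map_objective F (matrix_inv Sig) (matrix_inv Gam) (d + 0) (u0 + 0) v
    = (wnorm2 (matrix_inv Sig) (F v - d) / 2 - (matrix_inv Sig *v 0) \<bullet> (F v - d))
      + (wnorm2 (matrix_inv Gam) (v - u0) / 2 - (matrix_inv Gam *v 0) \<bullet> (v - u0)) + r"
    using map_objective_expand[OF BC, where s=0 and t=0] by blast
  show ?thesis unfolding P_map_def
    by (rule minimizer_solves_opt_system[OF assms(3) BC assms(4)]) (use r in simp)
qed

lemma tilde_minimizer_solves:
  assumes "F differentiable (at u)"
    "is_arg_min (tilde_objective F d u0 N sig eps del lam) (\<lambda>_. True) u"
  shows "opt_system F d u0 (P_tilde N sig eps del lam) u = 0"
proof -
  obtain r where r: "\<And>v. tilde_objective F d u0 N sig eps del lam v =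
    (let S = sample_mean N (\<lambda>i. outer (eps i) (eps i)); T = sample_mean N (\<lambda>i. outer (lam i) (lam i)) in
      (wnorm2 S (F v - d) / 2 - (S *v sample_mean N sig) \<bullet> (F v - d))
      + (wnorm2 T (v - u0) / 2 - (T *v sample_mean N del) \<bullet> (v - u0)) + r)"
    unfolding tilde_objective_def Let_def
    using map_objective_expand[OF transpose_sample_mean_outer[of N eps] transpose_sample_mean_outer[of N lam],
        of F d "sample_mean N sig" u0 "sample_mean N del"] by blast
  show ?thesis unfolding P_tilde_def Let_def
    by (rule minimizer_solves_opt_system[OF assms(1) transpose_sample_mean_outer
          transpose_sample_mean_outer assms(2)]) (use r in \<open>simp add: Let_def\<close>)
qed

lemma wnorm2_sample_mean_outer:
  "wnorm2 (sample_mean N (\<lambda>i. outer (x i) (x i))) v = sample_mean N (\<lambda>i. (x i \<bullet> v)\<^sup>2)"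
proof -
  have "wnorm2 (sample_mean N (\<lambda>i. outer (x i) (x i))) v
      = sample_mean N (\<lambda>i. v \<bullet> (outer (x i) (x i) *v v))"
    unfolding wnorm2_def sample_mean_mult_vec
    by (rule bounded_linear_sample_mean) (rule bounded_linear_inner_right)
  then show ?thesis by (simp add: outer_mult_vec power2_eq_square inner_commute)
qed

lemma inner_sample_mean_outer:
  "sample_mean N (\<lambda>i. outer (x i) (x i) *v s i) \<bullet> v = sample_mean N (\<lambda>i. (x i \<bullet> s i) * (x i \<bullet> v))"
  using bounded_linear_sample_mean[OF bounded_linear_inner_left, of N "\<lambda>i. outer (x i) (x i) *v s i" v]
  by (simp add: outer_mult_vec)

text \<open>Here noise and weight belong to the same sample: half the squared residual has the cross
  term \<open>- (eps i \<bullet> sig i) * (eps i \<bullet> (F v - d))\<close>, so the linear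
  coefficient is the mean of the products \<open>outer (eps i) (eps i) *v sig i\<close> and not a
  product of means.\<close>

lemma hat_minimizer_solves:
  assumes "F differentiable (at u)"
    "is_arg_min (hat_objective F d u0 N sig eps del lam) (\<lambda>_. True) u"
  shows "opt_system F d u0 (P_hat N sig eps del lam) u = 0"
proof -
  have "hat_objective F d u0 N sig eps del lam v =
      (wnorm2 (sample_mean N (\<lambda>i. outer (eps i) (eps i))) (F v - d) / 2
        - sample_mean N (\<lambda>i. outer (eps i) (eps i) *v sig i) \<bullet> (F v - d))
      + (wnorm2 (sample_mean N (\<lambda>i. outer (lam i) (lam i))) (v - u0) / 2
        - sample_mean N (\<lambda>i. outer (lam i) (lam i) *v del i) \<bullet> (v - u0))
      + sample_mean N (\<lambda>i. (eps i \<bullet> sig i)\<^sup>2 / 2 + (lam i \<bullet> del i)\<^sup>2 / 2)" for v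
    unfolding wnorm2_sample_mean_outer inner_sample_mean_outer hat_objective_def unfolding sample_mean_def
    by (simp add: scaleR_sum_right sum_distrib_left sum_divide_distrib flip: sum.distrib sum_subtractf)
      (intro sum.cong refl, simp add: power2_eq_square inner_diff_right inner_add_right field_simps)
  from minimizer_solves_opt_system[OF assms(1) transpose_sample_mean_outer
          transpose_sample_mean_outer assms(2) this]
  show ?thesis by (simp add: P_hat_def)
qed

section \<open>Sample means of products of subgaussian variables\<close>

lemma (in prob_space) iid_copies_compose:
  fixes Z :: "'a \<Rightarrow> 'b::topological_space" and g :: "'b \<Rightarrow> 'c::topological_space"
  assumes iid: "iid_copies M N Z Zs" and Z: "Z \<in> borel_measurable M" and g: "g \<in> borel_measurable borel"
  shows "iid_copies M N (\<lambda>\<omega>. g (Z \<omega>)) (\<lambda>i \<omega>. g (Zs i \<omega>))"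
  unfolding iid_copies_def
proof (intro conjI ballI)
  have ind: "indep_vars (\<lambda>_. borel) Zs {1..N}" using iid by (simp add: iid_copies_def)
  show "indep_vars (\<lambda>_. borel) (\<lambda>i \<omega>. g (Zs i \<omega>)) {1..N}"
    by (rule indep_vars_compose2[OF ind, where Y="\<lambda>_. g"]) (rule g)
  fix i assume i: "i \<in> {1..N}"
  then have "Zs i \<in> borel_measurable M" using ind by (simp add: indep_vars_def)
  moreover have "distr M borel (Zs i) = distr M borel Z" using iid i by (simp add: iid_copies_def)
  ultimately show "distr M borel (\<lambda>\<omega>. g (Zs i \<omega>)) = distr M borel (\<lambda>\<omega>. g (Z \<omega>))"
    using distr_distr[OF g, of "Zs i" M] distr_distr[OF g Z] by (simp add: comp_def)
qed

text \<open>The prefactor of \<open>sum_tail_exp_two_thirds\<close> with \<open>V\<close> inserted.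
  It depends neither on the deviation nor on the number of samples, so it can later be absorbed into
  the rate.\<close>

definition two_thirds_const :: "real \<Rightarrow> real \<Rightarrow> real" where
  "two_thirds_const a D = exp (a / 2)
    + 2 * (exp (48 * D / a ^ 3 * (a / 2 + a\<^sup>2 / 4)) + 48 * D / a ^ 3)"

context prob_space
begin

lemma iid_copies_real:
  fixes Y :: "'a \<Rightarrow> real"
  assumes iid: "iid_copies M N Y Ys" and Y: "Y \<in> borel_measurable M"
  shows "indep_vars (\<lambda>_. borel) (\<lambda>i \<omega>. Ys i \<omega> - \<mu>) {1..N}"
    and "i \<in> {1..N} \<Longrightarrow> Ys i \<in> borel_measurable M"
    and "i \<in> {1..N} \<Longrightarrow> integrable M Y \<Longrightarrow> expectation (\<lambda>\<omega>. Ys i \<omega> - expectation Y) = 0"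
    and "i \<in> {1..N} \<Longrightarrow> f \<in> borel_measurable borel \<Longrightarrow>
      (\<integral>\<^sup>+\<omega>. f (Ys i \<omega>) \<partial>M) = (\<integral>\<^sup>+\<omega>. f (Y \<omega>) \<partial>M)"
proof -
  have ind: "indep_vars (\<lambda>_. borel) Ys {1..N}" using iid by (simp add: iid_copies_def)
  show "indep_vars (\<lambda>_. borel) (\<lambda>i \<omega>. Ys i \<omega> - \<mu>) {1..N}"
    by (rule indep_vars_compose2[OF ind, where Y="\<lambda>_ y. y - \<mu>"]) measurable
  assume i: "i \<in> {1..N}"
  then show Yi: "Ys i \<in> borel_measurable M" using ind by (simp add: indep_vars_def)
  have d: "distr M borel (Ys i) = distr M borel Y" using iid i by (simp add: iid_copies_def)
  have nn: "(\<integral>\<^sup>+\<omega>. f (Ys i \<omega>) \<partial>M) = (\<integral>\<^sup>+\<omega>. f (Y \<omega>) \<partial>M)" if "f \<in> borel_measurable borel" for f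
    using nn_integral_distr[OF Yi, of f] nn_integral_distr[OF Y, of f] d that by simp
  then show "f \<in> borel_measurable borel \<Longrightarrow> (\<integral>\<^sup>+\<omega>. f (Ys i \<omega>) \<partial>M) = (\<integral>\<^sup>+\<omega>. f (Y \<omega>) \<partial>M)" .
  assume int: "integrable M Y"
  have "integrable M (Ys i)"
    using integrable_distr_eq[OF Yi, of "\<lambda>x. x"] integrable_distr_eq[OF Y, of "\<lambda>x. x"] d int by simp
  moreover have "expectation (Ys i) = expectation Y"
    using integral_distr[OF Yi, of "\<lambda>x. x"] integral_distr[OF Y, of "\<lambda>x. x"] d by simp
  ultimately show "expectation (\<lambda>\<omega>. Ys i \<omega> - expectation Y) = 0" by (simp add: prob_space)
qed

lemma sample_mean_deviation:
  "sample_mean N x - m = (\<Sum>i=1..N. x i - m) / real N" if "1 \<le> N" for m :: real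
  using that by (simp add: sample_mean_def sum_subtractf field_simps)

lemma sample_mean_tail_exp:
  fixes Y :: "'a \<Rightarrow> real"
  assumes iid: "iid_copies M N Y Ys" and Y: "integrable M Y" and \<mu>: "expectation Y = \<mu>" and N: "1 \<le> N"
    and D: "(\<integral>\<^sup>+\<omega>. ennreal (exp (a * \<bar>Y \<omega> - \<mu>\<bar>)) \<partial>M) \<le> ennreal D"
    and "0 < a" "0 < D" "0 < s" "s \<le> b" and \<theta>: "\<theta> = min (a / (2 * b)) (a\<^sup>2 / (16 * D))"
  shows "prob {\<omega> \<in> space M. s < \<bar>sample_mean N (\<lambda>i. Ys i \<omega>) - \<mu>\<bar>} \<le> 2 * exp (- (\<theta> / 2) * s\<^sup>2 * real N)"
proof -
  have Ym: "Y \<in> borel_measurable M" using Y by simp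
  note * = iid_copies_real[OF iid Ym]
  have [measurable]: "(\<lambda>\<omega>. \<Sum>i\<in>{1..N}. Ys i \<omega> - \<mu>) \<in> borel_measurable M"
    using *(2) by (intro borel_measurable_sum borel_measurable_diff) auto
  have "prob {\<omega> \<in> space M. s * real (card {1..N}) \<le> \<bar>\<Sum>i\<in>{1..N}. Ys i \<omega> - \<mu>\<bar>}
    \<le> 2 * exp (- (\<theta> / 2) * s\<^sup>2 * real (card {1..N}))"
  proof (rule sum_tail_exp)
    fix i assume i: "i \<in> {1..N}"
    show "expectation (\<lambda>\<omega>. Ys i \<omega> - \<mu>) = 0" using *(3)[OF i Y] \<mu> by simp
    show "(\<integral>\<^sup>+\<omega>. ennreal (exp (a * \<bar>Ys i \<omega> - \<mu>\<bar>)) \<partial>M) \<le> ennreal D"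
      using *(4)[OF i, of "\<lambda>y. ennreal (exp (a * \<bar>y - \<mu>\<bar>))"] D by simp
  qed (use * assms in auto)
  moreover have "{\<omega> \<in> space M. s < \<bar>sample_mean N (\<lambda>i. Ys i \<omega>) - \<mu>\<bar>}
      \<subseteq> {\<omega> \<in> space M. s * real (card {1..N}) \<le> \<bar>\<Sum>i\<in>{1..N}. Ys i \<omega> - \<mu>\<bar>}"
    using N by (auto simp: sample_mean_deviation pos_less_divide_eq)
  then have "prob {\<omega> \<in> space M. s < \<bar>sample_mean N (\<lambda>i. Ys i \<omega>) - \<mu>\<bar>}
      \<le> prob {\<omega> \<in> space M. s * real (card {1..N}) \<le> \<bar>\<Sum>i\<in>{1..N}. Ys i \<omega> - \<mu>\<bar>}"
    by (rule finite_measure_mono) measurable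
  ultimately show ?thesis by simp
qed

lemma sample_mean_tail_two_thirds:
  fixes Y :: "'a \<Rightarrow> real"
  assumes iid: "iid_copies M N Y Ys" and Y: "integrable M Y" and \<mu>: "expectation Y = \<mu>" and N: "1 \<le> N"
    and D: "(\<integral>\<^sup>+\<omega>. ennreal (exp (a * (root 3 \<bar>Y \<omega> - \<mu>\<bar>)\<^sup>2)) \<partial>M) \<le> ennreal D"
    and "0 < a" "0 < D" "0 < s"
  shows "prob {\<omega> \<in> space M. s < \<bar>sample_mean N (\<lambda>i. Ys i \<omega>) - \<mu>\<bar>}
    \<le> two_thirds_const a D * exp (- (a / 2) * (s powr (2/3) * real N powr (1/3)))"
proof -
  have Ym: "Y \<in> borel_measurable M" using Y by simp
  note * = iid_copies_real[OF iid Ym]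
  have [measurable]: "(\<lambda>\<omega>. \<Sum>i\<in>{1..N}. Ys i \<omega> - \<mu>) \<in> borel_measurable M"
    using *(2) by (intro borel_measurable_sum borel_measurable_diff) auto
  \<comment> \<open>Chosen so that \<open>p ^ 3 * sqrt N = s * real N\<close>; then
    \<open>p\<^sup>2\<close> is exactly the exponent in the claimed rate.\<close>
  define p where "p = root 3 (s * sqrt N)"
  have p: "0 < p" using \<open>0 < s\<close> N by (simp add: p_def)
  have "p ^ 3 = s * sqrt N" by (simp add: p_def odd_real_root_pow)
  then have pN: "p ^ 3 * sqrt N = s * real N" by simp
  have "p = (s * real N powr (1/2)) powr (1/3)"
    using \<open>0 < s\<close> N by (simp add: p_def root_powr_inverse powr_half_sqrt)
  then have p2: "p\<^sup>2 = s powr (2/3) * real N powr (1/3)"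
    using \<open>0 < s\<close> N by (simp add: powr_mult powr_powr power_mult_distrib powr_power)
  have "prob {\<omega> \<in> space M. p ^ 3 * sqrt (card {1..N}) \<le> \<bar>\<Sum>i\<in>{1..N}. Ys i \<omega> - \<mu>\<bar>}
    \<le> two_thirds_const a D * exp (- (a / 2) * p\<^sup>2)"
    unfolding two_thirds_const_def
  proof (rule sum_tail_exp_two_thirds)
    fix i assume i: "i \<in> {1..N}"
    show "expectation (\<lambda>\<omega>. Ys i \<omega> - \<mu>) = 0" using *(3)[OF i Y] \<mu> by simp
    show "(\<integral>\<^sup>+\<omega>. ennreal (exp (a * (root 3 \<bar>Ys i \<omega> - \<mu>\<bar>)\<^sup>2)) \<partial>M) \<le> ennreal D"
      using *(4)[OF i, of "\<lambda>y. ennreal (exp (a * (root 3 \<bar>y - \<mu>\<bar>)\<^sup>2))"] D by simp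
  qed (use * assms p in auto)
  moreover have "{\<omega> \<in> space M. s < \<bar>sample_mean N (\<lambda>i. Ys i \<omega>) - \<mu>\<bar>}
      \<subseteq> {\<omega> \<in> space M. p ^ 3 * sqrt (card {1..N}) \<le> \<bar>\<Sum>i\<in>{1..N}. Ys i \<omega> - \<mu>\<bar>}"
    using N by (auto simp: sample_mean_deviation pos_less_divide_eq pN)
  then have "prob {\<omega> \<in> space M. s < \<bar>sample_mean N (\<lambda>i. Ys i \<omega>) - \<mu>\<bar>}
      \<le> prob {\<omega> \<in> space M. p ^ 3 * sqrt (card {1..N}) \<le> \<bar>\<Sum>i\<in>{1..N}. Ys i \<omega> - \<mu>\<bar>}"
    by (rule finite_measure_mono) measurable
  ultimately show ?thesis by (simp add: p2)
qed

section \<open>Exponential moments of products of subgaussian variables\<close>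

text \<open>Centring multiplies the exponential moment by at most the exponential of
  \<open>a\<close> times the absolute mean, and this exponent is at most \<open>D\<close> because
  \<open>x \<le> exp x\<close>.\<close>

lemma centered_exp_moment:
  fixes Y :: "'a \<Rightarrow> real"
  assumes [measurable]: "Y \<in> borel_measurable M"
    and D: "(\<integral>\<^sup>+\<omega>. ennreal (exp (a * \<bar>Y \<omega>\<bar>)) \<partial>M) \<le> ennreal D" and "0 < a" "0 \<le> D"
  shows "integrable M Y"
    and "(\<integral>\<^sup>+\<omega>. ennreal (exp (a * \<bar>Y \<omega> - expectation Y\<bar>)) \<partial>M) \<le> ennreal (D * exp D)"
proof -
  have *: "integrable M (\<lambda>\<omega>. exp (a * \<bar>Y \<omega>\<bar>))" "expectation (\<lambda>\<omega>. exp (a * \<bar>Y \<omega>\<bar>)) \<le> D"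
    using D \<open>0 \<le> D\<close> by (auto intro!: nn_integral_le_imp_integrable)
  have le: "\<bar>Y \<omega>\<bar> \<le> exp (a * \<bar>Y \<omega>\<bar>) / a" for \<omega>
  proof -
    have "a * \<bar>Y \<omega>\<bar> \<le> exp (a * \<bar>Y \<omega>\<bar>)" using exp_ge_add_one_self[of "a * \<bar>Y \<omega>\<bar>"] by linarith
    then show ?thesis using \<open>0 < a\<close> by (simp add: field_simps)
  qed
  show int: "integrable M Y"
  proof (rule Bochner_Integration.integrable_bound)
    show "integrable M (\<lambda>\<omega>. exp (a * \<bar>Y \<omega>\<bar>) / a)" using * by simp
    show "AE \<omega> in M. norm (Y \<omega>) \<le> norm (exp (a * \<bar>Y \<omega>\<bar>) / a)"
      using \<open>0 < a\<close> le by (intro AE_I2) simp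
  qed simp
  have "\<bar>expectation Y\<bar> \<le> expectation (\<lambda>\<omega>. \<bar>Y \<omega>\<bar>)" by (rule integral_abs_bound)
  also have "\<dots> \<le> expectation (\<lambda>\<omega>. exp (a * \<bar>Y \<omega>\<bar>) / a)"
    using int * le by (intro integral_mono) auto
  also have "\<dots> \<le> D / a" using * \<open>0 < a\<close> by (simp add: divide_right_mono)
  finally have m: "a * \<bar>expectation Y\<bar> \<le> D" using \<open>0 < a\<close> by (simp add: field_simps)
  have "(\<integral>\<^sup>+\<omega>. ennreal (exp (a * \<bar>Y \<omega> - expectation Y\<bar>)) \<partial>M)
      \<le> (\<integral>\<^sup>+\<omega>. ennreal (exp D) * ennreal (exp (a * \<bar>Y \<omega>\<bar>)) \<partial>M)"
  proof (intro nn_integral_mono)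
    fix \<omega>
    have "a * \<bar>Y \<omega> - expectation Y\<bar> \<le> a * (\<bar>Y \<omega>\<bar> + \<bar>expectation Y\<bar>)"
      using \<open>0 < a\<close> by (intro mult_left_mono) auto
    with m have "a * \<bar>Y \<omega> - expectation Y\<bar> \<le> D + a * \<bar>Y \<omega>\<bar>" by (simp add: distrib_left)
    then have "exp (a * \<bar>Y \<omega> - expectation Y\<bar>) \<le> exp D * exp (a * \<bar>Y \<omega>\<bar>)" by (simp flip: exp_add)
    then show "ennreal (exp (a * \<bar>Y \<omega> - expectation Y\<bar>)) \<le> ennreal (exp D) * ennreal (exp (a * \<bar>Y \<omega>\<bar>))"
      by (simp add: ennreal_leI flip: ennreal_mult'')
  qed
  also have "\<dots> = ennreal (exp D) * (\<integral>\<^sup>+\<omega>. ennreal (exp (a * \<bar>Y \<omega>\<bar>)) \<partial>M)"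
    by (intro nn_integral_cmult) simp
  also have "\<dots> \<le> ennreal (exp D) * ennreal D" by (intro mult_left_mono D) simp
  also have "\<dots> = ennreal (D * exp D)" using \<open>0 \<le> D\<close> by (simp add: mult.commute flip: ennreal_mult'')
  finally show "(\<integral>\<^sup>+\<omega>. ennreal (exp (a * \<bar>Y \<omega> - expectation Y\<bar>)) \<partial>M) \<le> ennreal (D * exp D)" .
qed

text \<open>The arithmetic-geometric mean inequality reduces the product to the two Orlicz
  integrals, with total \<open>2 + 2 = 4\<close>; centring turns 4 into
  \<open>4 * exp 4\<close>.\<close>

lemma psi2_product:
  assumes x: "psi2_le M K x" and y: "psi2_le M K y"
  shows "integrable M (\<lambda>\<omega>. x \<omega> * y \<omega>)"
    and "(\<integral>\<^sup>+\<omega>. ennreal (exp (1 / K\<^sup>2 * \<bar>x \<omega> * y \<omega> - expectation (\<lambda>\<omega>. x \<omega> * y \<omega>)\<bar>)) \<partial>M)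
      \<le> ennreal (4 * exp 4)"
proof -
  have K: "0 < K" and [measurable]: "x \<in> borel_measurable M" "y \<in> borel_measurable M"
    using x y by (auto simp: psi2_le_def)
  have "(\<integral>\<^sup>+\<omega>. ennreal (exp (1 / K\<^sup>2 * \<bar>x \<omega> * y \<omega>\<bar>)) \<partial>M)
      \<le> (\<integral>\<^sup>+\<omega>. ennreal (exp ((x \<omega> / K)\<^sup>2)) + ennreal (exp ((y \<omega> / K)\<^sup>2)) \<partial>M)"
  proof (intro nn_integral_mono)
    fix \<omega>
    have "2 * (\<bar>x \<omega>\<bar> * \<bar>y \<omega>\<bar>) \<le> (x \<omega>)\<^sup>2 + (y \<omega>)\<^sup>2"
      using sum_squares_bound[of "\<bar>x \<omega>\<bar>" "\<bar>y \<omega>\<bar>"] by simp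
    then have "1 / K\<^sup>2 * \<bar>x \<omega> * y \<omega>\<bar> \<le> ((x \<omega> / K)\<^sup>2 + (y \<omega> / K)\<^sup>2) / 2"
      using K by (simp add: abs_mult field_simps)
    also have "\<dots> \<le> max ((x \<omega> / K)\<^sup>2) ((y \<omega> / K)\<^sup>2)" by simp
    finally have "exp (1 / K\<^sup>2 * \<bar>x \<omega> * y \<omega>\<bar>) \<le> exp (max ((x \<omega> / K)\<^sup>2) ((y \<omega> / K)\<^sup>2))" by simp
    also have "\<dots> \<le> exp ((x \<omega> / K)\<^sup>2) + exp ((y \<omega> / K)\<^sup>2)" by (auto simp: max_def)
    finally show "ennreal (exp (1 / K\<^sup>2 * \<bar>x \<omega> * y \<omega>\<bar>))
        \<le> ennreal (exp ((x \<omega> / K)\<^sup>2)) + ennreal (exp ((y \<omega> / K)\<^sup>2))"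
      by (simp flip: ennreal_plus)
  qed
  also have "\<dots> = (\<integral>\<^sup>+\<omega>. ennreal (exp ((x \<omega> / K)\<^sup>2)) \<partial>M) + (\<integral>\<^sup>+\<omega>. ennreal (exp ((y \<omega> / K)\<^sup>2)) \<partial>M)"
    by (intro nn_integral_add) auto
  also have "\<dots> \<le> 2 + 2" using x y by (intro add_mono) (auto simp: psi2_le_def)
  also have "\<dots> = ennreal 4" by simp
  finally have *: "(\<integral>\<^sup>+\<omega>. ennreal (exp (1 / K\<^sup>2 * \<bar>x \<omega> * y \<omega>\<bar>)) \<partial>M) \<le> ennreal 4" .
  show "integrable M (\<lambda>\<omega>. x \<omega> * y \<omega>)"
    by (rule centered_exp_moment(1)[OF _ *]) (use K in auto)
  show "(\<integral>\<^sup>+\<omega>. ennreal (exp (1 / K\<^sup>2 * \<bar>x \<omega> * y \<omega> - expectation (\<lambda>\<omega>. x \<omega> * y \<omega>)\<bar>)) \<partial>M)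
      \<le> ennreal (4 * exp 4)"
    by (rule centered_exp_moment(2)[OF _ *]) (use K in auto)
qed

text \<open>Weakening a subgaussian bound to an exponential moment, by
  \<open>2 * y \<le> 1 + y\<^sup>2\<close>, lets the means of the noise share the tail estimate for
  second moments.\<close>

lemma psi2_integrable:
  assumes x: "psi2_le M K x"
  shows "integrable M x" "(\<integral>\<^sup>+\<omega>. ennreal (exp (1 / K * \<bar>x \<omega>\<bar>)) \<partial>M) \<le> ennreal (2 * exp 1)"
proof -
  have K: "0 < K" and [measurable]: "x \<in> borel_measurable M"
    using x by (auto simp: psi2_le_def)
  have "(\<integral>\<^sup>+\<omega>. ennreal (exp (1 / K * \<bar>x \<omega>\<bar>)) \<partial>M) \<le> (\<integral>\<^sup>+\<omega>. ennreal (exp 1) * ennreal (exp ((x \<omega> / K)\<^sup>2)) \<partial>M)"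
  proof (intro nn_integral_mono)
    fix \<omega>
    have "2 * \<bar>x \<omega> / K\<bar> \<le> 1 + (x \<omega> / K)\<^sup>2"
      using sum_squares_bound[of 1 "\<bar>x \<omega> / K\<bar>"] by (simp del: abs_divide)
    then have "\<bar>x \<omega> / K\<bar> \<le> 1 + (x \<omega> / K)\<^sup>2" by linarith
    then have "exp (1 / K * \<bar>x \<omega>\<bar>) \<le> exp (1 + (x \<omega> / K)\<^sup>2)" using K by simp
    then show "ennreal (exp (1 / K * \<bar>x \<omega>\<bar>)) \<le> ennreal (exp 1) * ennreal (exp ((x \<omega> / K)\<^sup>2))"
      by (simp add: ennreal_leI exp_add flip: ennreal_mult'')
  qed
  also have "\<dots> = ennreal (exp 1) * (\<integral>\<^sup>+\<omega>. ennreal (exp ((x \<omega> / K)\<^sup>2)) \<partial>M)"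
    by (intro nn_integral_cmult) simp
  also have "\<dots> \<le> ennreal (exp 1) * 2" using x by (intro mult_left_mono) (auto simp: psi2_le_def)
  also have "\<dots> = ennreal (2 * exp 1)" by (simp add: ennreal_mult'' mult.commute)
  finally show *: "(\<integral>\<^sup>+\<omega>. ennreal (exp (1 / K * \<bar>x \<omega>\<bar>)) \<partial>M) \<le> ennreal (2 * exp 1)" .
  show "integrable M x" by (rule centered_exp_moment(1)[OF _ *]) (use K in auto)
qed

text \<open>An exponential moment controls one of order 2/3, since the cube root \<open>q\<close>
  satisfies \<open>q\<^sup>2 \<le> 1 + q ^ 3\<close>. The weaker moment is wanted because its tail
  bound holds for deviations of any size.\<close>

lemma psi2_product_two_thirds:
  assumes x: "psi2_le M K x" and y: "psi2_le M K y"
  shows "(\<integral>\<^sup>+\<omega>. ennreal (exp (1 / K\<^sup>2 * (root 3 \<bar>x \<omega> * y \<omega> - expectation (\<lambda>\<omega>. x \<omega> * y \<omega>)\<bar>)\<^sup>2)) \<partial>M)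
      \<le> ennreal (4 * exp (4 + 1 / K\<^sup>2))"
proof -
  have K: "0 < K" and [measurable]: "x \<in> borel_measurable M" "y \<in> borel_measurable M"
    using x y by (auto simp: psi2_le_def)
  define Y where "Y \<omega> = x \<omega> * y \<omega> - expectation (\<lambda>\<omega>. x \<omega> * y \<omega>)" for \<omega>
  have [measurable]: "Y \<in> borel_measurable M" unfolding Y_def by measurable
  have "(\<integral>\<^sup>+\<omega>. ennreal (exp (1 / K\<^sup>2 * (root 3 \<bar>Y \<omega>\<bar>)\<^sup>2)) \<partial>M)
      \<le> (\<integral>\<^sup>+\<omega>. ennreal (exp (1 / K\<^sup>2)) * ennreal (exp (1 / K\<^sup>2 * \<bar>Y \<omega>\<bar>)) \<partial>M)"
  proof (intro nn_integral_mono)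
    fix \<omega>
    define q where "q = root 3 \<bar>Y \<omega>\<bar>"
    have q: "q ^ 3 = \<bar>Y \<omega>\<bar>" "0 \<le> q" by (simp_all add: q_def odd_real_root_pow)
    have "q\<^sup>2 \<le> 1 + q ^ 3"
    proof (cases "q \<le> 1")
      case True
      then have "q\<^sup>2 \<le> 1" using q(2) by (simp add: power_le_one)
      with q show ?thesis by simp
    next
      case False
      then have "q\<^sup>2 \<le> q ^ 3" by (intro power_increasing) auto
      then show ?thesis by simp
    qed
    then have "1 / K\<^sup>2 * q\<^sup>2 \<le> 1 / K\<^sup>2 * (1 + \<bar>Y \<omega>\<bar>)"
      unfolding q(1)[symmetric] by (intro mult_left_mono) auto
    then have "exp (1 / K\<^sup>2 * q\<^sup>2) \<le> exp (1 / K\<^sup>2) * exp (1 / K\<^sup>2 * \<bar>Y \<omega>\<bar>)"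
      by (simp add: distrib_left flip: exp_add)
    then show "ennreal (exp (1 / K\<^sup>2 * (root 3 \<bar>Y \<omega>\<bar>)\<^sup>2))
        \<le> ennreal (exp (1 / K\<^sup>2)) * ennreal (exp (1 / K\<^sup>2 * \<bar>Y \<omega>\<bar>))"
      unfolding q_def[symmetric] by (simp add: ennreal_leI flip: ennreal_mult'')
  qed
  also have "\<dots> = ennreal (exp (1 / K\<^sup>2)) * (\<integral>\<^sup>+\<omega>. ennreal (exp (1 / K\<^sup>2 * \<bar>Y \<omega>\<bar>)) \<partial>M)"
    by (intro nn_integral_cmult) simp
  also have "\<dots> \<le> ennreal (exp (1 / K\<^sup>2)) * ennreal (4 * exp 4)"
    unfolding Y_def by (intro mult_left_mono psi2_product(2) x y) simp
  also have "\<dots> = ennreal (4 * exp (4 + 1 / K\<^sup>2))"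
    by (simp add: exp_add mult_ac flip: ennreal_mult'')
  finally show ?thesis unfolding Y_def .
qed

text \<open>The power 2/3 of a triple product is at most the largest of the three squares, so its
  exponential is at most the sum of the three Orlicz integrands.\<close>

lemma psi2_triple_two_thirds:
  assumes x: "psi2_le M K x" and y: "psi2_le M K y" and z: "psi2_le M K z"
  shows "(\<integral>\<^sup>+\<omega>. ennreal (exp (1 / K\<^sup>2 * (root 3 \<bar>x \<omega> * y \<omega> * z \<omega>\<bar>)\<^sup>2)) \<partial>M)
      \<le> ennreal (4 * exp (4 + 1 / K\<^sup>2))"
proof -
  have K: "0 < K" and [measurable]: "x \<in> borel_measurable M" "y \<in> borel_measurable M" "z \<in> borel_measurable M"
    using x y z by (auto simp: psi2_le_def)
  have "(\<integral>\<^sup>+\<omega>. ennreal (exp (1 / K\<^sup>2 * (root 3 \<bar>x \<omega> * y \<omega> * z \<omega>\<bar>)\<^sup>2)) \<partial>M)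
      \<le> (\<integral>\<^sup>+\<omega>. ennreal (exp ((x \<omega> / K)\<^sup>2)) + ennreal (exp ((y \<omega> / K)\<^sup>2)) + ennreal (exp ((z \<omega> / K)\<^sup>2)) \<partial>M)"
  proof (intro nn_integral_mono)
    fix \<omega>
    define m where "m = max \<bar>x \<omega>\<bar> (max \<bar>y \<omega>\<bar> \<bar>z \<omega>\<bar>)"
    have m: "\<bar>x \<omega>\<bar> \<le> m" "\<bar>y \<omega>\<bar> \<le> m" "\<bar>z \<omega>\<bar> \<le> m" "0 \<le> m" by (auto simp: m_def)
    then have "\<bar>x \<omega> * y \<omega> * z \<omega>\<bar> \<le> m * m * m" unfolding abs_mult by (intro mult_mono) auto
    then have "root 3 \<bar>x \<omega> * y \<omega> * z \<omega>\<bar> \<le> root 3 (m ^ 3)" by (simp add: power3_eq_cube)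
    also have "\<dots> = m" using m by (simp add: real_root_power_cancel)
    finally have "(root 3 \<bar>x \<omega> * y \<omega> * z \<omega>\<bar>)\<^sup>2 \<le> m\<^sup>2" by (intro power_mono) auto
    then have "exp (1 / K\<^sup>2 * (root 3 \<bar>x \<omega> * y \<omega> * z \<omega>\<bar>)\<^sup>2) \<le> exp ((m / K)\<^sup>2)"
      using K by (simp add: power_divide divide_right_mono)
    also have "\<dots> \<le> exp ((x \<omega> / K)\<^sup>2) + exp ((y \<omega> / K)\<^sup>2) + exp ((z \<omega> / K)\<^sup>2)"
      by (auto simp: m_def max_def power_divide add_increasing add_increasing2)
    finally show "ennreal (exp (1 / K\<^sup>2 * (root 3 \<bar>x \<omega> * y \<omega> * z \<omega>\<bar>)\<^sup>2))
        \<le> ennreal (exp ((x \<omega> / K)\<^sup>2)) + ennreal (exp ((y \<omega> / K)\<^sup>2)) + ennreal (exp ((z \<omega> / K)\<^sup>2))"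
      by (simp flip: ennreal_plus)
  qed
  also have "\<dots> = (\<integral>\<^sup>+\<omega>. ennreal (exp ((x \<omega> / K)\<^sup>2)) \<partial>M) + (\<integral>\<^sup>+\<omega>. ennreal (exp ((y \<omega> / K)\<^sup>2)) \<partial>M)
      + (\<integral>\<^sup>+\<omega>. ennreal (exp ((z \<omega> / K)\<^sup>2)) \<partial>M)"
    by (simp add: nn_integral_add)
  also have "\<dots> \<le> 2 + 2 + 2" using x y z by (intro add_mono) (auto simp: psi2_le_def)
  also have "\<dots> = ennreal 6" by simp
  \<comment> \<open>The total 6 is relaxed to the constant of the pair products, so that both kinds
    of product share one prefactor.\<close>
  also have "\<dots> \<le> ennreal (4 * exp (4 + 1 / K\<^sup>2))"
  proof (rule ennreal_leI)
    have "0 \<le> 1 / K\<^sup>2" by simp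
    then show "6 \<le> 4 * exp (4 + 1 / K\<^sup>2)" using exp_ge_add_one_self[of "4 + 1 / K\<^sup>2"] by linarith
  qed
  finally show ?thesis .
qed

end

section \<open>Whitening\<close>

text \<open>Translates a whitening identity such as \<open>A ** Q ** transpose A = mat 1\<close>
  into second moments of the marginals along the rows of \<open>A\<close>.\<close>

lemma row_quadratic: "(A ** B ** transpose C) $ i $ j = row i A \<bullet> (B *v row j C)" for A :: "real^'n^'m"
  by (simp add: matrix_matrix_mult_def matrix_vector_mult_def transpose_def row_def inner_vec_def
      sum_distrib_left sum_distrib_right mult_ac) (rule sum.swap)

lemma matrix_vector_mult_row: "(A *v x) $ i = row i A \<bullet> x" for A :: "real^'n^'m"
  by (simp add: matrix_vector_mult_def row_def inner_vec_def)

text \<open>The witness for \<open>T\<close> is \<open>inv_sqrt S ** S\<close>, the inverse of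
  \<open>inv_sqrt S\<close>. Vectors with second moment \<open>matrix_inv S\<close> are whitened by
  \<open>T\<close>, those with second moment \<open>S\<close> by \<open>inv_sqrt S\<close>.\<close>

lemma whitening_matrix:
  fixes S :: "real^'m^'m"
  assumes S: "sym_pos_def S"
  obtains T where "inv_sqrt S ** T = mat 1" "T ** matrix_inv S ** transpose T = mat 1"
    "inv_sqrt S ** S ** transpose (inv_sqrt S) = mat 1"
proof
  let ?R = "inv_sqrt S"
  note RR = inv_sqrt(2)[OF S]
  have tr: "transpose ?R = ?R" "transpose S = S" using inv_sqrt(1)[OF S] S by (auto simp: sym_pos_def_def)
  show RT: "?R ** (?R ** S) = mat 1"
    by (simp add: matrix_mul_assoc RR sym_pos_def_inverse(1)[OF S])
  then have TR: "(?R ** S) ** ?R = mat 1" by (simp add: matrix_left_right_inverse)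
  then show "?R ** S ** transpose ?R = mat 1" by (simp add: tr)
  have "(?R ** S) ** matrix_inv S ** transpose (?R ** S) = ((?R ** S) ** ?R) ** (?R ** (S ** ?R))"
    by (simp add: tr matrix_transpose_mul RR[symmetric] matrix_mul_assoc)
  also have "\<dots> = mat 1" using TR by (simp add: matrix_mul_assoc)
  finally show "(?R ** S) ** matrix_inv S ** transpose (?R ** S) = mat 1" .
qed

text \<open>Write \<open>x\<close> as \<open>R *v (T *v x)\<close> and move the symmetric
  \<open>R\<close> across the inner product: the random matrix now acts between whitened vectors,
  and one factor \<open>R\<close> remains outside.\<close>

lemma whiten_outer:
  fixes R T :: "real^'m^'m"
  assumes "R ** T = mat 1" "transpose R = R"
  shows "outer x x *v v = R *v (outer (T *v x) (T *v x) *v (R *v v))"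
proof -
  have x: "R *v (T *v x) = x" by (simp add: matrix_vector_mul_assoc assms(1))
  have "x \<bullet> v = (T *v x) \<bullet> (R *v v)"
    using x assms(2) by (metis dot_lmul_matrix transpose_matrix_vector)
  then show ?thesis by (simp add: outer_mult_vec matrix_vector_mult_scaleR x)
qed

lemma matrix_vector_sample_mean:
  fixes A :: "real^'n^'m"
  shows "A *v sample_mean N x = sample_mean N (\<lambda>i. A *v x i)"
  by (rule bounded_linear_sample_mean) (rule matrix_vector_mul_bounded_linear)

lemma sample_mean_component: "sample_mean N x $ a = sample_mean N (\<lambda>i. x i $ a)"
  for x :: "nat \<Rightarrow> 'b::real_normed_vector^'m"
  by (rule bounded_linear_sample_mean) (rule bounded_linear_vec_nth)

lemma sample_mean_outer_entry:
  "sample_mean N (\<lambda>i. outer (x i) (y i)) $ a $ b = sample_mean N (\<lambda>i. x i $ a * y i $ b)"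
  by (simp add: sample_mean_component outer_def)

lemma sample_mean_sum: "sample_mean N (\<lambda>i. \<Sum>b\<in>B. f b i) = (\<Sum>b\<in>B. sample_mean N (f b))"
  unfolding sample_mean_def by (subst sum.swap) (simp add: scaleR_sum_right)

text \<open>Entries of \<open>E\<close> and \<open>w\<close> are at most \<open>s\<close>, and a row
  of \<open>E\<close> has \<open>CARD('m)\<close> of them, so its absolute sum is at most
  \<open>\<beta>\<close>. Thus \<open>w\<close> contributes at most \<open>\<beta>\<close> and
  \<open>E *v w\<close> at most \<open>\<beta>\<^sup>2\<close>; this is the origin of
  \<open>1 + \<beta>\<close>.\<close>

lemma infnorm_tilde_noise_le:
  fixes R T :: "real^'m^'m"
  assumes RT: "R ** T = mat 1" "transpose R = R" and "0 \<le> s"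
    and cov: "\<And>a b. \<bar>sample_mean N (\<lambda>i. (row a T \<bullet> x i) * (row b T \<bullet> x i)) - (mat 1 :: real^'m^'m) $ a $ b\<bar> \<le> s"
    and mean: "\<And>a. \<bar>sample_mean N (\<lambda>i. row a R \<bullet> y i)\<bar> \<le> s"
    and \<beta>: "\<beta> = real CARD('m) * s"
  shows "infnorm (sample_mean N (\<lambda>i. outer (x i) (x i)) *v sample_mean N y) \<le> \<beta> * (1 + \<beta>) * matrix_infnorm R"
proof -
  define w where "w = R *v sample_mean N y"
  define E where "E = sample_mean N (\<lambda>i. outer (T *v x i) (T *v x i)) - mat 1"
  have "1 \<le> real CARD('m)" by (simp add: Suc_le_eq)
  then have s\<beta>: "s \<le> \<beta>" unfolding \<beta> using \<open>0 \<le> s\<close> mult_right_mono[of 1 "real CARD('m)" s] by simp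
  have w: "\<bar>w $ a\<bar> \<le> s" for a
    using mean[of a] by (simp add: w_def matrix_vector_sample_mean sample_mean_component matrix_vector_mult_row)
  have E: "\<bar>E $ a $ b\<bar> \<le> s" for a b
    using cov[of a b] by (simp add: E_def sample_mean_outer_entry matrix_vector_mult_row)
  have "sample_mean N (\<lambda>i. outer (x i) (x i)) *v sample_mean N y
      = R *v (sample_mean N (\<lambda>i. outer (T *v x i) (T *v x i)) *v w)"
    unfolding w_def sample_mean_mult_vec matrix_vector_sample_mean[of R]
    by (subst whiten_outer[OF RT]) (simp add: matrix_vector_sample_mean)
  also have "\<dots> = R *v (w + E *v w)"
    by (simp add: E_def matrix_vector_mult_diff_rdistrib)
  finally have "infnorm (sample_mean N (\<lambda>i. outer (x i) (x i)) *v sample_mean N y)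
      \<le> matrix_infnorm R * infnorm (w + E *v w)"
    by (simp add: infnorm_matrix_vector_le)
  also have "\<dots> \<le> matrix_infnorm R * (\<beta> * (1 + \<beta>))"
  proof (intro mult_left_mono infnorm_le_cartI matrix_infnorm_nonneg)
    fix a
    have "\<bar>(E *v w) $ a\<bar> \<le> (\<Sum>b\<in>UNIV. \<bar>E $ a $ b\<bar> * \<bar>w $ b\<bar>)"
      by (simp add: matrix_vector_mult_def order_trans[OF sum_abs] abs_mult)
    also have "\<dots> \<le> (\<Sum>b\<in>(UNIV::'m set). s * s)" using E w \<open>0 \<le> s\<close> by (intro sum_mono mult_mono) auto
    also have "\<dots> = \<beta> * s" by (simp add: \<beta>)
    also have "\<dots> \<le> \<beta> * \<beta>" using s\<beta> \<open>0 \<le> s\<close> by (intro mult_left_mono) auto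
    finally have "\<bar>(E *v w) $ a\<bar> \<le> \<beta> * \<beta>" .
    with w[of a] s\<beta> show "\<bar>(w + E *v w) $ a\<bar> \<le> \<beta> * (1 + \<beta>)" by (simp add: distrib_left)
  qed
  finally show ?thesis by (simp add: mult.commute)
qed

text \<open>A coordinate of the whitened mean is a sum of \<open>CARD('m)\<close> means of triple
  products; bounds \<open>s\<close> on each add up to \<open>\<beta>\<close>.\<close>

lemma infnorm_hat_noise_le:
  fixes R T :: "real^'m^'m"
  assumes RT: "R ** T = mat 1" "transpose R = R"
    and cubic: "\<And>a b. \<bar>sample_mean N (\<lambda>i. (row a T \<bullet> x i) * (row b T \<bullet> x i) * (row b R \<bullet> y i))\<bar> \<le> s"
    and \<beta>: "\<beta> = real CARD('m) * s"
  shows "infnorm (sample_mean N (\<lambda>i. outer (x i) (x i) *v y i)) \<le> \<beta> * matrix_infnorm R"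
proof -
  have "sample_mean N (\<lambda>i. outer (x i) (x i) *v y i)
      = R *v sample_mean N (\<lambda>i. outer (T *v x i) (T *v x i) *v (R *v y i))"
    unfolding matrix_vector_sample_mean by (subst whiten_outer[OF RT]) simp
  then have "infnorm (sample_mean N (\<lambda>i. outer (x i) (x i) *v y i))
      \<le> matrix_infnorm R * infnorm (sample_mean N (\<lambda>i. outer (T *v x i) (T *v x i) *v (R *v y i)))"
    by (simp add: infnorm_matrix_vector_le)
  also have "\<dots> \<le> matrix_infnorm R * \<beta>"
  proof (intro mult_left_mono infnorm_le_cartI matrix_infnorm_nonneg)
    fix a
    have "sample_mean N (\<lambda>i. outer (T *v x i) (T *v x i) *v (R *v y i)) $ a
        = sample_mean N (\<lambda>i. \<Sum>b\<in>UNIV. (row a T \<bullet> x i) * (row b T \<bullet> x i) * (row b R \<bullet> y i))"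
      unfolding sample_mean_component
      by (subst matrix_vector_mult_def) (simp add: outer_def matrix_vector_mult_row)
    also have "\<bar>\<dots>\<bar> \<le> (\<Sum>b\<in>(UNIV::'m set). s)"
      unfolding sample_mean_sum using cubic by (intro order_trans[OF sum_abs] sum_mono) auto
    finally show "\<bar>sample_mean N (\<lambda>i. outer (T *v x i) (T *v x i) *v (R *v y i)) $ a\<bar> \<le> \<beta>"
      by (simp add: \<beta>)
  qed
  finally show ?thesis by (simp add: mult.commute)
qed

text \<open>A Bochner integral of a nonintegrable function has the value 0, which is not positive
  definite; hence the moment condition already contains integrability.\<close>

lemma integrable_outer:
  fixes X :: "'a \<Rightarrow> real^'n"
  assumes "(\<integral>\<omega>. outer (X \<omega>) (X \<omega>) \<partial>M) = Q" "sym_pos_def Q"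
  shows "integrable M (\<lambda>\<omega>. outer (X \<omega>) (X \<omega>))"
proof (rule ccontr)
  assume "\<not> ?thesis"
  then have "Q = 0" using assms(1) not_integrable_integral_eq by blast
  then have "\<not> 0 < (1::real^'n) \<bullet> (Q *v 1)" by simp
  moreover have "(1::real^'n) \<noteq> 0" by (simp add: vec_eq_iff)
  ultimately show False using assms(2) by (auto simp: sym_pos_def_def)
qed

lemma second_moment_bilinear:
  fixes X :: "'a \<Rightarrow> real^'n"
  assumes Q: "(\<integral>\<omega>. outer (X \<omega>) (X \<omega>) \<partial>M) = Q" "sym_pos_def Q"
  shows "(\<integral>\<omega>. (v \<bullet> X \<omega>) * (w \<bullet> X \<omega>) \<partial>M) = v \<bullet> (Q *v w)"
proof -
  have "linear (\<lambda>A::real^'n^'n. v \<bullet> (A *v w))"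
    by (rule linearI) (simp_all add: matrix_vector_mult_add_rdistrib inner_add_right
        scaleR_matrix_vector_assoc[symmetric])
  then have "bounded_linear (\<lambda>A::real^'n^'n. v \<bullet> (A *v w))"
    by (rule linear_conv_bounded_linear[THEN iffD1])
  from integral_bounded_linear[OF this integrable_outer[OF Q]] Q(1) show ?thesis
    by (simp add: outer_mult_vec inner_commute mult.commute)
qed

lemma subgaussian_marginal:
  assumes "subgaussian_const M K X" "(\<integral>\<omega>. outer (X \<omega>) (X \<omega>) \<partial>M) = Q" "sym_pos_def Q"
    and "0 < K" "v \<noteq> 0" "v \<bullet> (Q *v v) \<le> 1"
  shows "psi2_le M K (\<lambda>\<omega>. v \<bullet> X \<omega>)"
proof (rule psi2_le_mono)
  show "psi2_le M (K * sqrt (v \<bullet> (Q *v v))) (\<lambda>\<omega>. v \<bullet> X \<omega>)"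
    using assms(1,5) second_moment_marginal[OF assms(2,3)] by (simp add: subgaussian_const_def)
  show "K * sqrt (v \<bullet> (Q *v v)) \<le> K" using assms(4,6) by simp
qed

text \<open>The absolute value appears because \<open>sqrt\<close> is an odd function on the reals,
  so that \<open>sqrt q * sqrt q\<close> is positive for negative \<open>q\<close> as well.\<close>

lemma scaled_axis_quadratic:
  assumes "q \<noteq> 0"
  shows "((1 / sqrt q) *\<^sub>R axis a 1) \<bullet> (Q *v ((1 / sqrt q) *\<^sub>R axis b 1)) = Q $ a $ b / \<bar>q\<bar>"
  using assms by (simp add: matrix_vector_mult_scaleR matrix_vector_mult_basis column_def inner_axis' flip: real_sqrt_mult)

section \<open>Noise of one block of parameters\<close>

context prob_space
begin

section \<open>Deviation events and their probabilities\<close>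

lemma prob_UN_pairs_le:
  fixes E :: "'m::finite \<Rightarrow> 'm \<Rightarrow> 'a set"
  assumes "\<And>i j. E i j \<in> events" "\<And>i j. prob (E i j) \<le> p"
  shows "(\<Union>i j. E i j) \<in> events" "prob (\<Union>i j. E i j) \<le> (real CARD('m))\<^sup>2 * p"
proof -
  show "(\<Union>i j. E i j) \<in> events" using assms(1) by (intro sets.finite_UN) auto
  have "prob (\<Union>i j. E i j) \<le> (\<Sum>i\<in>UNIV. prob (\<Union>j. E i j))"
    using assms(1) by (intro measure_UNION_le sets.finite_UN) auto
  also have "\<dots> \<le> (\<Sum>i\<in>UNIV. \<Sum>j\<in>UNIV. prob (E i j))"
    using assms(1) by (intro sum_mono measure_UNION_le) auto
  also have "\<dots> \<le> (\<Sum>i\<in>(UNIV::'m set). \<Sum>j\<in>(UNIV::'m set). p)"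
    using assms(2) by (intro sum_mono)
  also have "\<dots> = (real CARD('m))\<^sup>2 * p" by (simp add: power2_eq_square)
  finally show "prob (\<Union>i j. E i j) \<le> (real CARD('m))\<^sup>2 * p" .
qed

lemma deviation_event:
  fixes Y :: "'a \<Rightarrow> real"
  assumes "iid_copies M N Y Ys" "Y \<in> borel_measurable M"
  shows "{\<omega> \<in> space M. s < \<bar>sample_mean N (\<lambda>i. Ys i \<omega>) - \<mu>\<bar>} \<in> events"
proof -
  have "(\<lambda>\<omega>. \<Sum>i\<in>{1..N}. Ys i \<omega>) \<in> borel_measurable M"
    using iid_copies_real(2)[OF assms] by (intro borel_measurable_sum) auto
  then have [measurable]: "(\<lambda>\<omega>. sample_mean N (\<lambda>i. Ys i \<omega>)) \<in> borel_measurable M"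
    unfolding sample_mean_def by simp
  show ?thesis by measurable
qed

text \<open>Integrability of \<open>X\<close>, obtained coordinate by coordinate from the
  subgaussian bounds, is what makes \<open>expectation X = 0\<close> say something about marginals:
  the default value of the integral is 0 too.\<close>

lemma vector_expectation_inner:
  fixes X :: "'a \<Rightarrow> real^'n"
  assumes "subgaussian_const M K X" "(\<integral>\<omega>. outer (X \<omega>) (X \<omega>) \<partial>M) = Q" "sym_pos_def Q" "0 < K"
  shows "expectation (\<lambda>\<omega>. v \<bullet> X \<omega>) = v \<bullet> expectation X"
proof -
  have X: "X \<in> borel_measurable M" using assms(1) by (simp add: subgaussian_const_def)
  have "integrable M (\<lambda>\<omega>. w \<bullet> X \<omega>)" if "w \<noteq> 0" for w
  proof -
    have "psi2_le M (K * sqrt (\<integral>\<omega>. (w \<bullet> X \<omega>)\<^sup>2 \<partial>M)) (\<lambda>\<omega>. w \<bullet> X \<omega>)"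
      using assms(1) that by (simp add: subgaussian_const_def)
    then show ?thesis by (rule psi2_integrable)
  qed
  then have "integrable M (\<lambda>\<omega>. \<Sum>b\<in>Basis. (X \<omega> \<bullet> b) *\<^sub>R b)"
    by (intro Bochner_Integration.integrable_sum) (auto simp: nonzero_Basis inner_commute)
  then have "integrable M X"
    by (simp add: euclidean_representation)
  then show ?thesis by (simp add: integral_inner_right)
qed

lemma unit_marginal:
  fixes A :: "real^'m^'m"
  assumes "subgaussian_const M K X" "expectation (\<lambda>\<omega>. outer (X \<omega>) (X \<omega>)) = Q" "sym_pos_def Q"
    and "0 < K" "A ** Q ** transpose A = mat 1"
  shows "psi2_le M K (\<lambda>\<omega>. row a A \<bullet> X \<omega>)"
proof (rule subgaussian_marginal[OF assms(1-4)])
  have "row a A \<bullet> (Q *v row a A) = 1" by (simp add: assms(5) mat_def flip: row_quadratic)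
  then show "row a A \<bullet> (Q *v row a A) \<le> 1" "row a A \<noteq> 0" by auto
qed

text \<open>Diagonal entries of \<open>Q\<close> are at most its norm, so coordinates divided by the
  square root of the norm have second moment at most 1. A deviation \<beta> of their products is a
  deviation \<open>\<beta> * matrix_infnorm Q\<close> of the original entries.\<close>

lemma scaled_axis_marginal:
  fixes Q :: "real^'m^'m"
  assumes "subgaussian_const M K X" "expectation (\<lambda>\<omega>. outer (X \<omega>) (X \<omega>)) = Q" "sym_pos_def Q" "0 < K"
  shows "0 < matrix_infnorm Q"
    and "psi2_le M K (\<lambda>\<omega>. ((1 / sqrt (matrix_infnorm Q)) *\<^sub>R axis a 1) \<bullet> X \<omega>)"
proof -
  have "0 < axis b 1 \<bullet> (Q *v axis b 1)" for b
    using assms(3) by (simp add: sym_pos_def_def axis_eq_0_iff)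
  then have "0 < Q $ b $ b" for b
    by (simp add: matrix_vector_mult_basis column_def inner_axis')
  moreover have "Q $ b $ b \<le> matrix_infnorm Q" for b
    using entry_le_matrix_infnorm[of Q b b] by simp
  ultimately show q: "0 < matrix_infnorm Q"
    using order.strict_trans2 by blast
  show "psi2_le M K (\<lambda>\<omega>. ((1 / sqrt (matrix_infnorm Q)) *\<^sub>R axis a 1) \<bullet> X \<omega>)"
  proof (rule subgaussian_marginal[OF assms])
    show "(1 / sqrt (matrix_infnorm Q)) *\<^sub>R axis a 1 \<bullet> (Q *v ((1 / sqrt (matrix_infnorm Q)) *\<^sub>R axis a 1)) \<le> 1"
      using q entry_le_matrix_infnorm[of Q a a] by (subst scaled_axis_quadratic) auto
    show "(1 / sqrt (matrix_infnorm Q)) *\<^sub>R axis a (1::real) \<noteq> 0"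
      using q by (simp add: axis_eq_0_iff)
  qed
qed

lemma covariance_entry_le:
  fixes Q :: "real^'m^'m"
  assumes q: "0 < q" and "s \<le> \<beta>"
    and "\<bar>sample_mean N (\<lambda>i. (((1 / sqrt q) *\<^sub>R axis a 1) \<bullet> x i) * (((1 / sqrt q) *\<^sub>R axis b 1) \<bullet> x i))
      - ((1 / sqrt q) *\<^sub>R axis a 1) \<bullet> (Q *v ((1 / sqrt q) *\<^sub>R axis b 1))\<bar> \<le> s"
  shows "\<bar>Q $ a $ b - sample_mean N (\<lambda>i. outer (x i) (x i)) $ a $ b\<bar> \<le> \<beta> * q"
proof -
  have m: "sample_mean N (\<lambda>i. (((1 / sqrt q) *\<^sub>R axis a 1) \<bullet> x i) * (((1 / sqrt q) *\<^sub>R axis b 1) \<bullet> x i))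
      = sample_mean N (\<lambda>i. outer (x i) (x i)) $ a $ b / q"
    using q by (simp add: sample_mean_outer_entry outer_def inner_axis' sample_mean_def sum_divide_distrib mult_ac
        flip: real_sqrt_mult)
  have "q \<noteq> 0" using q by simp
  have "\<bar>sample_mean N (\<lambda>i. outer (x i) (x i)) $ a $ b / q - Q $ a $ b / q\<bar> \<le> s"
    using assms(3) q unfolding m scaled_axis_quadratic[OF \<open>q \<noteq> 0\<close>] by simp
  also have "sample_mean N (\<lambda>i. outer (x i) (x i)) $ a $ b / q - Q $ a $ b / q
      = (sample_mean N (\<lambda>i. outer (x i) (x i)) $ a $ b - Q $ a $ b) / q"
    by (simp add: diff_divide_distrib)
  finally have "\<bar>sample_mean N (\<lambda>i. outer (x i) (x i)) $ a $ b - Q $ a $ b\<bar> \<le> s * q"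
    using q by (simp add: pos_divide_le_eq)
  also have "\<dots> \<le> \<beta> * q" using q assms(2) by (intro mult_right_mono) auto
  finally show ?thesis by (simp add: abs_minus_commute)
qed

lemma exp_moment_mono_rate:
  assumes "(\<integral>\<^sup>+\<omega>. ennreal (exp (a' * \<bar>Y \<omega>\<bar>)) \<partial>M) \<le> ennreal D'" "a \<le> a'" "D' \<le> D"
  shows "(\<integral>\<^sup>+\<omega>. ennreal (exp (a * \<bar>Y \<omega>\<bar>)) \<partial>M) \<le> ennreal D"
proof -
  have "(\<integral>\<^sup>+\<omega>. ennreal (exp (a * \<bar>Y \<omega>\<bar>)) \<partial>M) \<le> (\<integral>\<^sup>+\<omega>. ennreal (exp (a' * \<bar>Y \<omega>\<bar>)) \<partial>M)"
    using assms(2) by (intro nn_integral_mono ennreal_leI) (simp add: mult_right_mono)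
  also have "\<dots> \<le> ennreal D" using assms(1,3) by (meson ennreal_leI order_trans)
  finally show ?thesis .
qed

text \<open>Three kinds of deviation are excluded: of products of scaled coordinates, for the matrix
  block, and of whitened products and whitened means, for the noise block. The rates are
  \<open>1 / K\<^sup>2\<close> for products and \<open>1 / K\<close> for means; with
  \<open>a\<close> the smaller one, a single \<open>\<theta>\<close> serves all three.\<close>

lemma noise_block_tilde:
  fixes sig eps :: "'a \<Rightarrow> real^'m" and S :: "real^'m^'m"
  assumes S: "sym_pos_def S" and sig: "subgaussian_const M K sig" and eps: "subgaussian_const M K eps"
    and eps2: "expectation (\<lambda>\<omega>. outer (eps \<omega>) (eps \<omega>)) = matrix_inv S"
    and sig1: "expectation sig = 0" and sig2: "expectation (\<lambda>\<omega>. outer (sig \<omega>) (sig \<omega>)) = S"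
    and N: "1 \<le> N"
    and iid: "iid_copies M N (\<lambda>\<omega>. (sig \<omega>, eps \<omega>)) (\<lambda>i \<omega>. (sigs i \<omega>, epss i \<omega>))"
    and K: "0 < K" and \<beta>: "0 < \<beta>" "\<beta> \<le> b"
    and a: "a = min (1 / K) (1 / K\<^sup>2)" and \<theta>: "\<theta> = min (a / (2 * b)) (a\<^sup>2 / (16 * (4 * exp 4)))"
  obtains E where "E \<in> events"
    "prob E \<le> 6 * (real CARD('m))\<^sup>2 * exp (- (\<theta> / (2 * (real CARD('m))\<^sup>2)) * (\<beta>\<^sup>2 * real N))"
    "\<And>\<omega> i j. \<omega> \<in> space M - E \<Longrightarrow>
      \<bar>matrix_inv S $ i $ j - sample_mean N (\<lambda>i. outer (epss i \<omega>) (epss i \<omega>)) $ i $ j\<bar>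
        \<le> \<beta> * matrix_infnorm (matrix_inv S)"
    "\<And>\<omega>. \<omega> \<in> space M - E \<Longrightarrow>
      infnorm (sample_mean N (\<lambda>i. outer (epss i \<omega>) (epss i \<omega>)) *v sample_mean N (\<lambda>i. sigs i \<omega>))
        \<le> \<beta> * (1 + \<beta>) * matrix_infnorm (inv_sqrt S)"
proof -
  define Q where "Q = matrix_inv S"
  define R where "R = inv_sqrt S"
  obtain T where RT: "R ** T = mat 1" and TQT: "T ** Q ** transpose T = mat 1"
    and RSR: "R ** S ** transpose R = mat 1"
    unfolding R_def Q_def using whitening_matrix[OF S] by blast
  have Rsym: "transpose R = R" using inv_sqrt(1)[OF S] by (simp add: R_def sym_pos_def_def)
  note Q = sym_pos_def_inverse(3)[OF S, folded Q_def]
  note eps2 = eps2[folded Q_def]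
  have [measurable]: "sig \<in> borel_measurable M" "eps \<in> borel_measurable M"
    using sig eps by (auto simp: subgaussian_const_def)
  define k where "k = real CARD('m)"
  have k: "1 \<le> k" by (simp add: k_def Suc_le_eq)
  \<comment> \<open>The noise estimate adds up \<open>CARD('m)\<close> deviations, hence the
    division; its square reappears in the rate.\<close>
  define s where "s = \<beta> / k"
  have s: "0 < s" "s \<le> \<beta>" "\<beta> = k * s"
    using \<beta> k by (auto simp: s_def divide_le_eq)
  have sb: "s \<le> b" using s(2) \<beta>(2) by simp
  have apos: "0 < a" using K by (simp add: a)
  define p where "p = 2 * exp (- (\<theta> / 2) * s\<^sup>2 * real N)"
  define V where "V v w = {\<omega> \<in> space M.
    s < \<bar>sample_mean N (\<lambda>i. (v \<bullet> epss i \<omega>) * (w \<bullet> epss i \<omega>)) - v \<bullet> (Q *v w)\<bar>}" for v w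
  define W where "W r = {\<omega> \<in> space M. s < \<bar>sample_mean N (\<lambda>i. r \<bullet> sigs i \<omega>) - 0\<bar>}" for r
  have V: "V v w \<in> events" "prob (V v w) \<le> p"
    if vw: "psi2_le M K (\<lambda>\<omega>. v \<bullet> eps \<omega>)" "psi2_le M K (\<lambda>\<omega>. w \<bullet> eps \<omega>)" for v w
  proof -
    have iid': "iid_copies M N (\<lambda>\<omega>. (v \<bullet> eps \<omega>) * (w \<bullet> eps \<omega>)) (\<lambda>i \<omega>. (v \<bullet> epss i \<omega>) * (w \<bullet> epss i \<omega>))"
      using iid_copies_compose[OF iid, of "\<lambda>z. (v \<bullet> snd z) * (w \<bullet> snd z)"]
      by (simp add: borel_measurable_continuous_onI continuous_intros)
    note mean = second_moment_bilinear[OF eps2 Q, of v w]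
    show "V v w \<in> events" unfolding V_def by (rule deviation_event[OF iid']) simp
    show "prob (V v w) \<le> p" unfolding V_def p_def
    proof (rule sample_mean_tail_exp[OF iid' _ mean N _ apos _ s(1) sb \<theta>])
      show "integrable M (\<lambda>\<omega>. (v \<bullet> eps \<omega>) * (w \<bullet> eps \<omega>))" by (rule psi2_product(1)[OF vw])
      show "(\<integral>\<^sup>+\<omega>. ennreal (exp (a * \<bar>(v \<bullet> eps \<omega>) * (w \<bullet> eps \<omega>) - v \<bullet> (Q *v w)\<bar>)) \<partial>M) \<le> ennreal (4 * exp 4)"
        by (rule exp_moment_mono_rate[OF psi2_product(2)[OF vw, unfolded mean]]) (simp_all add: a)
    qed simp
  qed
  have W: "W r \<in> events" "prob (W r) \<le> p" if r: "psi2_le M K (\<lambda>\<omega>. r \<bullet> sig \<omega>)" for r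
  proof -
    have iid': "iid_copies M N (\<lambda>\<omega>. r \<bullet> sig \<omega>) (\<lambda>i \<omega>. r \<bullet> sigs i \<omega>)"
      using iid_copies_compose[OF iid, of "\<lambda>z. r \<bullet> fst z"]
      by (simp add: borel_measurable_continuous_onI continuous_intros)
    have mean: "expectation (\<lambda>\<omega>. r \<bullet> sig \<omega>) = 0"
      using vector_expectation_inner[OF sig sig2 S K] sig1 by simp
    show "W r \<in> events" unfolding W_def by (rule deviation_event[OF iid']) simp
    show "prob (W r) \<le> p" unfolding W_def p_def
    proof (rule sample_mean_tail_exp[OF iid' _ mean N _ apos _ s(1) sb \<theta>])
      show "integrable M (\<lambda>\<omega>. r \<bullet> sig \<omega>)" by (rule psi2_integrable[OF r])
      have "exp 1 \<le> exp (4::real)" by simp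
      then have "2 * exp 1 \<le> 4 * exp (4::real)" using exp_gt_zero[of "4::real"] by linarith
      then show "(\<integral>\<^sup>+\<omega>. ennreal (exp (a * \<bar>r \<bullet> sig \<omega> - 0\<bar>)) \<partial>M) \<le> ennreal (4 * exp 4)"
        using exp_moment_mono_rate[OF psi2_integrable(2)[OF r], of a "4 * exp 4"] by (simp add: a)
    qed simp
  qed
  define v where "v i = (1 / sqrt (matrix_infnorm Q)) *\<^sub>R (axis i 1 :: real^'m)" for i
  note q = scaled_axis_marginal[OF eps eps2 Q K, folded v_def]
  \<comment> \<open>\<open>W\<close> is repeated for each \<open>j\<close> so that one union over
    pairs suffices: each pair costs \<open>3 * p\<close>, and the two-sided factor 2 in
    \<open>p\<close> makes this 6.\<close>
  define E where "E = (\<Union>i j. V (v i) (v j) \<union> V (row i T) (row j T) \<union> W (row i R))"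
  show ?thesis
  proof
    note VT = V[OF unit_marginal[OF eps eps2 Q K TQT] unit_marginal[OF eps eps2 Q K TQT]]
    note Vv = V[OF q(2) q(2)]
    note WR = W[OF unit_marginal[OF sig sig2 S K RSR]]
    have ev: "V (v i) (v j) \<union> V (row i T) (row j T) \<union> W (row i R) \<in> events" for i j
      using VT(1) Vv(1) WR(1) by blast
    have pr: "prob (V (v i) (v j) \<union> V (row i T) (row j T) \<union> W (row i R)) \<le> 3 * p" for i j
      using VT Vv WR measure_Un_le[of "V (v i) (v j)" M "V (row i T) (row j T)"]
        measure_Un_le[of "V (v i) (v j) \<union> V (row i T) (row j T)" M "W (row i R)"]
      by (smt (verit) sets.Un)
    show "E \<in> events" unfolding E_def by (rule prob_UN_pairs_le(1)[OF ev pr])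
    have "prob E \<le> k\<^sup>2 * (3 * p)" unfolding E_def k_def by (rule prob_UN_pairs_le(2)[OF ev pr])
    also have "\<dots> = 6 * k\<^sup>2 * exp (- (\<theta> / (2 * k\<^sup>2)) * (\<beta>\<^sup>2 * real N))"
      by (simp add: p_def s_def power_divide mult_ac)
    finally show "prob E \<le> 6 * (real CARD('m))\<^sup>2 * exp (- (\<theta> / (2 * (real CARD('m))\<^sup>2)) * (\<beta>\<^sup>2 * real N))"
      by (simp add: k_def)
    fix \<omega> assume \<omega>: "\<omega> \<in> space M - E"
    have "\<omega> \<notin> V (v i) (v j)" "\<omega> \<notin> V (row i T) (row j T)" "\<omega> \<notin> W (row i R)" for i j
      using \<omega> by (auto simp: E_def)
    with \<omega> have good:
      "\<bar>sample_mean N (\<lambda>l. (v i \<bullet> epss l \<omega>) * (v j \<bullet> epss l \<omega>)) - v i \<bullet> (Q *v v j)\<bar> \<le> s"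
      "\<bar>sample_mean N (\<lambda>l. (row i T \<bullet> epss l \<omega>) * (row j T \<bullet> epss l \<omega>)) - row i T \<bullet> (Q *v row j T)\<bar> \<le> s"
      "\<bar>sample_mean N (\<lambda>l. row i R \<bullet> sigs l \<omega>)\<bar> \<le> s" for i j
      by (auto simp: V_def W_def not_less)
    show "\<bar>matrix_inv S $ i $ j - sample_mean N (\<lambda>i. outer (epss i \<omega>) (epss i \<omega>)) $ i $ j\<bar>
        \<le> \<beta> * matrix_infnorm (matrix_inv S)" for i j
      using covariance_entry_le[OF q(1) s(2) good(1)[unfolded v_def]] by (simp add: Q_def)
    show "infnorm (sample_mean N (\<lambda>i. outer (epss i \<omega>) (epss i \<omega>)) *v sample_mean N (\<lambda>i. sigs i \<omega>))
        \<le> \<beta> * (1 + \<beta>) * matrix_infnorm (inv_sqrt S)"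
      unfolding R_def[symmetric]
    proof (rule infnorm_tilde_noise_le[OF RT Rsym _ _ good(3)])
      show "\<bar>sample_mean N (\<lambda>l. (row i T \<bullet> epss l \<omega>) * (row j T \<bullet> epss l \<omega>)) - (mat 1 :: real^'m^'m) $ i $ j\<bar> \<le> s" for i j
        using good(2)[of i j] by (simp add: TQT flip: row_quadratic)
    qed (use s in \<open>simp_all add: k_def\<close>)
  qed
qed

text \<open>The noise block consists of triple products, for which the 2/3 rate is available. Pair
  products are estimated at the same rate, so that the result covers every positive
  \<open>\<beta>\<close>.\<close>

lemma noise_block_hat:
  fixes sig eps :: "'a \<Rightarrow> real^'m" and S :: "real^'m^'m"
  assumes S: "sym_pos_def S" and sig: "subgaussian_const M K sig" and eps: "subgaussian_const M K eps"
    and ind: "indep_var borel eps borel sig"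
    and eps2: "expectation (\<lambda>\<omega>. outer (eps \<omega>) (eps \<omega>)) = matrix_inv S"
    and sig1: "expectation sig = 0" and sig2: "expectation (\<lambda>\<omega>. outer (sig \<omega>) (sig \<omega>)) = S"
    and N: "1 \<le> N"
    and iid: "iid_copies M N (\<lambda>\<omega>. (sig \<omega>, eps \<omega>)) (\<lambda>i \<omega>. (sigs i \<omega>, epss i \<omega>))"
    and K: "0 < K" and \<beta>: "0 < \<beta>"
  obtains E where "E \<in> events"
    "prob E \<le> 2 * (real CARD('m))\<^sup>2 * two_thirds_const (1 / K\<^sup>2) (4 * exp (4 + 1 / K\<^sup>2))
      * exp (- (1 / (2 * K\<^sup>2 * real CARD('m) powr (2/3))) * (\<beta> powr (2/3) * real N powr (1/3)))"
    "\<And>\<omega> i j. \<omega> \<in> space M - E \<Longrightarrow>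
      \<bar>matrix_inv S $ i $ j - sample_mean N (\<lambda>i. outer (epss i \<omega>) (epss i \<omega>)) $ i $ j\<bar>
        \<le> \<beta> * matrix_infnorm (matrix_inv S)"
    "\<And>\<omega>. \<omega> \<in> space M - E \<Longrightarrow>
      infnorm (sample_mean N (\<lambda>i. outer (epss i \<omega>) (epss i \<omega>) *v sigs i \<omega>))
        \<le> \<beta> * matrix_infnorm (inv_sqrt S)"
proof -
  define Q where "Q = matrix_inv S"
  define R where "R = inv_sqrt S"
  obtain T where RT: "R ** T = mat 1" and TQT: "T ** Q ** transpose T = mat 1"
    and RSR: "R ** S ** transpose R = mat 1"
    unfolding R_def Q_def using whitening_matrix[OF S] by blast
  have Rsym: "transpose R = R" using inv_sqrt(1)[OF S] by (simp add: R_def sym_pos_def_def)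
  note Q = sym_pos_def_inverse(3)[OF S, folded Q_def]
  note eps2 = eps2[folded Q_def]
  have [measurable]: "sig \<in> borel_measurable M" "eps \<in> borel_measurable M"
    using sig eps by (auto simp: subgaussian_const_def)
  define k where "k = real CARD('m)"
  have k: "1 \<le> k" by (simp add: k_def Suc_le_eq)
  define s where "s = \<beta> / k"
  have s: "0 < s" "s \<le> \<beta>" "\<beta> = k * s"
    using \<beta> k by (auto simp: s_def divide_le_eq)
  have K2: "0 < 1 / K\<^sup>2" using K by simp
  define C where "C = two_thirds_const (1 / K\<^sup>2) (4 * exp (4 + 1 / K\<^sup>2))"
  define p where "p = C * exp (- (1 / K\<^sup>2 / 2) * (s powr (2/3) * real N powr (1/3)))"
  define V where "V v w = {\<omega> \<in> space M.
    s < \<bar>sample_mean N (\<lambda>i. (v \<bullet> epss i \<omega>) * (w \<bullet> epss i \<omega>)) - v \<bullet> (Q *v w)\<bar>}" for v w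
  define W where "W v w r = {\<omega> \<in> space M.
    s < \<bar>sample_mean N (\<lambda>i. (v \<bullet> epss i \<omega>) * (w \<bullet> epss i \<omega>) * (r \<bullet> sigs i \<omega>)) - 0\<bar>}" for v w r
  have V: "V v w \<in> events" "prob (V v w) \<le> p"
    if vw: "psi2_le M K (\<lambda>\<omega>. v \<bullet> eps \<omega>)" "psi2_le M K (\<lambda>\<omega>. w \<bullet> eps \<omega>)" for v w
  proof -
    have iid': "iid_copies M N (\<lambda>\<omega>. (v \<bullet> eps \<omega>) * (w \<bullet> eps \<omega>)) (\<lambda>i \<omega>. (v \<bullet> epss i \<omega>) * (w \<bullet> epss i \<omega>))"
      using iid_copies_compose[OF iid, of "\<lambda>z. (v \<bullet> snd z) * (w \<bullet> snd z)"]
      by (simp add: borel_measurable_continuous_onI continuous_intros)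
    note mean = second_moment_bilinear[OF eps2 Q, of v w]
    show "V v w \<in> events" unfolding V_def by (rule deviation_event[OF iid']) simp
    show "prob (V v w) \<le> p" unfolding V_def p_def C_def
    proof (rule sample_mean_tail_two_thirds[OF iid' _ mean N _ K2 _ s(1)])
      show "integrable M (\<lambda>\<omega>. (v \<bullet> eps \<omega>) * (w \<bullet> eps \<omega>))" by (rule psi2_product(1)[OF vw])
    qed (use psi2_product_two_thirds[OF vw, unfolded mean] in simp_all)
  qed
  have W: "W v w r \<in> events" "prob (W v w r) \<le> p"
    if vwr: "psi2_le M K (\<lambda>\<omega>. v \<bullet> eps \<omega>)" "psi2_le M K (\<lambda>\<omega>. w \<bullet> eps \<omega>)" "psi2_le M K (\<lambda>\<omega>. r \<bullet> sig \<omega>)" for v w r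
  proof -
    have iid': "iid_copies M N (\<lambda>\<omega>. (v \<bullet> eps \<omega>) * (w \<bullet> eps \<omega>) * (r \<bullet> sig \<omega>))
        (\<lambda>i \<omega>. (v \<bullet> epss i \<omega>) * (w \<bullet> epss i \<omega>) * (r \<bullet> sigs i \<omega>))"
      using iid_copies_compose[OF iid, of "\<lambda>z. (v \<bullet> snd z) * (w \<bullet> snd z) * (r \<bullet> fst z)"]
      by (simp add: borel_measurable_continuous_onI continuous_intros)
    have "indep_var borel ((\<lambda>x. (v \<bullet> x) * (w \<bullet> x)) \<circ> eps) borel ((\<lambda>x. r \<bullet> x) \<circ> sig)"
      by (rule indep_var_compose[OF ind]) (simp_all add: borel_measurable_continuous_onI continuous_intros)
    then have ind': "indep_var borel (\<lambda>\<omega>. (v \<bullet> eps \<omega>) * (w \<bullet> eps \<omega>)) borel (\<lambda>\<omega>. r \<bullet> sig \<omega>)"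
      by (simp add: comp_def)
    have int: "integrable M (\<lambda>\<omega>. (v \<bullet> eps \<omega>) * (w \<bullet> eps \<omega>))" "integrable M (\<lambda>\<omega>. r \<bullet> sig \<omega>)"
      using psi2_product(1)[OF vwr(1,2)] psi2_integrable(1)[OF vwr(3)] by auto
    \<comment> \<open>Independence of \<open>eps\<close> and \<open>sig\<close> splits off the noise
      marginal, whose mean is 0, so the triple products are centred and their deviation is measured
      from 0.\<close>
    have "expectation (\<lambda>\<omega>. r \<bullet> sig \<omega>) = 0"
      using vector_expectation_inner[OF sig sig2 S K] sig1 by simp
    then have mean: "expectation (\<lambda>\<omega>. (v \<bullet> eps \<omega>) * (w \<bullet> eps \<omega>) * (r \<bullet> sig \<omega>)) = 0"
      using indep_var_lebesgue_integral[OF ind' int] by simp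
    show "W v w r \<in> events" unfolding W_def by (rule deviation_event[OF iid']) simp
    show "prob (W v w r) \<le> p" unfolding W_def p_def C_def
    proof (rule sample_mean_tail_two_thirds[OF iid' _ mean N _ K2 _ s(1)])
      show "integrable M (\<lambda>\<omega>. (v \<bullet> eps \<omega>) * (w \<bullet> eps \<omega>) * (r \<bullet> sig \<omega>))"
        by (rule indep_var_integrable[OF ind' int])
    qed (use psi2_triple_two_thirds[OF vwr] in simp_all)
  qed
  define v where "v i = (1 / sqrt (matrix_infnorm Q)) *\<^sub>R (axis i 1 :: real^'m)" for i
  note q = scaled_axis_marginal[OF eps eps2 Q K, folded v_def]
  define E where "E = (\<Union>i j. V (v i) (v j) \<union> W (row i T) (row j T) (row j R))"
  show ?thesis
  proof
    note mT = unit_marginal[OF eps eps2 Q K TQT]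
    note VV = V[OF q(2) q(2)]
    note WW = W[OF mT mT unit_marginal[OF sig sig2 S K RSR]]
    have ev: "V (v i) (v j) \<union> W (row i T) (row j T) (row j R) \<in> events" for i j
      using VV(1) WW(1) by blast
    have pr: "prob (V (v i) (v j) \<union> W (row i T) (row j T) (row j R)) \<le> 2 * p" for i j
      using VV WW measure_Un_le[of "V (v i) (v j)" M "W (row i T) (row j T) (row j R)"]
      by (smt (verit))
    show "E \<in> events" unfolding E_def by (rule prob_UN_pairs_le(1)[OF ev pr])
    have "prob E \<le> k\<^sup>2 * (2 * p)" unfolding E_def k_def by (rule prob_UN_pairs_le(2)[OF ev pr])
    also have "\<dots> = 2 * k\<^sup>2 * C * exp (- (1 / (2 * K\<^sup>2 * k powr (2/3))) * (\<beta> powr (2/3) * real N powr (1/3)))"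
      using \<beta> k by (simp add: p_def s_def powr_divide mult_ac)
    finally show "prob E \<le> 2 * (real CARD('m))\<^sup>2 * two_thirds_const (1 / K\<^sup>2) (4 * exp (4 + 1 / K\<^sup>2))
      * exp (- (1 / (2 * K\<^sup>2 * real CARD('m) powr (2/3))) * (\<beta> powr (2/3) * real N powr (1/3)))"
      by (simp only: k_def C_def)
    fix \<omega> assume \<omega>: "\<omega> \<in> space M - E"
    have "\<omega> \<notin> V (v i) (v j)" "\<omega> \<notin> W (row i T) (row j T) (row j R)" for i j
      using \<omega> by (auto simp: E_def)
    with \<omega> have good:
      "\<bar>sample_mean N (\<lambda>l. (v i \<bullet> epss l \<omega>) * (v j \<bullet> epss l \<omega>)) - v i \<bullet> (Q *v v j)\<bar> \<le> s"
      "\<bar>sample_mean N (\<lambda>l. (row i T \<bullet> epss l \<omega>) * (row j T \<bullet> epss l \<omega>) * (row j R \<bullet> sigs l \<omega>))\<bar> \<le> s" for i j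
      by (auto simp: V_def W_def not_less)
    show "\<bar>matrix_inv S $ i $ j - sample_mean N (\<lambda>i. outer (epss i \<omega>) (epss i \<omega>)) $ i $ j\<bar>
        \<le> \<beta> * matrix_infnorm (matrix_inv S)" for i j
      using covariance_entry_le[OF q(1) s(2) good(1)[unfolded v_def]] by (simp add: Q_def)
    show "infnorm (sample_mean N (\<lambda>i. outer (epss i \<omega>) (epss i \<omega>) *v sigs i \<omega>))
        \<le> \<beta> * matrix_infnorm (inv_sqrt S)"
      unfolding R_def[symmetric]
      by (rule infnorm_hat_noise_le[OF RT Rsym good(2)]) (use s in \<open>simp add: k_def\<close>)
  qed
qed

end

section \<open>Failure probabilities\<close>

text \<open>A number \<open>p\<close> in the unit interval is at most \<open>p powr r\<close> for \<open>r \<le> 1\<close>; here \<open>r\<close> is chosen such that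
  \<open>C powr r\<close> is at most 2.\<close>

lemma absorb_constant:
  fixes c0 C :: real
  assumes "0 < c0"
  obtains c where "0 < c"
    "\<And>c' p s m. c' \<le> c \<Longrightarrow> p \<le> 1 \<Longrightarrow> 0 \<le> s \<Longrightarrow> p \<le> C * exp (- c0 * s) \<Longrightarrow> 2 \<le> m \<Longrightarrow> p \<le> m * exp (- c' * s)"
proof
  \<comment> \<open>Raising \<open>C\<close> to at least 2 gives \<open>r \<le> 1\<close>, and then
    \<open>C1 powr r\<close> equals 2.\<close>
  define C1 where "C1 = max C 2"
  have C1: "C \<le> C1" "2 \<le> C1" by (auto simp: C1_def)
  define r where "r = ln 2 / ln C1"
  have lnC: "0 < ln C1" "ln 2 \<le> ln C1" using C1 by auto
  then have r: "0 < r" "r \<le> 1" by (auto simp: r_def)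
  then show "0 < r * c0" using assms by simp
  fix c' p s m :: real
  assume *: "c' \<le> r * c0" "p \<le> 1" "0 \<le> s" "p \<le> C * exp (- c0 * s)" "2 \<le> m"
  have "p \<le> 2 * exp (- (r * c0) * s)"
  proof (cases "0 < p")
    case True
    have "p \<le> p powr r" using True r * powr_mono'[of r 1 p] by simp
    also have "\<dots> \<le> (C1 * exp (- c0 * s)) powr r"
    proof (rule powr_mono2)
      have "C * exp (- c0 * s) \<le> C1 * exp (- c0 * s)" using C1 by (intro mult_right_mono) auto
      with * show "p \<le> C1 * exp (- c0 * s)" by linarith
    qed (use True r in auto)
    also have "\<dots> = exp (r * (ln C1 - c0 * s))"
      using C1 by (simp add: powr_def ln_mult)
    also have "r * (ln C1 - c0 * s) = ln 2 - r * c0 * s"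
      using lnC by (simp add: r_def field_simps)
    also have "exp (ln 2 - r * c0 * s) = 2 * exp (- (r * c0) * s)"
      by (simp add: exp_diff exp_minus field_simps)
    finally show ?thesis .
  next
    case False
    then show ?thesis using exp_gt_zero[of "- (r * c0) * s"] by linarith
  qed
  also have "\<dots> \<le> m * exp (- c' * s)"
    using * by (intro mult_mono) (auto intro: mult_right_mono)
  finally show "p \<le> m * exp (- c' * s)" .
qed

lemma two_exp_rates_le:
  fixes c1 c2 :: real
  assumes "p \<le> C1 * exp (- c1 * s)" "q \<le> C2 * exp (- c2 * s)" "0 \<le> C1" "0 \<le> C2" "0 \<le> s"
  shows "p + q \<le> (C1 + C2) * exp (- min c1 c2 * s)"
proof -
  have "C1 * exp (- c1 * s) \<le> C1 * exp (- min c1 c2 * s)"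
    "C2 * exp (- c2 * s) \<le> C2 * exp (- min c1 c2 * s)"
    using assms by (auto intro!: mult_left_mono mult_right_mono)
  with assms show ?thesis by (simp add: distrib_right)
qed

section \<open>The two blocks as separate samples\<close>

lemma (in prob_space) indep4_imp_indep_var:
  assumes "indep4 M X1 X2 X3 X4"
  shows "indep_var borel X2 borel X1" "indep_var borel X4 borel X3"
proof -
  have X [measurable]: "X1 \<in> borel_measurable M" "X2 \<in> borel_measurable M"
      "X3 \<in> borel_measurable M" "X4 \<in> borel_measurable M"
    and prod: "\<And>A1 A2 A3 A4. \<lbrakk>A1 \<in> sets borel; A2 \<in> sets borel; A3 \<in> sets borel; A4 \<in> sets borel\<rbrakk> \<Longrightarrow>
        prob {\<omega> \<in> space M. X1 \<omega> \<in> A1 \<and> X2 \<omega> \<in> A2 \<and> X3 \<omega> \<in> A3 \<and> X4 \<omega> \<in> A4} =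
        prob {\<omega> \<in> space M. X1 \<omega> \<in> A1} * prob {\<omega> \<in> space M. X2 \<omega> \<in> A2} *
        prob {\<omega> \<in> space M. X3 \<omega> \<in> A3} * prob {\<omega> \<in> space M. X4 \<omega> \<in> A4}"
    using assms unfolding indep4_def by blast+
  \<comment> \<open>The dimension is left open because the two pairs may take values in spaces of
    different dimension. Preimages of Borel sets form an intersection-stable family, on which the
    product rule is checked.\<close>
  have gen: "indep_var borel X borel Y"
    if [measurable]: "X \<in> borel_measurable M" "Y \<in> borel_measurable M"
      and XY: "\<And>A B. A \<in> sets borel \<Longrightarrow> B \<in> sets borel \<Longrightarrow>
        prob {\<omega> \<in> space M. X \<omega> \<in> A \<and> Y \<omega> \<in> B} = prob {\<omega> \<in> space M. X \<omega> \<in> A} * prob {\<omega> \<in> space M. Y \<omega> \<in> B}"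
    for X :: "'a \<Rightarrow> real^'z" and Y :: "'a \<Rightarrow> real^'z"
    unfolding indep_var_eq
  proof (intro conjI indep_set_sigma_sets indep_setI)
    fix U V assume "U \<in> {X -` A \<inter> space M |A. A \<in> sets borel}" "V \<in> {Y -` A \<inter> space M |A. A \<in> sets borel}"
    then obtain A B where AB: "A \<in> sets borel" "B \<in> sets borel"
      and "U = {\<omega> \<in> space M. X \<omega> \<in> A}" "V = {\<omega> \<in> space M. Y \<omega> \<in> B}" by auto
    moreover from this have "U \<inter> V = {\<omega> \<in> space M. X \<omega> \<in> A \<and> Y \<omega> \<in> B}" by auto
    ultimately show "prob (U \<inter> V) = prob U * prob V" using XY[OF AB] by simp
  next
    have stable: "Int_stable {Z -` A \<inter> space M |A. A \<in> sets borel}" for Z :: "'a \<Rightarrow> real^'z"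
    proof (rule Int_stableI)
      fix U V assume "U \<in> {Z -` A \<inter> space M |A. A \<in> sets borel}" "V \<in> {Z -` A \<inter> space M |A. A \<in> sets borel}"
      then obtain A B where "A \<in> sets borel" "B \<in> sets borel" "U = Z -` A \<inter> space M" "V = Z -` B \<inter> space M"
        by auto
      then show "U \<inter> V \<in> {Z -` A \<inter> space M |A. A \<in> sets borel}"
        by (intro CollectI exI[of _ "A \<inter> B"]) auto
    qed
    show "Int_stable {X -` A \<inter> space M |A. A \<in> sets borel}" "Int_stable {Y -` A \<inter> space M |A. A \<in> sets borel}"
      by (rule stable)+
  qed (auto intro: measurable_sets)
  show "indep_var borel X2 borel X1"
  proof (rule gen)
    fix A B :: "(real^'b) set" assume "A \<in> sets borel" "B \<in> sets borel"
    from prod[OF this(2,1), of UNIV UNIV]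
    show "prob {\<omega> \<in> space M. X2 \<omega> \<in> A \<and> X1 \<omega> \<in> B} = prob {\<omega> \<in> space M. X2 \<omega> \<in> A} * prob {\<omega> \<in> space M. X1 \<omega> \<in> B}"
      by (simp add: prob_space conj_commute mult.commute)
  qed (rule X)+
  show "indep_var borel X4 borel X3"
  proof (rule gen)
    fix A B :: "(real^'c) set" assume "A \<in> sets borel" "B \<in> sets borel"
    from prod[OF _ _ this(2,1), of UNIV UNIV]
    show "prob {\<omega> \<in> space M. X4 \<omega> \<in> A \<and> X3 \<omega> \<in> B} = prob {\<omega> \<in> space M. X4 \<omega> \<in> A} * prob {\<omega> \<in> space M. X3 \<omega> \<in> B}"
      by (simp add: prob_space conj_commute mult.commute)
  qed (rule X)+
qed

lemma (in prob_space) iid_copies_pairs: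
  fixes X1 X2 :: "'a \<Rightarrow> real^'k" and X3 X4 :: "'a \<Rightarrow> real^'n"
  assumes "indep4 M X1 X2 X3 X4"
    and iid: "iid_copies M N (\<lambda>\<omega>. (X1 \<omega>, X2 \<omega>, X3 \<omega>, X4 \<omega>)) (\<lambda>i \<omega>. (Y1 i \<omega>, Y2 i \<omega>, Y3 i \<omega>, Y4 i \<omega>))"
  shows "iid_copies M N (\<lambda>\<omega>. (X1 \<omega>, X2 \<omega>)) (\<lambda>i \<omega>. (Y1 i \<omega>, Y2 i \<omega>))"
    "iid_copies M N (\<lambda>\<omega>. (X3 \<omega>, X4 \<omega>)) (\<lambda>i \<omega>. (Y3 i \<omega>, Y4 i \<omega>))"
proof -
  have [measurable]: "X1 \<in> borel_measurable M" "X2 \<in> borel_measurable M"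
      "X3 \<in> borel_measurable M" "X4 \<in> borel_measurable M"
    using assms(1) by (auto simp: indep4_def)
  have Z: "(\<lambda>\<omega>. (X1 \<omega>, X2 \<omega>, X3 \<omega>, X4 \<omega>)) \<in> borel_measurable M"
    by (intro borel_measurable_Pair) auto
  show "iid_copies M N (\<lambda>\<omega>. (X1 \<omega>, X2 \<omega>)) (\<lambda>i \<omega>. (Y1 i \<omega>, Y2 i \<omega>))"
    using iid_copies_compose[OF iid Z, of "\<lambda>z. (fst z, fst (snd z))"]
    by (simp add: borel_measurable_continuous_onI continuous_intros)
  show "iid_copies M N (\<lambda>\<omega>. (X3 \<omega>, X4 \<omega>)) (\<lambda>i \<omega>. (Y3 i \<omega>, Y4 i \<omega>))"
    using iid_copies_compose[OF iid Z, of "\<lambda>z. (fst (snd (snd z)), snd (snd (snd z)))"]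
    by (simp add: borel_measurable_continuous_onI continuous_intros)
qed

section \<open>Combination of the blocks\<close>

text \<open>The maximum over the four blocks is bounded by the sum of their nonnegative bounds,
  which is why four norms are added in the claims. The factor \<open>1 + \<beta>\<close> of the
  first claim is carried by \<open>r1\<close> and \<open>r2\<close>.\<close>

lemma infnorm_P_map_diff_le:
  fixes B :: "real^'k^'k" and C :: "real^'n^'n"
  assumes "\<And>i j. \<bar>matrix_inv Sig $ i $ j - B $ i $ j\<bar> \<le> \<beta> * q1"
    "\<And>i j. \<bar>matrix_inv Gam $ i $ j - C $ i $ j\<bar> \<le> \<beta> * q2"
    and "infnorm e \<le> \<beta> * r1" "infnorm z \<le> \<beta> * r2"
    and nonneg: "0 \<le> \<beta>" "0 \<le> q1" "0 \<le> q2" "0 \<le> r1" "0 \<le> r2"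
  shows "infnorm (P_map Sig Gam - stack B C e z) \<le> \<beta> * (q1 + q2 + r1 + r2)"
proof -
  have le: "\<beta> * q1 \<le> \<beta> * (q1 + q2 + r1 + r2)" "\<beta> * q2 \<le> \<beta> * (q1 + q2 + r1 + r2)"
    "\<beta> * r1 \<le> \<beta> * (q1 + q2 + r1 + r2)" "\<beta> * r2 \<le> \<beta> * (q1 + q2 + r1 + r2)"
    using nonneg by (auto intro!: mult_left_mono)
  show ?thesis unfolding P_map_def
  proof (rule infnorm_stack_diff_le)
    show "infnorm (0 - e) \<le> \<beta> * (q1 + q2 + r1 + r2)" "infnorm (0 - z) \<le> \<beta> * (q1 + q2 + r1 + r2)"
      using assms(3,4) le(3,4) by (simp_all add: infnorm_neg)
  qed (blast intro: order_trans assms(1,2) le(1,2))+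
qed

text \<open>Admissibility and minimality hold almost surely only; comparing events up to null sets
  lets these exceptions cost nothing.\<close>

lemma (in prob_space) failure_probability_le:
  assumes E: "E1 \<in> events" "E2 \<in> events" and Y: "Y \<in> borel_measurable M"
    and AE: "AE \<omega> in M. \<omega> \<notin> E1 \<longrightarrow> \<omega> \<notin> E2 \<longrightarrow> Y \<omega> \<le> (r :: real)"
  shows "1 - prob {\<omega> \<in> space M. Y \<omega> \<le> r} \<le> prob E1 + prob E2"
proof -
  have "1 - prob {\<omega> \<in> space M. Y \<omega> \<le> r} = prob (space M - {\<omega> \<in> space M. Y \<omega> \<le> r})"
    using Y by (subst prob_compl) auto
  also have "\<dots> \<le> prob (E1 \<union> E2)"
    using AE E by (intro finite_measure_mono_AE) auto
  also have "\<dots> \<le> prob E1 + prob E2" using E by (rule measure_Un_le)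
  finally show ?thesis .
qed

lemma infnorm_error_le:
  assumes "lipschitz_well_posed F d u0 A L" "P \<in> A" "P' \<in> A"
    "opt_system F d u0 P u = 0" "opt_system F d u0 P' u' = 0"
    and "infnorm (P - P') \<le> \<beta> * q"
  shows "infnorm (u - u') \<le> \<beta> * L * q"
proof -
  have "infnorm (u - u') \<le> L * infnorm (P - P')"
    by (rule lipschitz_well_posed_le[OF assms(1-5)])
  also have "\<dots> \<le> L * (\<beta> * q)"
    using assms(1,6) by (intro mult_left_mono) (auto simp: lipschitz_well_posed_def)
  finally show ?thesis by (simp add: mult_ac)
qed

lemma borel_measurable_infnorm_diff:
  fixes f :: "'a \<Rightarrow> real^'n"
  assumes "f \<in> borel_measurable M"
  shows "(\<lambda>\<omega>. infnorm (u - f \<omega>)) \<in> borel_measurable M"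
  by (rule borel_measurable_continuous_on[OF _ assms, of "\<lambda>x. infnorm (u - x)"])
    (intro continuous_intros)

text \<open>The order of quantifiers makes \<open>c\<close> depend only on \<open>K\<close>,
  \<open>b\<close> and the two dimensions. The restriction \<open>\<beta> \<le> b\<close> is
  attached to the first claim alone.\<close>

theorem lemma6:
  fixes K b :: real
  assumes "0 < K" and "0 < b"
  shows "\<exists>c>0.
    \<forall>(M :: 'a measure) (Sig :: real^'k^'k) (Gam :: real^'n^'n)
      (sig :: 'a \<Rightarrow> real^'k) (eps :: 'a \<Rightarrow> real^'k) (del :: 'a \<Rightarrow> real^'n) (lam :: 'a \<Rightarrow> real^'n)
      (N :: nat) (sigs :: nat \<Rightarrow> 'a \<Rightarrow> real^'k) (epss :: nat \<Rightarrow> 'a \<Rightarrow> real^'k)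
      (dels :: nat \<Rightarrow> 'a \<Rightarrow> real^'n) (lams :: nat \<Rightarrow> 'a \<Rightarrow> real^'n)
      (d :: real^'k) (u0 :: real^'n) (F :: real^'n \<Rightarrow> real^'k)
      (A :: ('k, 'n) params set) (L :: real)
      (u_map :: real^'n) (u_tilde :: 'a \<Rightarrow> real^'n) (u_hat :: 'a \<Rightarrow> real^'n) (\<beta> :: real).
    prob_space M \<and> sym_pos_def Sig \<and> sym_pos_def Gam
    \<and> subgaussian_const M K sig \<and> subgaussian_const M K eps
    \<and> subgaussian_const M K del \<and> subgaussian_const M K lam
    \<and> indep4 M sig eps del lam
    \<and> (\<integral>\<omega>. sig \<omega> \<partial>M) = 0 \<and> (\<integral>\<omega>. outer (eps \<omega>) (eps \<omega>) \<partial>M) = matrix_inv Sig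
    \<and> (\<integral>\<omega>. del \<omega> \<partial>M) = 0 \<and> (\<integral>\<omega>. outer (lam \<omega>) (lam \<omega>) \<partial>M) = matrix_inv Gam
    \<and> (\<integral>\<omega>. outer (sig \<omega>) (sig \<omega>) \<partial>M) = Sig
    \<and> (\<integral>\<omega>. outer (del \<omega>) (del \<omega>) \<partial>M) = Gam
    \<and> 1 \<le> N
    \<and> iid_copies M N (\<lambda>\<omega>. (sig \<omega>, eps \<omega>, del \<omega>, lam \<omega>))
        (\<lambda>i \<omega>. (sigs i \<omega>, epss i \<omega>, dels i \<omega>, lams i \<omega>))
    \<and> (\<forall>u. F differentiable (at u))
    \<and> lipschitz_well_posed F d u0 A L
    \<and> P_map Sig Gam \<in> A
    \<and> (AE \<omega> in M. P_tilde N (\<lambda>i. sigs i \<omega>) (\<lambda>i. epss i \<omega>) (\<lambda>i. dels i \<omega>) (\<lambda>i. lams i \<omega>) \<in> A)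
    \<and> (AE \<omega> in M. P_hat N (\<lambda>i. sigs i \<omega>) (\<lambda>i. epss i \<omega>) (\<lambda>i. dels i \<omega>) (\<lambda>i. lams i \<omega>) \<in> A)
    \<and> is_arg_min (map_objective F (matrix_inv Sig) (matrix_inv Gam) d u0) (\<lambda>_. True) u_map
    \<and> u_tilde \<in> borel_measurable M
    \<and> (AE \<omega> in M. is_arg_min
          (tilde_objective F d u0 N (\<lambda>i. sigs i \<omega>) (\<lambda>i. epss i \<omega>) (\<lambda>i. dels i \<omega>) (\<lambda>i. lams i \<omega>))
          (\<lambda>_. True) (u_tilde \<omega>))
    \<and> u_hat \<in> borel_measurable M
    \<and> (AE \<omega> in M. is_arg_min
          (hat_objective F d u0 N (\<lambda>i. sigs i \<omega>) (\<lambda>i. epss i \<omega>) (\<lambda>i. dels i \<omega>) (\<lambda>i. lams i \<omega>))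
          (\<lambda>_. True) (u_hat \<omega>))
    \<and> 0 < \<beta>
    \<longrightarrow>
    (\<beta> \<le> b \<longrightarrow>
      measure M {\<omega> \<in> space M. infnorm (u_map - u_tilde \<omega>)
          \<le> \<beta> * L * (matrix_infnorm (matrix_inv Sig) + matrix_infnorm (matrix_inv Gam)
              + (1 + \<beta>) * matrix_infnorm (inv_sqrt Sig) + (1 + \<beta>) * matrix_infnorm (inv_sqrt Gam))}
        \<ge> 1 - 10 * zeta c N \<beta>)
    \<and> measure M {\<omega> \<in> space M. infnorm (u_map - u_hat \<omega>)
          \<le> \<beta> * L * (matrix_infnorm (matrix_inv Sig) + matrix_infnorm (matrix_inv Gam)
              + matrix_infnorm (inv_sqrt Sig) + matrix_infnorm (inv_sqrt Gam))}
        \<ge> 1 - 4 * zeta c N \<beta> - 2 * real CARD('k) * zeta_pow (2/3) c N \<beta>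
            - 2 * real CARD('n) * zeta_pow (2/3) c N \<beta>"
proof -
  define k n where "k = real CARD('k)" and "n = real CARD('n)"
  have kn: "1 \<le> k" "1 \<le> n" by (auto simp: k_def n_def Suc_le_eq)
  define a where "a = min (1 / K) (1 / K\<^sup>2)"
  define \<theta> where "\<theta> = min (a / (2 * b)) (a\<^sup>2 / (16 * (4 * exp 4)))"
  define H where "H = two_thirds_const (1 / K\<^sup>2) (4 * exp (4 + 1 / K\<^sup>2))"
  \<comment> \<open>\<open>t\<close> and \<open>h\<close> are the rates of the two noise estimates
    for a block of dimension \<open>m\<close>.\<close>
  define t where "t m = \<theta> / (2 * m\<^sup>2)" for m :: real
  define h where "h m = 1 / (2 * K\<^sup>2 * m powr (2/3))" for m :: real
  have H: "0 \<le> H" using \<open>0 < K\<close> by (simp add: H_def two_thirds_const_def)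
  have "0 < a" using assms by (simp add: a_def)
  then have "0 < \<theta>" using assms by (simp add: \<theta>_def)
  then have "0 < min (t k) (t n)" using kn by (simp add: t_def)
  from absorb_constant[OF this, of "6 * k\<^sup>2 + 6 * n\<^sup>2"]
  obtain c1 where c1: "0 < c1" "\<And>c' p s m. c' \<le> c1 \<Longrightarrow> p \<le> 1 \<Longrightarrow> 0 \<le> s \<Longrightarrow>
      p \<le> (6 * k\<^sup>2 + 6 * n\<^sup>2) * exp (- min (t k) (t n) * s) \<Longrightarrow> 2 \<le> m \<Longrightarrow> p \<le> m * exp (- c' * s)"
    by blast
  have "0 < min (h k) (h n)" using kn \<open>0 < K\<close> by (simp add: h_def)
  from absorb_constant[OF this, of "2 * k\<^sup>2 * H + 2 * n\<^sup>2 * H"]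
  obtain c2 where c2: "0 < c2" "\<And>c' p s m. c' \<le> c2 \<Longrightarrow> p \<le> 1 \<Longrightarrow> 0 \<le> s \<Longrightarrow>
      p \<le> (2 * k\<^sup>2 * H + 2 * n\<^sup>2 * H) * exp (- min (h k) (h n) * s) \<Longrightarrow> 2 \<le> m \<Longrightarrow> p \<le> m * exp (- c' * s)"
    by blast
  define c where "c = min c1 c2"
  have c: "0 < c" "c \<le> c1" "c \<le> c2" using c1(1) c2(1) by (auto simp: c_def)
  show ?thesis
  proof (rule exI[of _ c], rule conjI[OF c(1)], intro allI impI, elim conjE, intro conjI impI)
    fix M :: "'a measure" and Sig :: "real^'k^'k" and Gam :: "real^'n^'n"
      and sig eps :: "'a \<Rightarrow> real^'k" and del lam :: "'a \<Rightarrow> real^'n"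
      and N :: nat and sigs epss :: "nat \<Rightarrow> 'a \<Rightarrow> real^'k" and dels lams :: "nat \<Rightarrow> 'a \<Rightarrow> real^'n"
      and d :: "real^'k" and u0 :: "real^'n" and F :: "real^'n \<Rightarrow> real^'k"
      and A :: "('k, 'n) params set" and L :: real
      and u_map :: "real^'n" and u_tilde u_hat :: "'a \<Rightarrow> real^'n" and \<beta> :: real
    assume "prob_space M" and Sig: "sym_pos_def Sig" and Gam: "sym_pos_def Gam"
      and sub: "subgaussian_const M K sig" "subgaussian_const M K eps"
        "subgaussian_const M K del" "subgaussian_const M K lam"
      and ind: "indep4 M sig eps del lam"
      and sig1: "(\<integral>\<omega>. sig \<omega> \<partial>M) = 0" and eps2: "(\<integral>\<omega>. outer (eps \<omega>) (eps \<omega>) \<partial>M) = matrix_inv Sig"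
      and del1: "(\<integral>\<omega>. del \<omega> \<partial>M) = 0" and lam2: "(\<integral>\<omega>. outer (lam \<omega>) (lam \<omega>) \<partial>M) = matrix_inv Gam"
      and sig2: "(\<integral>\<omega>. outer (sig \<omega>) (sig \<omega>) \<partial>M) = Sig"
      and del2: "(\<integral>\<omega>. outer (del \<omega>) (del \<omega>) \<partial>M) = Gam"
      and N: "1 \<le> N"
      and iid: "iid_copies M N (\<lambda>\<omega>. (sig \<omega>, eps \<omega>, del \<omega>, lam \<omega>))
        (\<lambda>i \<omega>. (sigs i \<omega>, epss i \<omega>, dels i \<omega>, lams i \<omega>))"
      and F: "\<forall>u. F differentiable (at u)"
      and lip: "lipschitz_well_posed F d u0 A L"
      and PA: "P_map Sig Gam \<in> A"
      and tA: "AE \<omega> in M. P_tilde N (\<lambda>i. sigs i \<omega>) (\<lambda>i. epss i \<omega>) (\<lambda>i. dels i \<omega>) (\<lambda>i. lams i \<omega>) \<in> A"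
      and hA: "AE \<omega> in M. P_hat N (\<lambda>i. sigs i \<omega>) (\<lambda>i. epss i \<omega>) (\<lambda>i. dels i \<omega>) (\<lambda>i. lams i \<omega>) \<in> A"
      and u_map: "is_arg_min (map_objective F (matrix_inv Sig) (matrix_inv Gam) d u0) (\<lambda>_. True) u_map"
      and tm: "u_tilde \<in> borel_measurable M"
      and u_tilde: "AE \<omega> in M. is_arg_min
          (tilde_objective F d u0 N (\<lambda>i. sigs i \<omega>) (\<lambda>i. epss i \<omega>) (\<lambda>i. dels i \<omega>) (\<lambda>i. lams i \<omega>))
          (\<lambda>_. True) (u_tilde \<omega>)"
      and hm: "u_hat \<in> borel_measurable M"
      and u_hat: "AE \<omega> in M. is_arg_min
          (hat_objective F d u0 N (\<lambda>i. sigs i \<omega>) (\<lambda>i. epss i \<omega>) (\<lambda>i. dels i \<omega>) (\<lambda>i. lams i \<omega>))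
          (\<lambda>_. True) (u_hat \<omega>)"
      and \<beta>: "0 < \<beta>"
    interpret prob_space M by fact
    note iid2 = iid_copies_pairs[OF ind iid]
    note map_sol = map_minimizer_solves[OF Sig Gam F[rule_format] u_map]
    note nn = matrix_infnorm_nonneg
    show "measure M {\<omega> \<in> space M. infnorm (u_map - u_tilde \<omega>)
          \<le> \<beta> * L * (matrix_infnorm (matrix_inv Sig) + matrix_infnorm (matrix_inv Gam)
              + (1 + \<beta>) * matrix_infnorm (inv_sqrt Sig) + (1 + \<beta>) * matrix_infnorm (inv_sqrt Gam))}
        \<ge> 1 - 10 * zeta c N \<beta>" if \<beta>b: "\<beta> \<le> b"
    proof -
      let ?r = "\<beta> * L * (matrix_infnorm (matrix_inv Sig) + matrix_infnorm (matrix_inv Gam)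
              + (1 + \<beta>) * matrix_infnorm (inv_sqrt Sig) + (1 + \<beta>) * matrix_infnorm (inv_sqrt Gam))"
      obtain E1 where E1: "E1 \<in> events" "prob E1 \<le> 6 * k\<^sup>2 * exp (- t k * (\<beta>\<^sup>2 * real N))"
        "\<And>\<omega> i j. \<omega> \<in> space M - E1 \<Longrightarrow>
          \<bar>matrix_inv Sig $ i $ j - sample_mean N (\<lambda>i. outer (epss i \<omega>) (epss i \<omega>)) $ i $ j\<bar>
            \<le> \<beta> * matrix_infnorm (matrix_inv Sig)"
        "\<And>\<omega>. \<omega> \<in> space M - E1 \<Longrightarrow>
          infnorm (sample_mean N (\<lambda>i. outer (epss i \<omega>) (epss i \<omega>)) *v sample_mean N (\<lambda>i. sigs i \<omega>))
            \<le> \<beta> * (1 + \<beta>) * matrix_infnorm (inv_sqrt Sig)"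
        using noise_block_tilde[OF Sig sub(1,2) eps2 sig1 sig2 N iid2(1) \<open>0 < K\<close> \<beta> \<beta>b a_def \<theta>_def]
        unfolding k_def t_def by blast
      obtain E2 where E2: "E2 \<in> events" "prob E2 \<le> 6 * n\<^sup>2 * exp (- t n * (\<beta>\<^sup>2 * real N))"
        "\<And>\<omega> i j. \<omega> \<in> space M - E2 \<Longrightarrow>
          \<bar>matrix_inv Gam $ i $ j - sample_mean N (\<lambda>i. outer (lams i \<omega>) (lams i \<omega>)) $ i $ j\<bar>
            \<le> \<beta> * matrix_infnorm (matrix_inv Gam)"
        "\<And>\<omega>. \<omega> \<in> space M - E2 \<Longrightarrow>
          infnorm (sample_mean N (\<lambda>i. outer (lams i \<omega>) (lams i \<omega>)) *v sample_mean N (\<lambda>i. dels i \<omega>))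
            \<le> \<beta> * (1 + \<beta>) * matrix_infnorm (inv_sqrt Gam)"
        using noise_block_tilde[OF Gam sub(3,4) lam2 del1 del2 N iid2(2) \<open>0 < K\<close> \<beta> \<beta>b a_def \<theta>_def]
        unfolding n_def t_def by blast
      have "1 - prob {\<omega> \<in> space M. infnorm (u_map - u_tilde \<omega>) \<le> ?r} \<le> prob E1 + prob E2"
      proof (rule failure_probability_le[OF E1(1) E2(1) borel_measurable_infnorm_diff[OF tm]])
        show "AE \<omega> in M. \<omega> \<notin> E1 \<longrightarrow> \<omega> \<notin> E2 \<longrightarrow> infnorm (u_map - u_tilde \<omega>) \<le> ?r"
          using tA u_tilde AE_space
        proof eventually_elim
          case (elim \<omega>)
          show ?case
          proof (intro impI)
            assume "\<omega> \<notin> E1" "\<omega> \<notin> E2"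
            with elim have \<omega>: "\<omega> \<in> space M - E1" "\<omega> \<in> space M - E2" by auto
            show "infnorm (u_map - u_tilde \<omega>) \<le> ?r"
            proof (rule infnorm_error_le[OF lip PA elim(1) map_sol tilde_minimizer_solves[OF F[rule_format] elim(2)]])
              show "infnorm (P_map Sig Gam - P_tilde N (\<lambda>i. sigs i \<omega>) (\<lambda>i. epss i \<omega>) (\<lambda>i. dels i \<omega>) (\<lambda>i. lams i \<omega>))
                \<le> \<beta> * (matrix_infnorm (matrix_inv Sig) + matrix_infnorm (matrix_inv Gam)
                  + (1 + \<beta>) * matrix_infnorm (inv_sqrt Sig) + (1 + \<beta>) * matrix_infnorm (inv_sqrt Gam))"
                unfolding P_tilde_def Let_def
                by (rule infnorm_P_map_diff_le)
                  (use E1(3,4)[OF \<omega>(1)] E2(3,4)[OF \<omega>(2)] \<beta> in \<open>simp_all add: nn mult.assoc\<close>)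
            qed
          qed
        qed
      qed
      also have "\<dots> \<le> (6 * k\<^sup>2 + 6 * n\<^sup>2) * exp (- min (t k) (t n) * (\<beta>\<^sup>2 * real N))"
        by (rule two_exp_rates_le[OF E1(2) E2(2)]) auto
      \<comment> \<open>Absorption reaches any prefactor that is at least 2, here 10.\<close>
      finally have "1 - prob {\<omega> \<in> space M. infnorm (u_map - u_tilde \<omega>) \<le> ?r}
          \<le> 10 * exp (- c * (\<beta>\<^sup>2 * real N))"
        by (intro c1(2)[OF c(2)]) auto
      then show ?thesis by (simp add: zeta_def mult.assoc)
    qed
    show "measure M {\<omega> \<in> space M. infnorm (u_map - u_hat \<omega>)
          \<le> \<beta> * L * (matrix_infnorm (matrix_inv Sig) + matrix_infnorm (matrix_inv Gam)
              + matrix_infnorm (inv_sqrt Sig) + matrix_infnorm (inv_sqrt Gam))}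
        \<ge> 1 - 4 * zeta c N \<beta> - 2 * real CARD('k) * zeta_pow (2/3) c N \<beta>
            - 2 * real CARD('n) * zeta_pow (2/3) c N \<beta>"
    proof -
      let ?r = "\<beta> * L * (matrix_infnorm (matrix_inv Sig) + matrix_infnorm (matrix_inv Gam)
              + matrix_infnorm (inv_sqrt Sig) + matrix_infnorm (inv_sqrt Gam))"
      let ?s = "\<beta> powr (2/3) * real N powr (1/3)"
      note ind2 = indep4_imp_indep_var[OF ind]
      obtain E1 where E1: "E1 \<in> events" "prob E1 \<le> 2 * k\<^sup>2 * H * exp (- h k * ?s)"
        "\<And>\<omega> i j. \<omega> \<in> space M - E1 \<Longrightarrow>
          \<bar>matrix_inv Sig $ i $ j - sample_mean N (\<lambda>i. outer (epss i \<omega>) (epss i \<omega>)) $ i $ j\<bar>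
            \<le> \<beta> * matrix_infnorm (matrix_inv Sig)"
        "\<And>\<omega>. \<omega> \<in> space M - E1 \<Longrightarrow>
          infnorm (sample_mean N (\<lambda>i. outer (epss i \<omega>) (epss i \<omega>) *v sigs i \<omega>))
            \<le> \<beta> * matrix_infnorm (inv_sqrt Sig)"
        using noise_block_hat[OF Sig sub(1,2) ind2(1) eps2 sig1 sig2 N iid2(1) \<open>0 < K\<close> \<beta>]
        unfolding k_def h_def H_def by blast
      obtain E2 where E2: "E2 \<in> events" "prob E2 \<le> 2 * n\<^sup>2 * H * exp (- h n * ?s)"
        "\<And>\<omega> i j. \<omega> \<in> space M - E2 \<Longrightarrow>
          \<bar>matrix_inv Gam $ i $ j - sample_mean N (\<lambda>i. outer (lams i \<omega>) (lams i \<omega>)) $ i $ j\<bar>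
            \<le> \<beta> * matrix_infnorm (matrix_inv Gam)"
        "\<And>\<omega>. \<omega> \<in> space M - E2 \<Longrightarrow>
          infnorm (sample_mean N (\<lambda>i. outer (lams i \<omega>) (lams i \<omega>) *v dels i \<omega>))
            \<le> \<beta> * matrix_infnorm (inv_sqrt Gam)"
        using noise_block_hat[OF Gam sub(3,4) ind2(2) lam2 del1 del2 N iid2(2) \<open>0 < K\<close> \<beta>]
        unfolding n_def h_def H_def by blast
      have "1 - prob {\<omega> \<in> space M. infnorm (u_map - u_hat \<omega>) \<le> ?r} \<le> prob E1 + prob E2"
      proof (rule failure_probability_le[OF E1(1) E2(1) borel_measurable_infnorm_diff[OF hm]])
        show "AE \<omega> in M. \<omega> \<notin> E1 \<longrightarrow> \<omega> \<notin> E2 \<longrightarrow> infnorm (u_map - u_hat \<omega>) \<le> ?r"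
          using hA u_hat AE_space
        proof eventually_elim
          case (elim \<omega>)
          show ?case
          proof (intro impI)
            assume "\<omega> \<notin> E1" "\<omega> \<notin> E2"
            with elim have \<omega>: "\<omega> \<in> space M - E1" "\<omega> \<in> space M - E2" by auto
            show "infnorm (u_map - u_hat \<omega>) \<le> ?r"
            proof (rule infnorm_error_le[OF lip PA elim(1) map_sol hat_minimizer_solves[OF F[rule_format] elim(2)]])
              show "infnorm (P_map Sig Gam - P_hat N (\<lambda>i. sigs i \<omega>) (\<lambda>i. epss i \<omega>) (\<lambda>i. dels i \<omega>) (\<lambda>i. lams i \<omega>))
                \<le> \<beta> * (matrix_infnorm (matrix_inv Sig) + matrix_infnorm (matrix_inv Gam)
                  + matrix_infnorm (inv_sqrt Sig) + matrix_infnorm (inv_sqrt Gam))"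
                unfolding P_hat_def
                by (rule infnorm_P_map_diff_le)
                  (use E1(3,4)[OF \<omega>(1)] E2(3,4)[OF \<omega>(2)] \<beta> in \<open>simp_all add: nn\<close>)
            qed
          qed
        qed
      qed
      also have "\<dots> \<le> (2 * k\<^sup>2 * H + 2 * n\<^sup>2 * H) * exp (- min (h k) (h n) * ?s)"
        by (rule two_exp_rates_le[OF E1(2) E2(2)]) (use H in auto)
      \<comment> \<open>Here the prefactor is \<open>2 * k + 2 * n\<close>, which splits into the
        coefficients of the two \<open>zeta_pow\<close> terms.\<close>
      finally have "1 - prob {\<omega> \<in> space M. infnorm (u_map - u_hat \<omega>) \<le> ?r}
          \<le> (2 * k + 2 * n) * exp (- c * ?s)"
        using kn by (intro c2(2)[OF c(3)]) auto
      also have "exp (- c * ?s) = zeta_pow (2/3) c N \<beta>" by (simp add: zeta_pow_def mult.assoc)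
      finally have "1 - prob {\<omega> \<in> space M. infnorm (u_map - u_hat \<omega>) \<le> ?r}
          \<le> 2 * real CARD('k) * zeta_pow (2/3) c N \<beta> + 2 * real CARD('n) * zeta_pow (2/3) c N \<beta>"
        by (simp add: k_def n_def distrib_right)
      \<comment> \<open>All failures are charged to the \<open>zeta_pow\<close> terms; subtracting
        the positive \<open>4 * zeta c N \<beta>\<close> lowers the bound to be shown.\<close>
      moreover have "0 < zeta c N \<beta>" by (simp add: zeta_def)
      ultimately show ?thesis by linarith
    qed
  qed
qed

end
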